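(* Let $c>1$ and let $X$ be a $(c^E,c)$-operator semistable Lévy process on $\mathbb{R}^d$ with diagonal principal exponent $E_1$. (i) If $\alpha_1<d_1$, there exist constants $K_4,K_5>0$ such that for all $0<a\le1$ and $a^{\alpha_1}\le s\le1$, $$K_4a^{\alpha_1}\le\mathbb{E}[T(a,s)]\le K_5a^{\alpha_1}.$$ (ii) If $d\ge2$ and $\alpha_1>d_1$, then $d_1=1$; assume further that $E_2$ is diagonal. Then there exist constants $K_6,K_7>0$ and $a_0>0$ such that for all $0<a\le a_0$ and all $a^{\alpha_2}\le s\le1$, $$K_6a^{\rho}\le\mathbb{E}[T(a,s)]\le K_7a^{\rho},$$ where $\rho=1+\alpha_2(1-1/\alpha_1)$.
   Context: A Lévy process $X=\{X(t)\}_{t\ge0}$ on $\mathbb{R}^d$ is a stochastically continuous process with càdlàg paths and stationary independent increments, with $X(0)=0$ almost surely. For $c>1$ and a linear operator $E$ on $\mathbb{R}^d$, it is called $(c^E,c)$-operator semistable (with exponent $E$) if the distribution of $X(1)$ is full, i.e. not supported on any lower dimensional hyperplane, and $\{X(ct)\}_{t\ge0}$ and $\{c^EX(t)\}_{t\ge0}$ have the same finite-dimensional distributions, where $c^E=\sum_{n\ge0}\frac{(\log c)^n}{n!}E^n$. Spectral decomposition: factor the minimal polynomial of $E$ as $q_1\cdots q_p$, where all roots of $q_j$ have real part $a_j$ and $a_1<\dots<a_p$. Put $V_j=\operatorname{Ker}(q_j(E))$, $d_j=\dim V_j$; then $\mathbb{R}^d=V_1\oplus\dots\oplus V_p$ with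 $E$-invariant $V_j$, and $E=E_1\oplus\dots\oplus E_p$ with $E_j=E|_{V_j}$. An inner product $\langle\cdot,\cdot\rangle$ on $\mathbb{R}^d$ is fixed making the $V_j$ mutually orthogonal, and $\|x\|=\sqrt{\langle x,x\rangle}$. Put $\alpha_j=1/a_j$. Standing assumption: $X$ has no Gaussian component, in which case $0<\alpha_p<\dots<\alpha_1<2$. "$E_j$ is diagonal" means $E_j=\alpha_j^{-1}I$ with $I$ the identity on $V_j$; "diagonal principal exponent $E_1$" means this holds for $j=1$, with no restriction on the other $E_j$ unless stated. $B(0,a)$ is the closed ball of radius $a$ centered at the origin, and $T(a,s)=\int_0^s1_{B(0,a)}(X(t))\,dt$ is the sojourn time up to time $s$. *)

theory Defs
  imports "HOL-Probability.Probability" "HOL-Computational_Algebra.Polynomial"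
begin

section \<open>Linear operators\<close>

(* c^E, the series sum_n (log c)^n / n! E^n evaluated at the vector x.
   There is no normed algebra of operators in the library, so it is summed pointwise,
   which in finite dimension is the same as convergence in operator norm. *)
definition op_powr :: "real \<Rightarrow> (real^'n \<Rightarrow> real^'n) \<Rightarrow> real^'n \<Rightarrow> real^'n" where
  "op_powr c E x = (\<Sum>n. (ln c ^ n / fact n) *\<^sub>R (E ^^ n) x)"

definition poly_op :: "real poly \<Rightarrow> (real^'n \<Rightarrow> real^'n) \<Rightarrow> real^'n \<Rightarrow> real^'n" where
  "poly_op p E x = (\<Sum>i\<le>degree p. coeff p i *\<^sub>R (E ^^ i) x)"

definition is_minimal_poly :: "(real^'n \<Rightarrow> real^'n) \<Rightarrow> real poly \<Rightarrow> bool" where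
  "is_minimal_poly E m \<longleftrightarrow>
     lead_coeff m = 1 \<and> (\<forall>x. poly_op m E x = 0) \<and>
     (\<forall>r. r \<noteq> 0 \<and> (\<forall>x. poly_op r E x = 0) \<longrightarrow> degree m \<le> degree r)"

(* The minimal polynomial of E is q 1 * ... * q p, and all complex roots of the (nonconstant)
   real polynomial q j have real part a j, where a 1 < ... < a p. *)
definition spectral_factorization ::
  "(real^'n \<Rightarrow> real^'n) \<Rightarrow> nat \<Rightarrow> (nat \<Rightarrow> real poly) \<Rightarrow> (nat \<Rightarrow> real) \<Rightarrow> bool" where
  "spectral_factorization E p q a \<longleftrightarrow>
     is_minimal_poly E (\<Prod>j=1..p. q j) \<and>
     (\<forall>j\<in>{1..p}. degree (q j) > 0 \<and>
        (\<forall>z. poly (map_poly complex_of_real (q j)) z = 0 \<longrightarrow> Re z = a j)) \<and>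
     strict_mono_on {1..p} a"

definition is_inner_product :: "(real^'n \<Rightarrow> real^'n \<Rightarrow> real) \<Rightarrow> bool" where
  "is_inner_product ip \<longleftrightarrow>
     bilinear ip \<and> (\<forall>x y. ip x y = ip y x) \<and> (\<forall>x. x \<noteq> 0 \<longrightarrow> ip x x > 0)"

definition ip_cball :: "(real^'n \<Rightarrow> real^'n \<Rightarrow> real) \<Rightarrow> real \<Rightarrow> (real^'n) set" where
  "ip_cball ip r = {x. sqrt (ip x x) \<le> r}"


section \<open>Processes\<close>

definition cadlag :: "(real \<Rightarrow> 'a::topological_space) \<Rightarrow> bool" where
  "cadlag f \<longleftrightarrow> (\<forall>t\<ge>0. (f \<longlongrightarrow> f t) (at_right t)) \<and> (\<forall>t>0. \<exists>l. (f \<longlongrightarrow> l) (at_left t))"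

definition levy_process :: "'w measure \<Rightarrow> (real \<Rightarrow> 'w \<Rightarrow> real^'n) \<Rightarrow> bool" where
  "levy_process M X \<longleftrightarrow>
     prob_space M \<and>
     (\<forall>t\<ge>0. X t \<in> borel_measurable M) \<and>
     (AE \<omega> in M. X 0 \<omega> = 0) \<and>
     (\<forall>\<omega>\<in>space M. cadlag (\<lambda>t. X t \<omega>)) \<and>
     (\<forall>t\<ge>0. \<forall>\<epsilon>>0.
        ((\<lambda>s. measure M {\<omega>\<in>space M. dist (X s \<omega>) (X t \<omega>) > \<epsilon>}) \<longlongrightarrow> 0) (at t within {0..})) \<and>
     (\<forall>s\<ge>0. \<forall>t\<ge>0. distr M borel (\<lambda>\<omega>. X (s + t) \<omega> - X s \<omega>) = distr M borel (X t)) \<and>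
     (\<forall>n (t :: nat \<Rightarrow> real). 0 \<le> t 0 \<and> (\<forall>i<n. t i < t (Suc i)) \<longrightarrow>
        prob_space.indep_vars M (\<lambda>_. borel) (\<lambda>i \<omega>. X (t (Suc i)) \<omega> - X (t i) \<omega>) {..<n})"

definition full_distribution :: "(real^'n) measure \<Rightarrow> bool" where
  "full_distribution \<mu> \<longleftrightarrow>
     \<not> (\<exists>H. affine H \<and> aff_dim H < int CARD('n) \<and> (AE x in \<mu>. x \<in> H))"

definition same_fdd :: "'w measure \<Rightarrow> (real \<Rightarrow> 'w \<Rightarrow> real^'n) \<Rightarrow> (real \<Rightarrow> 'w \<Rightarrow> real^'n) \<Rightarrow> bool" where
  "same_fdd M Y Z \<longleftrightarrow>
     (\<forall>J. finite J \<and> J \<subseteq> {0..} \<longrightarrow>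
        distr M (Pi\<^sub>M J (\<lambda>_. borel)) (\<lambda>\<omega>. \<lambda>t\<in>J. Y t \<omega>) =
        distr M (Pi\<^sub>M J (\<lambda>_. borel)) (\<lambda>\<omega>. \<lambda>t\<in>J. Z t \<omega>))"

definition operator_semistable ::
  "'w measure \<Rightarrow> (real \<Rightarrow> 'w \<Rightarrow> real^'n) \<Rightarrow> real \<Rightarrow> (real^'n \<Rightarrow> real^'n) \<Rightarrow> bool" where
  "operator_semistable M X c E \<longleftrightarrow>
     levy_process M X \<and> full_distribution (distr M borel (X 1)) \<and>
     same_fdd M (\<lambda>t. X (c * t)) (\<lambda>t \<omega>. op_powr c E (X t \<omega>))"

(* mu is infinitely divisible with Levy-Khintchine triplet (A, nu, b): Gaussian covariance A,
   Levy measure nu, drift b relative to the truncation function indicator (cball 0 1). *)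
definition levy_triplet ::
  "(real^'n) measure \<Rightarrow> real^'n^'n \<Rightarrow> (real^'n) measure \<Rightarrow> real^'n \<Rightarrow> bool" where
  "levy_triplet \<mu> A \<nu> b \<longleftrightarrow>
     transpose A = A \<and> (\<forall>u. u \<bullet> (A *v u) \<ge> 0) \<and>
     sets \<nu> = sets borel \<and> emeasure \<nu> {0} = 0 \<and> integrable \<nu> (\<lambda>x. min 1 ((norm x)\<^sup>2)) \<and>
     (\<forall>u. (CLINT x|\<mu>. iexp (u \<bullet> x)) =
        exp (\<i> * complex_of_real (b \<bullet> u) - complex_of_real (u \<bullet> (A *v u)) / 2 +
          (CLINT x|\<nu>. iexp (u \<bullet> x) - 1 - \<i> * complex_of_real (u \<bullet> x) * indicator (cball 0 1) x)))"

(* The triplet of X 1 exists and is unique by the Levy-Khintchine theorem, so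
   it suffices to ask for some triplet with vanishing Gaussian part. *)
definition no_gaussian_component :: "'w measure \<Rightarrow> (real \<Rightarrow> 'w \<Rightarrow> real^'n) \<Rightarrow> bool" where
  "no_gaussian_component M X \<longleftrightarrow> (\<exists>\<nu> b. levy_triplet (distr M borel (X 1)) 0 \<nu> b)"

definition sojourn_time ::
  "(real^'n \<Rightarrow> real^'n \<Rightarrow> real) \<Rightarrow> (real \<Rightarrow> 'w \<Rightarrow> real^'n) \<Rightarrow> real \<Rightarrow> real \<Rightarrow> 'w \<Rightarrow> real" where
  "sojourn_time ip X r s \<omega> = (LBINT t:{0..s}. indicator (ip_cball ip r) (X t \<omega>))"

end

(*
By Fubini, the expected sojourn time is the integral over time of the small ball probability
P(norm (X t) <= r), and semistability relates X (c^k t) to X t through the flow exp(k log c E).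
A root-by-root argument on the minimal polynomial shows that exp(-t E) decays like exp(-a_1 t),
and like exp(-a_2 t) on the complement of V_1; this alone gives the lower bound in (i).

Upper bounds for small balls come from characteristic functions: fullness and the scaling relation
force the characteristic function of X 1 to decay faster than any power, and testing against a
Gaussian kernel yields P(norm (X t) <= r) <= K r^n t^(-b_1-...-b_n) for n independent functionals
that are left eigenvectors of E with eigenvalues b_i.  Here n <= 2 suffices, because a Levy process
without Gaussian part has a_1 > 1/2 (its log-characteristic function is o(|u|^2)).

For the lower bound in (ii) let Y be the one-dimensional component of X along V_1.  If phi_t denotes
the characteristic function of Y t, then L = int exp(-t) phi_t dt has nonnegative real part, and L is
close to 1 near the origin.  Integrating L against a Gaussian density shows that Y spends a time of
order eta in [-eta, eta]; the part of that time during which the remaining components are large is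
controlled by splitting X t into two independent halves.
*)
theory Submission
  imports Defs "HOL-Computational_Algebra.Fundamental_Theorem_Algebra"
begin

section \<open>Exponential generating functions and decay\<close>

text \<open>Sharp powers of the radius require decay rates without polynomial factors. Diagonality
  makes the slowest block act as a scalar, and the polynomial factors coming from Jordan blocks of
  the remaining part are absorbed by the strict gap between real parts. The exponent rho in (ii),
  with b_j = 1 / \<alpha>_j: the components outside V_1 leave a ball of radius r at a time of order
  r^(1/b_2). Run time faster by q = r^(-1/b_2); the V_1 coordinate then has to stay within r
  q^(b_1), which it does for a time of that order, and undoing the time change divides by q. The
  result is r q^(b_1 - 1) = r^(1 + (1 - b_1)/b_2). The obstacle in that lower bound is that phi_t is
  complex and may oscillate, as X need not be symmetric. Averaging over an exponential time replaces
  it by 1 / (1 + psi), where psi is the Levy exponent, whose real part is nonnegative; this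
  positivity is all that survives, but it permits discarding the frequencies that are not
  controlled.\<close>

definition exp_bounded :: "(nat \<Rightarrow> complex) \<Rightarrow> bool" where
  "exp_bounded e \<longleftrightarrow> (\<exists>K R. \<forall>n. norm (e n) \<le> K * R ^ n)"

text \<open>Differentiation shifts the sequence (\<open>egf_deriv\<close>), so a linear recurrence
  for \<open>e\<close> becomes a constant-coefficient differential equation for
  \<open>egf e\<close>. Geometric growth of \<open>e\<close> makes the series entire.\<close>

definition egf :: "(nat \<Rightarrow> complex) \<Rightarrow> complex \<Rightarrow> complex" where
  "egf e z = (\<Sum>n. (e n / fact n) * z ^ n)"

lemma exp_bounded_Suc:
  assumes "exp_bounded e" shows "exp_bounded (\<lambda>n. e (Suc n))"
proof -
  obtain K R where "\<And>n. norm (e n) \<le> K * R ^ n"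
    using assms unfolding exp_bounded_def by blast
  then have "norm (e (Suc n)) \<le> (K * R) * R ^ n" for n
    by (metis mult.assoc power_Suc)
  then show ?thesis unfolding exp_bounded_def by blast
qed

lemma exp_bounded_add:
  assumes "exp_bounded e" "exp_bounded f" shows "exp_bounded (\<lambda>n. e n + f n)"
proof -
  obtain K R where 1: "\<And>n. norm (e n) \<le> K * R ^ n"
    using assms unfolding exp_bounded_def by blast
  obtain L S where 2: "\<And>n. norm (f n) \<le> L * S ^ n"
    using assms unfolding exp_bounded_def by blast
  have "norm (e n + f n) \<le> (\<bar>K\<bar> + \<bar>L\<bar>) * (max \<bar>R\<bar> \<bar>S\<bar>) ^ n" for n
  proof -
    have "K * R ^ n \<le> \<bar>K\<bar> * \<bar>R\<bar> ^ n"
      by (metis abs_ge_self abs_mult power_abs)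
    also have "\<dots> \<le> \<bar>K\<bar> * (max \<bar>R\<bar> \<bar>S\<bar>) ^ n"
      by (intro mult_left_mono power_mono) auto
    finally have a: "norm (e n) \<le> \<bar>K\<bar> * (max \<bar>R\<bar> \<bar>S\<bar>) ^ n" using 1[of n] by simp
    have "L * S ^ n \<le> \<bar>L\<bar> * \<bar>S\<bar> ^ n"
      by (metis abs_ge_self abs_mult power_abs)
    also have "\<dots> \<le> \<bar>L\<bar> * (max \<bar>R\<bar> \<bar>S\<bar>) ^ n"
      by (intro mult_left_mono power_mono) auto
    finally have "norm (f n) \<le> \<bar>L\<bar> * (max \<bar>R\<bar> \<bar>S\<bar>) ^ n" using 2[of n] by simp
    with a show ?thesis
      using norm_triangle_ineq[of "e n" "f n"] by (simp add: distrib_right)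
  qed
  then show ?thesis unfolding exp_bounded_def by blast
qed

lemma exp_bounded_cmult:
  assumes "exp_bounded e" shows "exp_bounded (\<lambda>n. c * e n)"
proof -
  obtain K R where 1: "\<And>n. norm (e n) \<le> K * R ^ n"
    using assms unfolding exp_bounded_def by blast
  have "norm (c * e n) \<le> (norm c * K) * R ^ n" for n
    using mult_left_mono[OF 1, of "norm c" n] by (simp add: norm_mult mult.assoc)
  then show ?thesis unfolding exp_bounded_def by blast
qed

lemma egf_summable:
  assumes "exp_bounded e" shows "summable (\<lambda>n. (e n / fact n) * z ^ n)"
proof -
  obtain K R where 1: "\<And>n. norm (e n) \<le> K * R ^ n"
    using assms unfolding exp_bounded_def by blast
  have "summable (\<lambda>n. \<bar>K\<bar> * (inverse (fact n) * (\<bar>R\<bar> * norm z) ^ n))"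
    by (intro summable_mult summable_exp)
  then show ?thesis
  proof (rule summable_comparison_test')
    fix n
    have "norm (e n) \<le> \<bar>K\<bar> * \<bar>R\<bar> ^ n"
      using 1[of n] by (metis abs_ge_self abs_mult order_trans power_abs)
    then have "norm (e n) * (norm z ^ n / fact n) \<le> (\<bar>K\<bar> * \<bar>R\<bar> ^ n) * (norm z ^ n / fact n)"
      by (rule mult_right_mono) simp
    then show "norm (e n / fact n * z ^ n) \<le> \<bar>K\<bar> * (inverse (fact n) * (\<bar>R\<bar> * norm z) ^ n)"
      by (simp add: norm_mult norm_divide norm_power power_mult_distrib field_simps)
  qed
qed

lemma egf_add:
  assumes "exp_bounded e" "exp_bounded f"
  shows "egf (\<lambda>n. e n + f n) z = egf e z + egf f z"
  unfolding egf_def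
  by (subst suminf_add[OF egf_summable[OF assms(1)] egf_summable[OF assms(2)]])
     (simp add: add_divide_distrib distrib_right)

lemma egf_cmult:
  assumes "exp_bounded e"
  shows "egf (\<lambda>n. c * e n) z = c * egf e z"
  unfolding egf_def
  by (subst suminf_mult[OF egf_summable[OF assms(1)], symmetric]) (simp add: mult.assoc)

lemma egf_deriv:
  assumes "exp_bounded e"
  shows "(egf e has_field_derivative egf (\<lambda>n. e (Suc n)) z) (at z)"
proof -
  have "((\<lambda>z. \<Sum>n. (e n / fact n) * z ^ n) has_field_derivative
      (\<Sum>n. diffs (\<lambda>n. e n / fact n) n * z ^ n)) (at z)"
    by (rule termdiffs_strong_converges_everywhere) (rule egf_summable[OF assms])
  moreover have "diffs (\<lambda>n. e n / fact n) n = e (Suc n) / fact n" for n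
  proof -
    have "(1 + of_nat n :: complex) \<noteq> 0"
      by (metis of_nat_Suc of_nat_eq_0_iff nat.distinct(1) )
    then show ?thesis by (simp add: diffs_def)
  qed
  ultimately show ?thesis by (simp add: egf_def[abs_def])
qed

lemma egf_vector_deriv:
  assumes "exp_bounded e"
  shows "((\<lambda>t. egf e (of_real (-t))) has_vector_derivative - egf (\<lambda>n. e (Suc n)) (of_real (-t))) (at t)"
proof -
  have "((\<lambda>t. complex_of_real (- t)) has_vector_derivative of_real (-1)) (at t)"
    by (intro has_vector_derivative_of_real derivative_intros)
  from field_vector_diff_chain_at[OF this egf_deriv[OF assms]]
  show ?thesis by (simp add: o_def)
qed

text \<open>The negative half-line, since only the backward flow is estimated: undoing
  \<open>k\<close> scaling steps is what carries a bound at time \<open>c ^ k * t\<close> back to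
  time \<open>t\<close>.\<close>

definition edecay :: "real \<Rightarrow> (nat \<Rightarrow> complex) \<Rightarrow> bool" where
  "edecay b e \<longleftrightarrow> (\<exists>K. \<forall>t\<ge>0. norm (egf e (of_real (-t))) \<le> K * exp (- b * t))"

text \<open>With \<open>f t = egf e (- t)\<close> the hypothesis says \<open>f' + z f = O(exp (- b t))\<close>, so multiplying by
  \<open>exp (z t)\<close> and integrating costs nothing because \<open>Re z > b\<close>.\<close>

lemma edecay_factor:
  assumes e: "exp_bounded e" and z: "Re z > b"
    and d: "edecay b (\<lambda>n. e (Suc n) - z * e n)"
  shows "edecay b e"
proof -
  obtain K where K: "\<And>t. t \<ge> 0 \<Longrightarrow>
      norm (egf (\<lambda>n. e (Suc n) - z * e n) (of_real (-t))) \<le> K * exp (- b * t)"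
    using d unfolding edecay_def by blast
  define f where "f = (\<lambda>t. egf e (of_real (-t)))"
  define g where "g = (\<lambda>t. egf (\<lambda>n. e (Suc n) - z * e n) (of_real (-t)))"
  have g: "g t = egf (\<lambda>n. e (Suc n)) (of_real (-t)) - z * f t" for t
    using egf_add[OF exp_bounded_Suc[OF e] exp_bounded_cmult[OF e, of "-z"]] egf_cmult[OF e, of "-z"]
    by (simp add: g_def f_def)
  have fd: "(f has_vector_derivative - egf (\<lambda>n. e (Suc n)) (of_real (-t))) (at t)" for t
    unfolding f_def by (rule egf_vector_deriv[OF e])
  have ed: "((\<lambda>t. exp (z * of_real t)) has_vector_derivative z * exp (z * of_real t)) (at t)" for t
  proof -
    have "((\<lambda>w. exp (z * w)) has_field_derivative z * exp (z * of_real t)) (at (of_real t))"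
      by (auto intro!: derivative_eq_intros)
    moreover have "(of_real has_vector_derivative (1::complex)) (at t)"
      using has_vector_derivative_of_real[OF DERIV_ident] by simp
    ultimately show ?thesis
      using field_vector_diff_chain_at[of "of_real" 1 t "\<lambda>w. exp (z * w)"] by (simp add: o_def)
  qed
  define F where "F = (\<lambda>t. exp (z * of_real t) * f t)"
  have Fd: "(F has_vector_derivative - (exp (z * of_real t) * g t)) (at t)" for t
    unfolding F_def
    by (rule has_vector_derivative_eq_rhs[OF has_vector_derivative_mult[OF ed fd]])
       (simp add: g algebra_simps)
  define \<beta> where "\<beta> = Re z - b"
  have \<beta>: "\<beta> > 0" using z by (simp add: \<beta>_def)
  define h where "h = (\<lambda>t::real. K / \<beta> * exp (\<beta> * t))"
  have hd: "(h has_vector_derivative K * exp (\<beta> * t)) (at t)" for t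
    unfolding h_def has_real_derivative_iff_has_vector_derivative[symmetric]
    using \<beta> by (auto intro!: derivative_eq_intros)
  have K0: "K \<ge> 0" using order_trans[OF norm_ge_zero K[of 0]] by simp
  have "norm (F t - F 0) \<le> h t - h 0" if "t \<ge> 0" for t
  proof (cases "t = 0")
    case False
    with that have "0 < t" by simp
    then show ?thesis
    proof (rule differentiable_bound_general[OF _ _ _ Fd hd])
      show "continuous_on {0..t} F"
        by (meson Fd continuous_at_imp_continuous_on has_vector_derivative_continuous)
      show "continuous_on {0..t} h"
        by (meson hd continuous_at_imp_continuous_on has_vector_derivative_continuous)
      fix x assume "0 < x" "x < t"
      then have "norm (exp (z * of_real x) * g x) \<le> exp (Re z * x) * (K * exp (- b * x))"
        using K[of x] by (auto simp: norm_mult g_def intro!: mult_left_mono)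
      also have "\<dots> = K * exp (\<beta> * x)"
        by (simp add: \<beta>_def left_diff_distrib exp_diff exp_minus field_simps)
      finally show "norm (- (exp (z * of_real x) * g x)) \<le> K * exp (\<beta> * x)" by simp
    qed
  qed simp
  then have b: "norm (F t) \<le> norm (F 0) + h t" if "t \<ge> 0" for t
    using norm_triangle_ineq2[of "F t" "F 0"] that K0 \<beta>
    by (smt (verit) divide_nonneg_pos exp_ge_zero h_def mult_nonneg_nonneg)
  have "norm (f t) \<le> (norm (F 0) + K / \<beta>) * exp (- b * t)" if t: "t \<ge> 0" for t
  proof -
    have "norm (f t) = exp (- Re z * t) * norm (F t)"
      by (simp add: F_def norm_mult exp_minus)
    also have "\<dots> \<le> exp (- Re z * t) * (norm (F 0) + h t)"
      using b[OF t] by (intro mult_left_mono) auto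
    also have "\<dots> \<le> exp (- Re z * t) * ((norm (F 0) + K / \<beta>) * exp (\<beta> * t))"
    proof (rule mult_left_mono)
      have "norm (F 0) * 1 \<le> norm (F 0) * exp (\<beta> * t)"
        using \<beta> t by (intro mult_left_mono) auto
      then show "norm (F 0) + h t \<le> (norm (F 0) + K / \<beta>) * exp (\<beta> * t)"
        by (simp add: h_def distrib_right)
    qed simp
    also have "\<dots> = (norm (F 0) + K / \<beta>) * exp (- b * t)"
      by (simp add: \<beta>_def mult.left_commute mult.assoc exp_add[symmetric] algebra_simps)
    finally show ?thesis .
  qed
  then show ?thesis unfolding edecay_def f_def by blast
qed

text \<open>The polynomial \<open>P\<close> in the shift operator; on \<open>egf e\<close> it acts
  as \<open>P\<close> of the derivative.\<close>

definition shift_poly :: "complex poly \<Rightarrow> (nat \<Rightarrow> complex) \<Rightarrow> nat \<Rightarrow> complex" where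
  "shift_poly P e n = (\<Sum>i\<le>degree P. coeff P i * e (n + i))"

lemma shift_poly_le:
  assumes "degree P \<le> N" shows "shift_poly P e n = (\<Sum>i\<le>N. coeff P i * e (n + i))"
  unfolding shift_poly_def using assms
  by (intro sum.mono_neutral_left) (auto simp: coeff_eq_0)

lemma shift_poly_pCons: "shift_poly (pCons a P) e n = a * e n + shift_poly P e (Suc n)"
proof -
  have "shift_poly (pCons a P) e n = (\<Sum>i\<le>Suc (degree P). coeff (pCons a P) i * e (n + i))"
    by (rule shift_poly_le) (simp add: degree_pCons_le)
  also have "\<dots> = a * e n + shift_poly P e (Suc n)"
    unfolding sum.atMost_Suc_shift shift_poly_def by simp
  finally show ?thesis .
qed

lemma shift_poly_linear_factor:
  "shift_poly ([:-z, 1:] * P) e = shift_poly P (\<lambda>n. e (Suc n) - z * e n)"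
proof -
  have "[:-z, 1:] * P = pCons 0 P - smult z P" by simp
  moreover have "degree (pCons 0 P - smult z P) \<le> Suc (degree P)"
    by (intro degree_diff_le) (auto simp: degree_pCons_le intro: order_trans[OF degree_smult_le])
  ultimately have "shift_poly ([:-z, 1:] * P) e n
      = (\<Sum>i\<le>Suc (degree P). coeff (pCons 0 P - smult z P) i * e (n + i))" for n
    by (simp add: shift_poly_le)
  also have "\<dots>n = (\<Sum>i\<le>Suc (degree P). coeff (pCons 0 P) i * e (n + i))
       - z * (\<Sum>i\<le>Suc (degree P). coeff P i * e (n + i))" for n
    by (simp add: left_diff_distrib sum_subtractf sum_distrib_left mult.assoc del: sum.atMost_Suc)
  also have "\<dots>n = shift_poly P e (Suc n) - z * shift_poly P e n" for n
    using shift_poly_le[of P "Suc (degree P)" e n] shift_poly_le[of "pCons 0 P" "Suc (degree P)" e n]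
    by (simp add: degree_pCons_le shift_poly_pCons)
  also have "\<dots>n = shift_poly P (\<lambda>n. e (Suc n) - z * e n) n" for n
    by (simp add: shift_poly_def right_diff_distrib sum_subtractf sum_distrib_left mult.left_commute)
  finally show ?thesis by blast
qed

text \<open>Factoring \<open>P\<close> over the complex numbers, each root is removed by
  \<open>edecay_factor\<close>; the induction ranges over \<open>e\<close> as well, because removing
  a root changes the sequence. A multiple root is simply removed several times: the strict
  inequality on real parts absorbs the polynomial factor that it produces.\<close>

lemma edecay_shift_poly:
  assumes "P \<noteq> 0" "\<And>z. poly P z = 0 \<Longrightarrow> Re z > b" "exp_bounded e"
    "edecay b (shift_poly P e)"
  shows "edecay b e"
  using assms
proof (induction "degree P" arbitrary: P e)
  case 0
  then obtain a where a: "P = [:a:]" by (metis degree_0_id degree_eq_zeroE)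
  then have a0: "a \<noteq> 0" using 0 by auto
  have "shift_poly P e = (\<lambda>n. a * e n)" by (auto simp: a shift_poly_def)
  then have "egf e w = egf (shift_poly P e) w / a" for w
    using egf_cmult[OF \<open>exp_bounded e\<close>, of a w] a0 by simp
  moreover obtain K where "\<And>t. t \<ge> 0 \<Longrightarrow> norm (egf (shift_poly P e) (of_real (-t))) \<le> K * exp (- b * t)"
    using 0(5) unfolding edecay_def by blast
  ultimately have "norm (egf e (of_real (-t))) \<le> (K / norm a) * exp (- b * t)" if "t \<ge> 0" for t
    using a0 that by (simp add: norm_divide divide_right_mono)
  then show ?case unfolding edecay_def by blast
next
  case (Suc m)
  then have "\<not> constant (poly P)" by (simp add: constant_degree)
  then obtain z where z: "poly P z = 0" using fundamental_theorem_of_algebra by blast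
  then obtain P' where P': "P = [:-z, 1:] * P'" by (auto simp: poly_eq_0_iff_dvd)
  have P'0: "P' \<noteq> 0" using P' Suc by auto
  have "degree P = Suc (degree P')" using P'0 unfolding P' by (subst degree_mult_eq) auto
  then have deg: "m = degree P'" using Suc by simp
  have eb: "exp_bounded (\<lambda>n. e (Suc n) - z * e n)"
    using exp_bounded_add[OF exp_bounded_Suc[OF Suc(5)] exp_bounded_cmult[OF Suc(5), of "-z"]] by simp
  have "edecay b (\<lambda>n. e (Suc n) - z * e n)"
  proof (rule Suc(1)[OF deg P'0 _ eb])
    show "Re w > b" if "poly P' w = 0" for w using Suc(4) that P' by auto
    show "edecay b (shift_poly P' (\<lambda>n. e (Suc n) - z * e n))"
      using Suc(6) unfolding P' shift_poly_linear_factor .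
  qed
  then show ?case using edecay_factor Suc(4)[OF z] Suc(5) by blast
qed

section \<open>The flow of a linear operator\<close>

lemma linear_funpow:
  assumes "linear (E :: 'a::real_vector \<Rightarrow> 'a)" shows "linear (E ^^ n)"
proof (induction n)
  case 0 then show ?case by (simp add: linear_iff)
next
  case (Suc n) then show ?case using linear_compose[OF Suc assms] by (simp add: o_def)
qed

lemma linear_eq_sum_Basis:
  assumes "linear (L :: 'a::euclidean_space \<Rightarrow> 'b::real_vector)"
  shows "L z = (\<Sum>i\<in>Basis. (z \<bullet> i) *\<^sub>R L i)"
proof -
  have "L z = L (\<Sum>i\<in>Basis. (z \<bullet> i) *\<^sub>R i)" by (simp only: euclidean_representation)
  also have "\<dots> = (\<Sum>i\<in>Basis. (z \<bullet> i) *\<^sub>R L i)"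
    by (simp add: linear_sum[OF assms] linear_scale[OF assms])
  finally show ?thesis .
qed

lemma funpow_norm_bound:
  assumes "linear (E :: 'a::euclidean_space \<Rightarrow> 'a)"
  obtains B where "B > 0" "\<And>n x. norm ((E ^^ n) x) \<le> B ^ n * norm x"
proof -
  obtain B where B: "B > 0" "\<And>x. norm (E x) \<le> B * norm x"
    using linear_bounded_pos[OF assms] by blast
  have "norm ((E ^^ n) x) \<le> B ^ n * norm x" for n x
  proof (induction n)
    case (Suc n)
    have "norm ((E ^^ Suc n) x) \<le> B * norm ((E ^^ n) x)" using B(2) by simp
    also have "\<dots> \<le> B * (B ^ n * norm x)" using Suc B(1) by (intro mult_left_mono) auto
    finally show ?case by (simp add: mult.assoc)
  qed simp
  with B(1) that show ?thesis by blast
qed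

text \<open>This is exp(t E) for real \<open>t\<close>; \<open>op_powr c E\<close> is its value at
  \<open>ln c\<close>. A continuous parameter opens the semigroup law and the decay rates to
  differentiation.\<close>

definition flow :: "('a::euclidean_space \<Rightarrow> 'a) \<Rightarrow> real \<Rightarrow> 'a \<Rightarrow> 'a" where
  "flow E t x = (\<Sum>n. (t ^ n / fact n) *\<^sub>R (E ^^ n) x)"

lemma op_powr_eq_flow: "op_powr c E = flow E (ln c)"
  by (simp add: fun_eq_iff op_powr_def flow_def)

text \<open>Matrix coefficients turn vector recurrences into scalar ones; complex values allow the
  complex roots of the minimal polynomial to be removed one by one.\<close>

definition orbit :: "('a::euclidean_space \<Rightarrow> 'a) \<Rightarrow> 'a \<Rightarrow> 'a \<Rightarrow> nat \<Rightarrow> complex" where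
  "orbit E y x n = complex_of_real (y \<bullet> (E ^^ n) x)"

lemma exp_bounded_orbit:
  assumes "linear (E :: 'a::euclidean_space \<Rightarrow> 'a)"
  shows "exp_bounded (orbit E y x)"
proof -
  obtain B where B: "\<And>n x. norm ((E ^^ n) x) \<le> B ^ n * norm x"
    using funpow_norm_bound[OF assms] by blast
  have "norm (orbit E y x n) \<le> (norm y * norm x) * B ^ n" for n
  proof -
    have "norm (orbit E y x n) \<le> norm y * norm ((E ^^ n) x)"
      by (simp add: orbit_def Cauchy_Schwarz_ineq2)
    also have "\<dots> \<le> norm y * (B ^ n * norm x)" by (intro mult_left_mono B) auto
    finally show ?thesis by (simp add: ac_simps)
  qed
  then show ?thesis unfolding exp_bounded_def by blast
qed

context
  fixes E :: "'a::euclidean_space \<Rightarrow> 'a"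
  assumes lin: "linear E"
begin

lemma flow_sums: "(\<lambda>n. (t ^ n / fact n) *\<^sub>R (E ^^ n) x) sums flow E t x"
proof -
  obtain B where B: "\<And>n x. norm ((E ^^ n) x) \<le> B ^ n * norm x"
    using funpow_norm_bound[OF lin] by blast
  have "summable (\<lambda>n. norm x * (inverse (fact n) * (B * \<bar>t\<bar>) ^ n))"
    by (intro summable_mult summable_exp)
  then have "summable (\<lambda>n. (t ^ n / fact n) *\<^sub>R (E ^^ n) x)"
  proof (rule summable_comparison_test')
    fix n
    have "norm ((t ^ n / fact n) *\<^sub>R (E ^^ n) x) \<le> (\<bar>t\<bar> ^ n / fact n) * (B ^ n * norm x)"
      using mult_left_mono[OF B, of "\<bar>t\<bar> ^ n / fact n"] by (simp add: power_abs)
    then show "norm ((t ^ n / fact n) *\<^sub>R (E ^^ n) x) \<le> norm x * (inverse (fact n) * (B * \<bar>t\<bar>) ^ n)"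
      by (simp add: power_mult_distrib field_simps)
  qed
  then show ?thesis unfolding flow_def by (rule summable_sums)
qed

lemma inner_flow: "complex_of_real (y \<bullet> flow E t x) = egf (orbit E y x) (of_real t)"
proof -
  have "(\<lambda>n. y \<bullet> ((t ^ n / fact n) *\<^sub>R (E ^^ n) x)) sums (y \<bullet> flow E t x)"
    by (rule bounded_linear.sums[OF bounded_linear_inner_right flow_sums])
  then have "(\<lambda>n. complex_of_real (y \<bullet> ((t ^ n / fact n) *\<^sub>R (E ^^ n) x))) sums
      complex_of_real (y \<bullet> flow E t x)"
    by (rule sums_of_real)
  moreover have "complex_of_real (y \<bullet> ((t ^ n / fact n) *\<^sub>R (E ^^ n) x))
      = (orbit E y x n / fact n) * (of_real t) ^ n" for n
    by (simp add: orbit_def)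
  ultimately show ?thesis unfolding egf_def by (simp only: sums_iff)
qed

lemma flow_0: "flow E 0 x = x"
proof -
  have "(\<lambda>n. (0 ^ n / fact n) *\<^sub>R (E ^^ n) x) sums (\<Sum>n\<in>{0}. (0 ^ n / fact n) *\<^sub>R (E ^^ n) x)"
    by (rule sums_finite) auto
  then show ?thesis using flow_sums[of 0 x] by (simp add: sums_iff)
qed

lemma linear_flow: "linear (flow E t)"
proof
  fix x y :: 'a and r :: real
  have l: "linear (E ^^ n)" for n by (rule linear_funpow[OF lin])
  show "flow E t (x + y) = flow E t x + flow E t y"
    using sums_add[OF flow_sums[of t x] flow_sums[of t y]] flow_sums[of t "x + y"]
    by (simp add: linear_add[OF l] scaleR_add_right sums_iff)
  show "flow E t (r *\<^sub>R x) = r *\<^sub>R flow E t x"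
    using sums_scaleR_right[OF flow_sums[of t x], of r] flow_sums[of t "r *\<^sub>R x"]
    by (simp add: linear_scale[OF l] sums_iff mult.commute)
qed

lemma flow_commute: "flow E t (E x) = E (flow E t x)"
proof -
  interpret bounded_linear E using lin by (simp add: linear_conv_bounded_linear)
  have "(\<lambda>n. E ((t ^ n / fact n) *\<^sub>R (E ^^ n) x)) sums E (flow E t x)"
    by (rule sums[OF flow_sums])
  then show ?thesis using flow_sums[of t "E x"]
    by (simp add: scaleR funpow_swap1 sums_iff)
qed

lemma flow_eigen:
  assumes "E x = a *\<^sub>R x" shows "flow E t x = exp (a * t) *\<^sub>R x"
proof -
  have "(E ^^ n) x = a ^ n *\<^sub>R x" for n
  proof (induction n)
    case (Suc n) then show ?case by (simp add: linear_scale[OF lin] assms ac_simps)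
  qed simp
  then have "(\<lambda>n. ((a * t) ^ n /\<^sub>R fact n) *\<^sub>R x) sums flow E t x"
    using flow_sums[of t x] by (simp add: power_mult_distrib divide_inverse ac_simps)
  moreover have "(\<lambda>n. ((a * t) ^ n /\<^sub>R fact n) *\<^sub>R x) sums (exp (a * t) *\<^sub>R x)"
    by (rule sums_scaleR_left[OF exp_converges])
  ultimately show ?thesis by (metis sums_unique2)
qed

lemma flow_deriv: "((\<lambda>t. y \<bullet> flow E t x) has_real_derivative y \<bullet> flow E t (E x)) (at t)"
proof -
  have "((\<lambda>t. complex_of_real t) has_vector_derivative 1) (at t)"
    using has_vector_derivative_of_real[OF DERIV_ident] by simp
  from field_vector_diff_chain_at[OF this egf_deriv[OF exp_bounded_orbit[OF lin]]]
  have "((\<lambda>t. complex_of_real (y \<bullet> flow E t x)) has_vector_derivative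
      egf (\<lambda>n. orbit E y x (Suc n)) (of_real t)) (at t)"
    by (simp add: o_def inner_flow)
  moreover have "(\<lambda>n. orbit E y x (Suc n)) = orbit E y (E x)"
    by (simp add: orbit_def fun_eq_iff funpow_swap1)
  ultimately have "((\<lambda>t. complex_of_real (y \<bullet> flow E t x)) has_vector_derivative
      complex_of_real (y \<bullet> flow E t (E x))) (at t)"
    by (simp add: inner_flow)
  then show ?thesis
    by (simp add: has_vector_derivative_complex_iff has_real_derivative_iff_has_vector_derivative)
qed

text \<open>The vector exp(r E) exp((s + t - r) E) x does not depend on \<open>r\<close>, its
  derivative being 0; comparing r = s with r = 0 avoids rearranging a double series.\<close>

lemma flow_add: "flow E (s + t) x = flow E s (flow E t x)"
proof -
  have "y \<bullet> flow E s (flow E t x) = y \<bullet> flow E (s + t) x" for y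
  proof -
    \<comment> \<open>Expanded over the basis so that the product rule is applied to real functions
      only.\<close>
    define F where "F = (\<lambda>r. \<Sum>i\<in>Basis. (y \<bullet> flow E r i) * (i \<bullet> flow E (s + t - r) x))"
    have F: "F r = y \<bullet> flow E r (flow E (s + t - r) x)" for r
      unfolding F_def by (subst (2) linear_eq_sum_Basis[OF linear_flow])
        (simp add: inner_sum_right mult.commute inner_commute)
    have "(F has_real_derivative 0) (at r)" for r
    proof -
      have 1: "((\<lambda>r. s + t - r) has_real_derivative -1) (at r)"
        by (auto intro!: derivative_eq_intros)
      have 2: "((\<lambda>r. i \<bullet> flow E (s + t - r) x) has_real_derivative
          - (i \<bullet> flow E (s + t - r) (E x))) (at r)" for i
        using DERIV_chain2[OF flow_deriv 1] by simp
      have "(F has_real_derivative (\<Sum>i\<in>Basis. (y \<bullet> flow E r (E i)) * (i \<bullet> flow E (s + t - r) x)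
          + - (i \<bullet> flow E (s + t - r) (E x)) * (y \<bullet> flow E r i))) (at r)"
        unfolding F_def by (intro DERIV_sum DERIV_mult flow_deriv 2)
      moreover have "(\<Sum>i\<in>Basis. (y \<bullet> flow E r (E i)) * (i \<bullet> flow E (s + t - r) x)
          + - (i \<bullet> flow E (s + t - r) (E x)) * (y \<bullet> flow E r i))
          = y \<bullet> (\<Sum>i\<in>Basis. (i \<bullet> flow E (s + t - r) x) *\<^sub>R flow E r (E i))
          - y \<bullet> (\<Sum>i\<in>Basis. (i \<bullet> flow E (s + t - r) (E x)) *\<^sub>R flow E r i)"
        by (simp add: inner_sum_right sum_subtractf[symmetric] ac_simps)
      moreover have "(\<Sum>i\<in>Basis. (i \<bullet> z) *\<^sub>R L i) = L z" if "linear L" for L :: "'a \<Rightarrow> 'a" and z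
        by (subst (2) linear_eq_sum_Basis[OF that]) (simp add: inner_commute)
      moreover have "linear (\<lambda>z. flow E r (E z))"
        using linear_compose[OF lin linear_flow] by (simp add: o_def)
      ultimately show ?thesis
        by (simp add: linear_flow flow_commute)
    qed
    then have "F s = F 0" by (intro DERIV_isconst_all) auto
    then show ?thesis by (simp add: F flow_0)
  qed
  then have "flow E (s + t) x - flow E s (flow E t x) = 0"
    by (metis inner_diff_right inner_eq_zero_iff right_minus_eq)
  then show ?thesis by simp
qed

end

text \<open>The coordinate along a left eigenvector evolves by a scalar, so along it the semistable
  process scales like a one-dimensional one.\<close>

lemma inner_flow_eigen:
  assumes "linear E" "\<And>y. u \<bullet> E y = a * (u \<bullet> y)"
  shows "u \<bullet> flow E t x = exp (a * t) * (u \<bullet> x)"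
proof -
  have "u \<bullet> (E ^^ n) x = a ^ n * (u \<bullet> x)" for n
    by (induction n) (simp_all add: assms(2))
  then have "(\<lambda>n. ((a * t) ^ n /\<^sub>R fact n) * (u \<bullet> x)) sums (u \<bullet> flow E t x)"
    using bounded_linear.sums[OF bounded_linear_inner_right flow_sums[OF assms(1), of t x], of u]
    by (simp add: power_mult_distrib divide_inverse ac_simps)
  moreover have "(\<lambda>n. ((a * t) ^ n /\<^sub>R fact n) * (u \<bullet> x)) sums (exp (a * t) * (u \<bullet> x))"
    by (rule sums_mult2[OF exp_converges])
  ultimately show ?thesis by (metis sums_unique2)
qed

section \<open>Polynomials in \<open>E\<close> and the decay they force\<close>

lemma poly_op_le:
  assumes "degree p \<le> N" shows "poly_op p E x = (\<Sum>i\<le>N. coeff p i *\<^sub>R (E ^^ i) x)"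
  unfolding poly_op_def using assms
  by (intro sum.mono_neutral_left) (auto simp: coeff_eq_0)

lemma poly_op_0: "poly_op 0 E x = 0" by (simp add: poly_op_def)

lemma poly_op_add: "poly_op (p + q) E x = poly_op p E x + poly_op q E x"
proof -
  let ?N = "max (degree p) (degree q)"
  have "degree (p + q) \<le> ?N" by (rule degree_add_le_max)
  then show ?thesis
    by (simp add: poly_op_le[of _ ?N] sum.distrib scaleR_left_distrib)
qed

lemma poly_op_smult: "poly_op (smult c p) E x = c *\<^sub>R poly_op p E x"
  by (simp add: poly_op_le[of _ "degree p"] degree_smult_le scaleR_sum_right)

context
  fixes E :: "real^'n \<Rightarrow> real^'n"
  assumes lin: "linear E"
begin

lemma poly_op_pCons: "poly_op (pCons a p) E x = a *\<^sub>R x + E (poly_op p E x)"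
proof -
  have "poly_op (pCons a p) E x = (\<Sum>i\<le>Suc (degree p). coeff (pCons a p) i *\<^sub>R (E ^^ i) x)"
    by (rule poly_op_le) (simp add: degree_pCons_le)
  also have "\<dots> = a *\<^sub>R x + E (poly_op p E x)"
    unfolding sum.atMost_Suc_shift poly_op_def
    by (simp add: linear_sum[OF lin] linear_scale[OF lin])
  finally show ?thesis .
qed

lemma linear_poly_op: "linear (poly_op p E)"
proof (induction p rule: pCons_induct)
  case 0 show ?case by (simp add: poly_op_0 linear_iff)
next
  case (pCons a p)
  show ?case
    by (rule linearI) (simp_all add: poly_op_pCons linear_add[OF pCons(2)] linear_scale[OF pCons(2)]
      linear_add[OF lin] linear_scale[OF lin] algebra_simps)
qed

lemma poly_op_commute: "poly_op p E (E x) = E (poly_op p E x)"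
  by (induction p rule: pCons_induct)
     (simp_all add: poly_op_0 poly_op_pCons linear_0[OF lin] linear_add[OF lin] linear_scale[OF lin])

lemma poly_op_mult: "poly_op (p * q) E x = poly_op p E (poly_op q E x)"
  by (induction p rule: pCons_induct)
     (simp_all add: poly_op_0 poly_op_pCons poly_op_add poly_op_smult)

lemma poly_op_eigen:
  assumes "E x = a *\<^sub>R x" shows "poly_op p E x = poly p a *\<^sub>R x"
  by (induction p rule: pCons_induct)
     (simp_all add: poly_op_0 poly_op_pCons linear_scale[OF lin] assms algebra_simps)

lemma funpow_poly_op_sum:
  "(E ^^ n) (poly_op p E x) = (\<Sum>i\<le>degree p. coeff p i *\<^sub>R (E ^^ (n + i)) x)"
  by (simp add: poly_op_def linear_sum[OF linear_funpow[OF lin]]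
      linear_scale[OF linear_funpow[OF lin]] funpow_add)

lemma shift_poly_orbit:
  "shift_poly (map_poly complex_of_real Q) (orbit E y x) = orbit E y (poly_op Q E x)"
  by (simp add: fun_eq_iff shift_poly_def orbit_def funpow_poly_op_sum inner_sum_right
      coeff_map_poly degree_map_poly)

text \<open>\<open>Q\<close> of \<open>E\<close> maps the range of \<open>L\<close> into the
  eigenspace of \<open>a\<close>, where the decay is exactly exp(-a t). All roots of
  \<open>Q\<close> have larger real part, so undoing \<open>Q\<close> root by root keeps the rate.
  \<open>L\<close> will be the identity or the removal of the \<open>V1\<close> component.\<close>

lemma flow_decay:
  fixes L :: "real^'n \<Rightarrow> real^'n"
  assumes L: "linear L" and Q: "Q \<noteq> 0"
    and roots: "\<And>z. poly (map_poly complex_of_real Q) z = 0 \<Longrightarrow> Re z > a"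
    and eig: "\<And>x. E (poly_op Q E (L x)) = a *\<^sub>R poly_op Q E (L x)"
  obtains C where "C > 0" "\<And>t x. t \<ge> 0 \<Longrightarrow> norm (flow E (-t) (L x)) \<le> C * exp (- a * t) * norm x"
proof -
  have "edecay a (orbit E y (L x))" for x y
  proof (rule edecay_shift_poly[OF _ roots exp_bounded_orbit[OF lin]])
    show "map_poly complex_of_real Q \<noteq> 0" using Q by (simp add: map_poly_eq_0_iff)
    let ?w = "poly_op Q E (L x)"
    have "norm (egf (orbit E y ?w) (of_real (-t))) \<le> \<bar>y \<bullet> ?w\<bar> * exp (- a * t)" for t
      unfolding inner_flow[OF lin, symmetric] flow_eigen[OF lin eig] by (simp add: norm_mult)
    then show "edecay a (shift_poly (map_poly complex_of_real Q) (orbit E y (L x)))"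
      unfolding shift_poly_orbit edecay_def by blast
  qed
  then have "\<forall>x y. \<exists>K. \<forall>t\<ge>0. \<bar>y \<bullet> flow E (-t) (L x)\<bar> \<le> K * exp (- a * t)"
    unfolding edecay_def inner_flow[OF lin, symmetric] by simp
  then have "\<exists>K. \<forall>x y. \<forall>t\<ge>0. \<bar>y \<bullet> flow E (-t) (L x)\<bar> \<le> K x y * exp (- a * t)"
    by (simp only: choice_iff)
  then obtain K where K: "\<And>x y t. t \<ge> 0 \<Longrightarrow> \<bar>y \<bullet> flow E (-t) (L x)\<bar> \<le> K x y * exp (- a * t)"
    by blast
  define C where "C = (\<Sum>i\<in>Basis. \<Sum>j\<in>Basis. \<bar>K j i\<bar>)"
  have "norm (flow E (-t) (L x)) \<le> C * exp (- a * t) * norm x" if t: "t \<ge> 0" for t x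
  proof -
    have lf: "linear (\<lambda>x. flow E (-t) (L x))"
      using linear_compose[OF L linear_flow[OF lin]] by (simp add: o_def)
    have "norm (flow E (-t) (L x)) \<le> (\<Sum>i\<in>Basis. \<bar>flow E (-t) (L x) \<bullet> i\<bar>)" by (rule norm_le_l1)
    also have "\<dots> = (\<Sum>i\<in>Basis. \<bar>\<Sum>j\<in>Basis. (x \<bullet> j) * (i \<bullet> flow E (-t) (L j))\<bar>)"
      by (subst linear_eq_sum_Basis[OF lf]) (simp add: inner_sum_right inner_commute)
    also have "\<dots> \<le> (\<Sum>i\<in>Basis. \<Sum>j\<in>Basis. norm x * (\<bar>K j i\<bar> * exp (- a * t)))"
    proof (intro sum_mono order_trans[OF sum_abs])
      fix i j :: "real^'n" assume "i \<in> Basis" "j \<in> Basis"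
      have "\<bar>i \<bullet> flow E (-t) (L j)\<bar> \<le> \<bar>K j i\<bar> * exp (- a * t)"
        using K[OF t, of i j] by (smt (verit) exp_ge_zero mult_right_mono)
      then show "\<bar>(x \<bullet> j) * (i \<bullet> flow E (-t) (L j))\<bar> \<le> norm x * (\<bar>K j i\<bar> * exp (- a * t))"
        unfolding abs_mult using \<open>j \<in> Basis\<close> by (intro mult_mono Basis_le_norm) auto
    qed
    also have "\<dots> = C * exp (- a * t) * norm x"
      by (simp add: C_def sum_distrib_left sum_distrib_right ac_simps)
    finally show ?thesis .
  qed
  \<comment> \<open>The sum \<open>C\<close> may vanish; adding 1 makes the constant
    positive.\<close>
  moreover have "C * exp (- a * t) * norm x \<le> (C + 1) * exp (- a * t) * norm x" for t and x :: "real^'n"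
    by (intro mult_right_mono) auto
  moreover have "C \<ge> 0" unfolding C_def by (intro sum_nonneg) auto
  ultimately show ?thesis using that[of "C + 1"] by (smt (verit))
qed

end

section \<open>Consequences of the spectral factorization\<close>

lemma spectral_factorization_annihilates:
  assumes "spectral_factorization E p q a" shows "poly_op (\<Prod>j=1..p. q j) E x = 0"
  using assms unfolding spectral_factorization_def is_minimal_poly_def by blast

lemma spectral_factorization_ge_1:
  fixes E :: "real^'n \<Rightarrow> real^'n"
  assumes "spectral_factorization E p q a" shows "p \<ge> 1"
proof (rule ccontr)
  assume "\<not> p \<ge> 1"
  then have "p = 0" by simp
  then have "x = 0" for x :: "real^'n"
    using spectral_factorization_annihilates[OF assms, of x] by (simp add: poly_op_def)
  then show False by (metis axis_eq_0_iff zero_neq_one)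
qed

lemma spectral_factorization_nonzero:
  assumes "spectral_factorization E p q a" "j \<in> {1..p}" shows "q j \<noteq> 0"
  using assms unfolding spectral_factorization_def by force

lemma map_poly_complex_of_real_prod:
  "map_poly complex_of_real (prod q I) = (\<Prod>j\<in>I. map_poly complex_of_real (q j))"
proof (induction I rule: infinite_finite_induct)
  case (insert x F)
  have "map_poly complex_of_real (p * r) = map_poly of_real p * map_poly of_real r" for p r
    by (rule poly_eqI) (simp add: coeff_map_poly coeff_mult)
  with insert show ?case by simp
qed simp_all

lemma spectral_factorization_roots:
  assumes sf: "spectral_factorization E p q a" and I: "I \<subseteq> {1..p}"
    and z: "poly (map_poly complex_of_real (prod q I)) z = 0"
  shows "\<exists>j\<in>I. Re z = a j"
proof -
  have "finite I" using I finite_subset by blast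
  then obtain j where "j \<in> I" "poly (map_poly complex_of_real (q j)) z = 0"
    using z by (auto simp: map_poly_complex_of_real_prod poly_prod prod_zero_iff)
  then show ?thesis using sf I unfolding spectral_factorization_def by blast
qed

lemma poly_map_poly_of_real:
  "poly (map_poly complex_of_real P) (of_real x) = of_real (poly P x)"
  by (induction P rule: pCons_induct) (simp_all add: map_poly_pCons)

text \<open>Roots of the other factors have real parts different from \<open>a i\<close>. This
  nonvanishing allows the spectral projections to be normalised by division.\<close>

lemma spectral_factorization_real_root:
  assumes sf: "spectral_factorization E p q a" and I: "I \<subseteq> {1..p}"
    and i: "i \<in> {1..p}" "i \<notin> I"
  shows "poly (prod q I) (a i) \<noteq> 0"
proof
  assume "poly (prod q I) (a i) = 0"
  then have "poly (map_poly complex_of_real (prod q I)) (of_real (a i)) = 0"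
    by (simp add: poly_map_poly_of_real)
  then obtain j where j: "j \<in> I" "a i = a j"
    using spectral_factorization_roots[OF sf I] by force
  then have "i = j" using sf I i unfolding spectral_factorization_def
    by (meson strict_mono_on_imp_inj_on inj_on_def subsetD)
  then show False using j i by simp
qed

text \<open>Minimality: dropping a factor from the minimal polynomial no longer annihilates.\<close>

lemma spectral_factorization_kernel:
  fixes E :: "real^'n \<Rightarrow> real^'n"
  assumes lin: "linear E" and sf: "spectral_factorization E p q a" and j: "j \<in> {1..p}"
  obtains x where "x \<noteq> 0" "poly_op (q j) E x = 0"
proof -
  let ?R = "prod q ({1..p} - {j})"
  have m: "(\<Prod>i=1..p. q i) = q j * ?R" using j by (simp add: prod.remove)
  have R0: "?R \<noteq> 0" using spectral_factorization_nonzero[OF sf] by (simp add: prod_zero_iff)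
  have "degree (q j) > 0" using sf j unfolding spectral_factorization_def by blast
  then have "degree ?R < degree (\<Prod>i=1..p. q i)"
    unfolding m using R0 spectral_factorization_nonzero[OF sf j] by (subst degree_mult_eq) auto
  then obtain x where "poly_op ?R E x \<noteq> 0"
    using sf R0 unfolding spectral_factorization_def is_minimal_poly_def by (meson not_less)
  moreover have "poly_op (q j) E (poly_op ?R E x) = 0"
    using spectral_factorization_annihilates[OF sf, of x] unfolding m poly_op_mult[OF lin] .
  ultimately show ?thesis using that by blast
qed

section \<open>Spectral decomposition\<close>

lemma inner_adjoint:
  fixes f :: "'a::euclidean_space \<Rightarrow> 'b::euclidean_space"
  assumes "linear f" shows "adjoint f w \<bullet> x = w \<bullet> f x"
  using adjoint_works[OF assms, of x w] by (simp add: inner_commute)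

locale spectral =
  fixes E :: "real^'n \<Rightarrow> real^'n" and p :: nat and q :: "nat \<Rightarrow> real poly" and a :: "nat \<Rightarrow> real"
  assumes lin: "linear E" and sf: "spectral_factorization E p q a"
    and diag1: "\<And>x. poly_op (q 1) E x = 0 \<Longrightarrow> E x = a 1 *\<^sub>R x"
begin

definition V1 :: "(real^'n) set" where "V1 = {x. poly_op (q 1) E x = 0}"

definition cofactor :: "real poly" where "cofactor = prod q {2..p}"

text \<open>\<open>cofactor\<close> of \<open>E\<close> kills every block but the first and lands in
  \<open>V1\<close>, where it acts as the number \<open>poly cofactor (a 1)\<close> because
  \<open>E\<close> is scalar there. Dividing by it gives the spectral projection onto
  \<open>V1\<close> along the other blocks.\<close>

definition proj1 :: "real^'n \<Rightarrow> real^'n" where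
  "proj1 x = poly_op cofactor E x /\<^sub>R poly cofactor (a 1)"

lemma p1: "1 \<in> {1..p}"
  using spectral_factorization_ge_1[OF sf] by simp

lemma a_less: "i \<in> {1..p} \<Longrightarrow> j \<in> {1..p} \<Longrightarrow> i < j \<Longrightarrow> a i < a j"
  using sf unfolding spectral_factorization_def by (meson strict_mono_onD)

lemma subspace_V1: "subspace V1"
  unfolding V1_def using linear_poly_op[OF lin] by (simp add: linear_subspace_kernel)

lemma cofactor_nonzero: "poly cofactor (a 1) \<noteq> 0"
  unfolding cofactor_def using spectral_factorization_real_root[OF sf _ p1, of "{2..p}"] by force

lemma cofactor_V1: "poly_op cofactor E x \<in> V1"
proof -
  have "(\<Prod>j=1..p. q j) = q 1 * cofactor"
    using p1 unfolding cofactor_def by (simp add: prod.atLeast_Suc_atMost numeral_2_eq_2)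
  then show ?thesis
    using spectral_factorization_annihilates[OF sf, of x]
    by (simp add: V1_def poly_op_mult[OF lin])
qed

lemma proj1_V1: "proj1 x \<in> V1"
  unfolding proj1_def by (intro subspace_scale subspace_V1 cofactor_V1)

lemma V1_eigen: "x \<in> V1 \<Longrightarrow> E x = a 1 *\<^sub>R x"
  by (simp add: V1_def diag1)

lemma proj1_id: "x \<in> V1 \<Longrightarrow> proj1 x = x"
  unfolding proj1_def by (simp add: poly_op_eigen[OF lin V1_eigen] cofactor_nonzero del: One_nat_def)

lemma linear_proj1: "linear proj1"
  unfolding proj1_def[abs_def] by (intro linear_compose_scale_right linear_poly_op lin)

lemma proj1_commute: "proj1 (E x) = a 1 *\<^sub>R proj1 x"
  unfolding proj1_def poly_op_commute[OF lin] V1_eigen[OF cofactor_V1] by simp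

lemma V1_nontrivial: obtains x where "x \<in> V1" "norm x = 1"
proof -
  obtain x where x: "x \<noteq> 0" "x \<in> V1"
    using spectral_factorization_kernel[OF lin sf p1] unfolding V1_def by blast
  show ?thesis
    by (rule that[of "x /\<^sub>R norm x"]) (use x in \<open>auto intro: subspace_scale subspace_V1\<close>)
qed

lemma dim_V1_pos: "dim V1 \<ge> 1"
proof -
  obtain x where "x \<in> V1" "norm x = 1" using V1_nontrivial .
  then have "\<not> V1 \<subseteq> {0}" by auto
  then show ?thesis by (metis dim_eq_0 less_one not_less)
qed

text \<open>\<open>E\<close> is scalar on the range of \<open>cofactor\<close>, so the slowest block
  contributes its exponential with no polynomial factor.\<close>

lemma flow_decay_all:
  obtains C where "C > 0" "\<And>t x. t \<ge> 0 \<Longrightarrow> norm (flow E (-t) x) \<le> C * exp (- a 1 * t) * norm x"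
proof (rule flow_decay[OF lin linear_id, of cofactor "a 1"])
  show "cofactor \<noteq> 0" using cofactor_nonzero by auto
  show "Re z > a 1" if "poly (map_poly complex_of_real cofactor) z = 0" for z
    using spectral_factorization_roots[OF sf _ that[unfolded cofactor_def]] a_less[OF p1] by force
  show "E (poly_op cofactor E (id x)) = a 1 *\<^sub>R poly_op cofactor E (id x)" for x
    by (rule V1_eigen[OF cofactor_V1])
qed (use that in simp)

text \<open>The spectral projection commutes with \<open>E\<close>, which is scalar on its range, so
  its rows are left eigenvectors.\<close>

lemma left_eigenvector:
  obtains u x where "u \<bullet> x = 1" "\<And>y. u \<bullet> E y = a 1 * (u \<bullet> y)"
proof -
  obtain x where x: "x \<in> V1" "norm x = 1" using V1_nontrivial .
  show ?thesis
    by (rule that[of "adjoint proj1 x" x])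
       (use x in \<open>auto simp: inner_adjoint[OF linear_proj1] proj1_id proj1_commute norm_eq_1 simp del: One_nat_def\<close>)
qed

text \<open>The dual vectors \<open>x1\<close>, \<open>x2\<close> make the independence of the
  functionals quantitative: they read the two coefficients off a combination of \<open>u1\<close>
  and \<open>u2\<close>.\<close>

lemma left_eigenvector_pair:
  assumes "dim V1 \<ge> 2"
  obtains u1 u2 x1 x2 where
    "u1 \<bullet> x1 = 1" "u1 \<bullet> x2 = 0" "u2 \<bullet> x1 = 0" "u2 \<bullet> x2 = 1"
    "\<And>y. u1 \<bullet> E y = a 1 * (u1 \<bullet> y)" "\<And>y. u2 \<bullet> E y = a 1 * (u2 \<bullet> y)"
proof -
  obtain B where B: "B \<subseteq> V1" "pairwise orthogonal B" "\<And>x. x \<in> B \<Longrightarrow> norm x = 1" "card B = dim V1"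
    using orthonormal_basis_subspace[OF subspace_V1] by metis
  then obtain x1 x2 where x: "x1 \<in> B" "x2 \<in> B" "x1 \<noteq> x2"
    using assms by (metis card_le_Suc0_iff_eq card.infinite not_less_eq_eq numeral_2_eq_2 zero_le)
  then have o: "x1 \<bullet> x2 = 0" "x1 \<bullet> x1 = 1" "x2 \<bullet> x2 = 1"
    using B by (auto simp: pairwise_def orthogonal_def norm_eq_1)
  show ?thesis
    by (rule that[of "adjoint proj1 x1" x1 x2 "adjoint proj1 x2"])
       (use B x o in \<open>auto simp: inner_adjoint[OF linear_proj1] proj1_id proj1_commute subset_iff inner_commute[of x2 x1] simp del: One_nat_def\<close>)
qed

text \<open>The \<open>V1\<close> component is kept as the coordinate \<open>u1 \<bullet> x\<close>
  instead of being merged into \<open>norm x\<close>: in the lower bound of (ii) this coordinate is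
  confined more tightly than the norm, which compensates for its slower decay.\<close>

lemma two_blocks:
  assumes d1: "dim V1 = 1" and n: "CARD('n) \<ge> 2"
    and diag2: "\<And>x. poly_op (q 2) E x = 0 \<Longrightarrow> E x = a 2 *\<^sub>R x"
  obtains u1 u2 x1 x2 C where
    "u1 \<bullet> x1 = 1" "u1 \<bullet> x2 = 0" "u2 \<bullet> x1 = 0" "u2 \<bullet> x2 = 1"
    "\<And>y. u1 \<bullet> E y = a 1 * (u1 \<bullet> y)" "\<And>y. u2 \<bullet> E y = a 2 * (u2 \<bullet> y)" "C > 0"
    "\<And>t x. t \<ge> 0 \<Longrightarrow> norm (flow E (-t) x) \<le> exp (- a 1 * t) * \<bar>u1 \<bullet> x\<bar> + C * exp (- a 2 * t) * norm x"
    "a 1 < a 2"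
proof -
  \<comment> \<open>With a single block, \<open>V1\<close> would be the whole space, of dimension at
    least 2.\<close>
  have "p \<noteq> 1"
  proof
    assume "p = 1"
    then have "V1 = UNIV"
      using spectral_factorization_annihilates[OF sf] by (simp add: V1_def)
    then show False using d1 n by (simp add: dim_UNIV)
  qed
  then have p2: "2 \<in> {1..p}" using p1 by simp
  have a12: "a 1 < a 2" by (rule a_less[OF p1 p2]) simp
  define R where "R = prod q {3..p}"
  have cof: "cofactor = q 2 * R"
    using p2 unfolding cofactor_def R_def by (simp add: prod.atLeast_Suc_atMost)
  have R2: "poly R (a 2) \<noteq> 0"
    unfolding R_def using spectral_factorization_real_root[OF sf _ p2, of "{3..p}"] by force
  obtain x1 where x1: "x1 \<in> V1" "norm x1 = 1" using V1_nontrivial .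
  obtain z where z: "z \<noteq> 0" "poly_op (q 2) E z = 0"
    using spectral_factorization_kernel[OF lin sf p2] by blast
  define x2 where "x2 = z /\<^sub>R norm z"
  have x2: "norm x2 = 1" "poly_op (q 2) E x2 = 0"
    using z by (simp_all add: x2_def linear_scale[OF linear_poly_op[OF lin]])
  have span1: "proj1 x = (x1 \<bullet> proj1 x) *\<^sub>R x1" for x
  proof -
    have "span {x1} = V1"
      using x1 d1 subspace_V1 by (intro subspace_dim_equal) (auto simp: span_minimal dim_insert)
    then obtain k where "proj1 x = k *\<^sub>R x1"
      using proj1_V1[of x] by (auto simp: span_singleton)
    then show ?thesis using x1(2) by (simp add: norm_eq_1)
  qed
  define u1 where "u1 = adjoint proj1 x1"
  have u1: "u1 \<bullet> x = x1 \<bullet> proj1 x" for x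
    by (simp add: u1_def inner_adjoint[OF linear_proj1])
  \<comment> \<open>\<open>q 1\<close> is replaced by the linear polynomial with root
    \<open>a 1\<close>. The range of \<open>cofactor\<close> lies in \<open>V1\<close>, which
    \<open>E - a 1\<close> annihilates, so \<open>q 2 * S\<close> annihilates the whole
    space.\<close>
  define S where "S = [:- a 1, 1:] * R"
  have S: "poly S (a 2) \<noteq> 0" using R2 a12 by (simp add: S_def)
  have factor: "poly_op ([:- b, 1:]) E x = E x - b *\<^sub>R x" for b x
    by (simp add: poly_op_pCons[OF lin] poly_op_0 linear_0[OF lin])
  have S_V2: "poly_op (q 2) E (poly_op S E x) = 0" for x
  proof -
    have "poly_op (q 2) E (poly_op S E x) = poly_op ([:- a 1, 1:] * cofactor) E x"
      unfolding cof S_def poly_op_mult[OF lin, symmetric] by (simp only: ac_simps)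
    also have "\<dots> = 0"
      by (simp add: poly_op_mult[OF lin] factor V1_eigen[OF cofactor_V1] del: mult_pCons_left)
    finally show ?thesis .
  qed
  define proj2 where "proj2 x = poly_op S E x /\<^sub>R poly S (a 2)" for x
  have lp2: "linear proj2"
    unfolding proj2_def[abs_def] by (intro linear_compose_scale_right linear_poly_op lin)
  have proj2_E: "proj2 (E x) = a 2 *\<^sub>R proj2 x" for x
    unfolding proj2_def poly_op_commute[OF lin] diag2[OF S_V2] by simp
  define u2 where "u2 = adjoint proj2 x2"
  have u2: "u2 \<bullet> x = x2 \<bullet> proj2 x" for x
    by (simp add: u2_def inner_adjoint[OF lp2])
  have "proj2 x2 = x2"
    by (simp add: proj2_def poly_op_eigen[OF lin diag2[OF x2(2)]] S)
  moreover have "proj2 x1 = 0"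
    by (simp add: proj2_def poly_op_eigen[OF lin V1_eigen[OF x1(1)]] S_def)
  moreover have "proj1 x2 = 0"
    by (simp add: proj1_def cof poly_op_mult[OF lin] x2(2) linear_0[OF linear_poly_op[OF lin]] mult.commute[of "q 2"])
  ultimately have dual: "u1 \<bullet> x1 = 1" "u1 \<bullet> x2 = 0" "u2 \<bullet> x1 = 0" "u2 \<bullet> x2 = 1"
    using x1 x2 proj1_id by (simp_all add: u1 u2 norm_eq_1)
  obtain C where C: "C > 0"
    "\<And>t x. t \<ge> 0 \<Longrightarrow> norm (flow E (-t) (x - proj1 x)) \<le> C * exp (- a 2 * t) * norm x"
  proof (rule flow_decay[OF lin, of "\<lambda>x. x - proj1 x" R "a 2"])
    show "linear (\<lambda>x. x - proj1 x)" by (intro linear_compose_sub linear_ident linear_proj1)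
    show "R \<noteq> 0" using R2 by auto
    show "Re z > a 2" if "poly (map_poly complex_of_real R) z = 0" for z
    proof -
      have "\<exists>j\<in>{3..p}. Re z = a j"
        by (rule spectral_factorization_roots[OF sf _ that[unfolded R_def]]) auto
      then show ?thesis using a_less[OF p2] by fastforce
    qed
    fix x
    \<comment> \<open>On the complement \<open>cofactor\<close> vanishes, so \<open>R\<close> of
      \<open>E\<close> maps it into the kernel of \<open>q 2\<close>, on which \<open>E\<close> is
      the scalar \<open>a 2\<close>: the situation of \<open>flow_decay\<close> again.\<close>
    have "poly_op cofactor E (x - proj1 x) = 0"
      using poly_op_eigen[OF lin V1_eigen[OF proj1_V1[of x]], of cofactor]
      by (simp add: linear_diff[OF linear_poly_op[OF lin]] proj1_def cofactor_nonzero
          del: One_nat_def)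
    then have "poly_op (q 2) E (poly_op R E (x - proj1 x)) = 0"
      by (simp add: cof poly_op_mult[OF lin])
    then show "E (poly_op R E (x - proj1 x)) = a 2 *\<^sub>R poly_op R E (x - proj1 x)"
      by (rule diag2)
  qed (use that in blast)
  have decay: "norm (flow E (-t) x) \<le> exp (- a 1 * t) * \<bar>u1 \<bullet> x\<bar> + C * exp (- a 2 * t) * norm x"
    if t: "t \<ge> 0" for t x
  proof -
    have "flow E (-t) x = flow E (-t) (proj1 x) + flow E (-t) (x - proj1 x)"
      by (simp add: linear_diff[OF linear_flow[OF lin]])
    also have "flow E (-t) (proj1 x) = exp (- a 1 * t) *\<^sub>R (u1 \<bullet> x) *\<^sub>R x1"
      unfolding flow_eigen[OF lin V1_eigen[OF proj1_V1]] u1 span1[symmetric] by simp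
    finally have "norm (flow E (-t) x) \<le> norm (exp (- a 1 * t) *\<^sub>R (u1 \<bullet> x) *\<^sub>R x1)
        + norm (flow E (-t) (x - proj1 x))" by (metis norm_triangle_ineq)
    then show ?thesis using C(2)[OF t, of x] x1(2) by (simp add: abs_mult)
  qed
  show ?thesis
  proof (rule that[OF dual _ _ C(1) decay a12])
    show "u1 \<bullet> E y = a 1 * (u1 \<bullet> y)" for y by (simp add: u1 proj1_commute)
    show "u2 \<bullet> E y = a 2 * (u2 \<bullet> y)" for y by (simp add: u2 proj2_E)
  qed
qed

end

section \<open>Levy processes and their characteristic functions\<close>

locale levy =
  fixes M :: "'w measure" and X :: "real \<Rightarrow> 'w \<Rightarrow> real^'n"
  assumes levy: "levy_process M X"

sublocale levy \<subseteq> prob_space M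
  using levy unfolding levy_process_def by blast

context levy
begin

lemma X_measurable: "t \<ge> 0 \<Longrightarrow> X t \<in> borel_measurable M"
  using levy unfolding levy_process_def by blast

lemma X_0: "AE \<omega> in M. X 0 \<omega> = 0"
  using levy unfolding levy_process_def by blast

lemma X_right_continuous: "\<omega> \<in> space M \<Longrightarrow> t \<ge> 0 \<Longrightarrow> ((\<lambda>t. X t \<omega>) \<longlongrightarrow> X t \<omega>) (at_right t)"
  using levy unfolding levy_process_def cadlag_def by blast

lemma X_increment_distr:
  "s \<ge> 0 \<Longrightarrow> t \<ge> 0 \<Longrightarrow> distr M borel (\<lambda>\<omega>. X (s + t) \<omega> - X s \<omega>) = distr M borel (X t)"
  using levy unfolding levy_process_def by blast

text \<open>For negative times \<open>X\<close> is unconstrained, hence the truncation.\<close>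

definition Y :: "real \<Rightarrow> 'w \<Rightarrow> real^'n" where "Y t = X (max 0 t)"

lemma Y_eq [simp]: "t \<ge> 0 \<Longrightarrow> Y t = X t" by (simp add: Y_def max_def)

text \<open>Right continuity suffices: \<open>Y t\<close> is approached through the grid times
  \<open>g n t\<close>, which lie strictly to the right of \<open>max 0 t\<close> and tend to it.
  For fixed \<open>n\<close> they take countably many values, which gives joint
  measurability.\<close>

lemma Y_jointly_measurable [measurable]: "(\<lambda>(t, \<omega>). Y t \<omega>) \<in> borel_measurable ((borel :: real measure) \<Otimes>\<^sub>M M)"
proof (rule borel_measurable_LIMSEQ_metric)
  define g where "g = (\<lambda>(n::nat) (t::real). (real (nat \<lfloor>real (Suc n) * max 0 t\<rfloor>) + 1) / real (Suc n))"
  show "(\<lambda>(t, \<omega>). X (g n t) \<omega>) \<in> borel_measurable (borel \<Otimes>\<^sub>M M)" for n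
  proof -
    have [measurable]: "(\<lambda>p. X ((real k + 1) / real (Suc n)) (snd p)) \<in> borel_measurable (borel \<Otimes>\<^sub>M M)" for k
      by (rule measurable_compose[OF measurable_snd X_measurable]) simp
    have "(\<lambda>p. X ((real (nat \<lfloor>real (Suc n) * max 0 (fst p)\<rfloor>) + 1) / real (Suc n)) (snd p))
        \<in> borel_measurable (borel \<Otimes>\<^sub>M M)"
      by (rule measurable_compose_countable[where g = "\<lambda>p. nat \<lfloor>real (Suc n) * max 0 (fst p)\<rfloor>" and
          f = "\<lambda>k p. X ((real k + 1) / real (Suc n)) (snd p)"]) measurable
    then show ?thesis by (simp add: g_def case_prod_beta)
  qed
  fix p assume "p \<in> space ((borel :: real measure) \<Otimes>\<^sub>M M)"
  then obtain t \<omega> where p: "p = (t, \<omega>)" and \<omega>: "\<omega> \<in> space M" by (auto simp: space_pair_measure)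
  define T where "T = max 0 t"
  have T: "T \<ge> 0" by (simp add: T_def)
  have gb: "T < g n t \<and> g n t \<le> T + 1 / real (Suc n)" for n
  proof -
    have nn: "real (Suc n) * T \<ge> 0" using T by simp
    have "real (nat \<lfloor>real (Suc n) * T\<rfloor>) = of_int \<lfloor>real (Suc n) * T\<rfloor>"
      using nn by (simp add: zero_le_floor)
    then have "real (Suc n) * T < real (nat \<lfloor>real (Suc n) * T\<rfloor>) + 1"
      "real (nat \<lfloor>real (Suc n) * T\<rfloor>) \<le> real (Suc n) * T" by linarith+
    then show ?thesis
      unfolding g_def T_def[symmetric] by (simp add: field_simps del: of_nat_Suc)
  qed
  have "(\<lambda>n. g n t) \<longlonglongrightarrow> T"
  proof (rule tendsto_sandwich[of "\<lambda>n. T"])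
    have "(\<lambda>n. T + 1 / real (Suc n)) \<longlonglongrightarrow> T + 0"
      using LIMSEQ_inverse_real_of_nat by (intro tendsto_add tendsto_const) (simp add: inverse_eq_divide)
    then show "(\<lambda>n. T + 1 / real (Suc n)) \<longlonglongrightarrow> T" by simp
  qed (use gb in \<open>auto intro: less_imp_le always_eventually\<close>)
  then have "filterlim (\<lambda>n. g n t) (at_right T) sequentially"
    unfolding filterlim_at using gb by (auto intro!: always_eventually)
  from filterlim_compose[OF X_right_continuous[OF \<omega> T] this]
  show "(\<lambda>n. case p of (t, \<omega>) \<Rightarrow> X (g n t) \<omega>) \<longlonglongrightarrow> (case p of (t, \<omega>) \<Rightarrow> Y t \<omega>)"
    by (simp add: p Y_def T_def)
qed

lemma Y_measurable [measurable]: "Y t \<in> borel_measurable M"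
  by (simp add: Y_def X_measurable)

lemma prob_Y_measurable [measurable]:
  assumes [measurable]: "B \<in> sets borel"
  shows "(\<lambda>t. prob {\<omega> \<in> space M. Y t \<omega> \<in> B}) \<in> borel_measurable borel"
proof -
  have "(\<lambda>t. integral\<^sup>L M (\<lambda>\<omega>. indicator B (Y t \<omega>) :: real)) \<in> borel_measurable borel"
    by (rule borel_measurable_lebesgue_integral) measurable
  moreover have "integral\<^sup>L M (\<lambda>\<omega>. indicator B (Y t \<omega>) :: real) = prob {\<omega> \<in> space M. Y t \<omega> \<in> B}" for t
  proof -
    have "integral\<^sup>L M (\<lambda>\<omega>. indicator B (Y t \<omega>) :: real)
        = integral\<^sup>L M (indicator {\<omega> \<in> space M. Y t \<omega> \<in> B})"
      by (intro Bochner_Integration.integral_cong) (auto simp: indicator_def)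
    then show ?thesis by (simp add: Int_absorb1 Collect_conj_eq)
  qed
  ultimately show ?thesis by simp
qed

lemma joint_distr:
  assumes s: "s > 0" and t: "t > 0"
  shows "distr M (borel \<Otimes>\<^sub>M borel) (\<lambda>\<omega>. (X s \<omega>, X (s + t) \<omega> - X s \<omega>))
    = distr M borel (X s) \<Otimes>\<^sub>M distr M borel (X t)"
proof -
  \<comment> \<open>The times 0, s, s + t, continued increasingly. Starting at 0 turns the first
    increment into \<open>X s\<close>, up to the null set where \<open>X 0\<close> is not 0.\<close>
  define \<tau> where "\<tau> = (\<lambda>i::nat. if i = 0 then 0 else if i = 1 then s else s + t * real (i - 1))"
  have [measurable]: "X s \<in> borel_measurable M" "X t \<in> borel_measurable M"
    "X (s + t) \<in> borel_measurable M" "X 0 \<in> borel_measurable M"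
    using s t by (auto intro: X_measurable)
  have "indep_vars (\<lambda>_. borel) (\<lambda>i \<omega>. X (\<tau> (Suc i)) \<omega> - X (\<tau> i) \<omega>) {..<2}"
  proof -
    have "0 \<le> \<tau> 0 \<and> (\<forall>i<2. \<tau> i < \<tau> (Suc i))"
      using s t by (auto simp: \<tau>_def less_2_cases_iff)
    then show ?thesis using levy unfolding levy_process_def by blast
  qed
  then have ind: "indep_vars (\<lambda>_. borel) (\<lambda>i \<omega>. X (\<tau> (Suc i)) \<omega> - X (\<tau> i) \<omega>) {0, 1}"
    by (rule indep_vars_subset) auto
  interpret D1: prob_space "distr M borel (X s)" by (rule prob_space_distr) measurable
  interpret D2: prob_space "distr M borel (X t)" by (rule prob_space_distr) measurable
  have "distr M borel (X s) \<Otimes>\<^sub>M distr M borel (X t)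
      = distr M (borel \<Otimes>\<^sub>M borel) (\<lambda>\<omega>. (X s \<omega>, X (s + t) \<omega> - X s \<omega>))"
  proof (rule pair_measure_eqI)
    fix A B :: "(real^'n) set"
    assume "A \<in> sets (distr M borel (X s))" "B \<in> sets (distr M borel (X t))"
    then have [measurable]: "A \<in> sets borel" "B \<in> sets borel" by auto
    have "emeasure (distr M borel (X s)) A * emeasure (distr M borel (X t)) B
        = emeasure M {\<omega> \<in> space M. X s \<omega> - X 0 \<omega> \<in> A} * emeasure M {\<omega> \<in> space M. X (s + t) \<omega> - X s \<omega> \<in> B}"
    proof (intro arg_cong2[where f = "(*)"])
      have "emeasure (distr M borel (X s)) A = emeasure M {\<omega> \<in> space M. X s \<omega> \<in> A}"
        by (simp add: emeasure_distr vimage_def Int_def conj_commute)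
      also have "\<dots> = emeasure M {\<omega> \<in> space M. X s \<omega> - X 0 \<omega> \<in> A}"
        by (rule emeasure_eq_AE) (use X_0 in auto)
      finally show "emeasure (distr M borel (X s)) A = emeasure M {\<omega> \<in> space M. X s \<omega> - X 0 \<omega> \<in> A}" .
      have "emeasure (distr M borel (X t)) B = emeasure (distr M borel (\<lambda>\<omega>. X (s + t) \<omega> - X s \<omega>)) B"
        using X_increment_distr[of s t] s t by simp
      then show "emeasure (distr M borel (X t)) B = emeasure M {\<omega> \<in> space M. X (s + t) \<omega> - X s \<omega> \<in> B}"
        by (simp add: emeasure_distr vimage_def Int_def conj_commute)
    qed
    also have "\<dots> = emeasure M ({\<omega> \<in> space M. X s \<omega> - X 0 \<omega> \<in> A} \<inter> {\<omega> \<in> space M. X (s + t) \<omega> - X s \<omega> \<in> B})"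
    proof -
      let ?Z = "\<lambda>i \<omega>. X (\<tau> (Suc i)) \<omega> - X (\<tau> i) \<omega>"
      have "prob (\<Inter>i\<in>{0, 1}. ?Z i -` (if i = 0 then A else B) \<inter> space M)
          = (\<Prod>i\<in>{0, 1::nat}. prob (?Z i -` (if i = 0 then A else B) \<inter> space M))"
        by (rule indep_varsD[OF ind]) auto
      then have "prob ({\<omega> \<in> space M. X s \<omega> - X 0 \<omega> \<in> A} \<inter> {\<omega> \<in> space M. X (s + t) \<omega> - X s \<omega> \<in> B})
        = prob {\<omega> \<in> space M. X s \<omega> - X 0 \<omega> \<in> A} * prob {\<omega> \<in> space M. X (s + t) \<omega> - X s \<omega> \<in> B}"
        by (simp add: \<tau>_def vimage_def Int_def conj_commute)
      then show ?thesis by (simp add: emeasure_eq_measure ennreal_mult)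
    qed
    also have "\<dots> = emeasure (distr M (borel \<Otimes>\<^sub>M borel) (\<lambda>\<omega>. (X s \<omega>, X (s + t) \<omega> - X s \<omega>))) (A \<times> B)"
    proof -
      have "emeasure M ({\<omega> \<in> space M. X s \<omega> - X 0 \<omega> \<in> A} \<inter> {\<omega> \<in> space M. X (s + t) \<omega> - X s \<omega> \<in> B})
          = emeasure M ((\<lambda>\<omega>. (X s \<omega>, X (s + t) \<omega> - X s \<omega>)) -` (A \<times> B) \<inter> space M)"
        by (rule emeasure_eq_AE) (use X_0 in auto)
      then show ?thesis by (subst emeasure_distr) auto
    qed
    finally show "emeasure (distr M borel (X s)) A * emeasure (distr M borel (X t)) B
      = emeasure (distr M (borel \<Otimes>\<^sub>M borel) (\<lambda>\<omega>. (X s \<omega>, X (s + t) \<omega> - X s \<omega>))) (A \<times> B)" .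
  qed (auto simp: D1.sigma_finite_measure_axioms D2.sigma_finite_measure_axioms cong: sets_pair_measure_cong)
  then show ?thesis by simp
qed

section \<open>Characteristic functions in time and frequency\<close>

definition cf :: "real \<Rightarrow> real^'n \<Rightarrow> complex" where
  "cf t u = (CLINT \<omega>|M. iexp (u \<bullet> X t \<omega>))"

lemma cf_distr: "t \<ge> 0 \<Longrightarrow> cf t u = (CLINT x|distr M borel (X t). iexp (u \<bullet> x))"
  unfolding cf_def by (subst integral_distr) (auto intro: X_measurable)

lemma cf_0: "cf 0 u = 1"
proof -
  have [measurable]: "X 0 \<in> borel_measurable M" by (rule X_measurable) simp
  have "cf 0 u = (CLINT \<omega>|M. 1)"
    unfolding cf_def by (rule integral_cong_AE) (use X_0 in auto)
  then show ?thesis by (simp add: prob_space)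
qed

lemma norm_cf_le_1: "norm (cf t u) \<le> 1"
proof -
  have "norm (cf t u) \<le> (LINT \<omega>|M. norm (iexp (u \<bullet> X t \<omega>)))"
    unfolding cf_def by (rule integral_norm_bound)
  then show ?thesis by (simp add: prob_space)
qed

lemma cf_add:
  assumes "s \<ge> 0" "t \<ge> 0" shows "cf (s + t) u = cf s u * cf t u"
proof (cases "s = 0 \<or> t = 0")
  case False
  then have s: "s > 0" and t: "t > 0" using assms by auto
  have [measurable]: "X s \<in> borel_measurable M" "X t \<in> borel_measurable M"
    "X (s + t) \<in> borel_measurable M"
    using s t by (auto intro: X_measurable)
  interpret D1: prob_space "distr M borel (X s)" by (rule prob_space_distr) measurable
  interpret D2: prob_space "distr M borel (X t)" by (rule prob_space_distr) measurable
  interpret P: pair_prob_space "distr M borel (X s)" "distr M borel (X t)" ..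
  have "cf (s + t) u = (CLINT \<omega>|M. (\<lambda>(x, y). iexp (u \<bullet> x) * iexp (u \<bullet> y)) (X s \<omega>, X (s + t) \<omega> - X s \<omega>))"
    unfolding cf_def by (simp add: exp_add[symmetric] inner_diff_right algebra_simps)
  also have "\<dots> = (CLINT p|distr M (borel \<Otimes>\<^sub>M borel) (\<lambda>\<omega>. (X s \<omega>, X (s + t) \<omega> - X s \<omega>)).
      (\<lambda>(x, y). iexp (u \<bullet> x) * iexp (u \<bullet> y)) p)"
    by (subst integral_distr) auto
  also have "\<dots> = (CLINT p|distr M borel (X s) \<Otimes>\<^sub>M distr M borel (X t). (\<lambda>(x, y). iexp (u \<bullet> x) * iexp (u \<bullet> y)) p)"
    by (simp only: joint_distr[OF s t])
  also have "\<dots> = (CLINT x|distr M borel (X s). CLINT y|distr M borel (X t). iexp (u \<bullet> x) * iexp (u \<bullet> y))"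
    by (subst P.integral_fst'[symmetric])
       (auto intro!: P.P.integrable_const_bound[where B = 1] simp: norm_mult)
  also have "\<dots> = cf s u * cf t u"
    using s t by (simp add: cf_distr)
  finally show ?thesis .
qed (use cf_0 in auto)

lemma cf_of_nat_mult: "t \<ge> 0 \<Longrightarrow> cf (real k * t) u = cf t u ^ k"
  by (induction k) (simp_all add: cf_0 distrib_right cf_add)

lemma norm_cf_antimono:
  assumes "0 \<le> s" "s \<le> t" shows "norm (cf t u) \<le> norm (cf s u)"
proof -
  have "cf t u = cf s u * cf (t - s) u" using cf_add[of s "t - s" u] assms by simp
  then show ?thesis using norm_cf_le_1[of "t - s" u] by (simp add: norm_mult mult_left_le)
qed

text \<open>Multiplicativity at integer times, monotonicity in between. With
  \<open>t = c ^ k\<close> after scaling, this is the source of the fast decay of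
  \<open>cf 1\<close>.\<close>

lemma norm_cf_le_floor:
  assumes "t \<ge> 0" shows "norm (cf t u) \<le> norm (cf 1 u) ^ nat \<lfloor>t\<rfloor>"
proof -
  have "norm (cf t u) \<le> norm (cf (real (nat \<lfloor>t\<rfloor>) * 1) u)"
    using assms by (intro norm_cf_antimono) auto
  then show ?thesis by (simp add: cf_of_nat_mult norm_power del: mult_1_right)
qed

lemma cf_measurable [measurable]: "(\<lambda>u. cf t u) \<in> borel_measurable borel" if "t \<ge> 0" for t
proof -
  have [measurable]: "X t \<in> borel_measurable M" using that by (rule X_measurable)
  show ?thesis unfolding cf_def by measurable
qed

lemma cf_line_jointly_measurable [measurable]:
  "(\<lambda>p. cf (max 0 (fst p)) (snd p *\<^sub>R u)) \<in> borel_measurable (borel \<Otimes>\<^sub>M borel)"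
proof -
  have "(\<lambda>p. CLINT \<omega>|M. iexp ((snd p *\<^sub>R u) \<bullet> Y (fst p) \<omega>)) \<in> borel_measurable (borel \<Otimes>\<^sub>M borel)"
    by measurable
  then show ?thesis by (simp add: cf_def Y_def)
qed

lemma cf_continuous: "t \<ge> 0 \<Longrightarrow> continuous_on UNIV (cf t)"
proof (rule continuous_at_imp_continuous_on, rule ballI)
  fix u assume "t \<ge> 0"
  then have [measurable]: "X t \<in> borel_measurable M" by (rule X_measurable)
  show "isCont (cf t) u"
    unfolding continuous_at_sequentially o_def cf_def
  proof (intro allI impI)
    fix v :: "nat \<Rightarrow> real^'n" assume v: "v \<longlonglongrightarrow> u"
    show "(\<lambda>n. CLINT \<omega>|M. iexp (v n \<bullet> X t \<omega>)) \<longlonglongrightarrow> (CLINT \<omega>|M. iexp (u \<bullet> X t \<omega>))"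
      by (rule integral_dominated_convergence[where w = "\<lambda>_. 1"])
         (auto intro!: tendsto_intros v AE_I2)
  qed
qed

lemma X_tendsto_0: "AE \<omega> in M. ((\<lambda>t. X t \<omega>) \<longlongrightarrow> 0) (at_right 0)"
  by (rule AE_mp[OF X_0]) (use X_right_continuous[OF _ order_refl] in \<open>force intro!: AE_I2\<close>)

lemma cf_tendsto_1: "((\<lambda>t. cf t u) \<longlongrightarrow> 1) (at_right 0)"
proof -
  have "((\<lambda>t. CLINT \<omega>|M. iexp (u \<bullet> Y t \<omega>)) \<longlongrightarrow> (CLINT \<omega>|M. 1)) (at_right 0)"
  proof (rule tendsto_at_right_sequentially[of _ 1], simp)
    fix S :: "nat \<Rightarrow> real" assume S: "\<And>n. 0 < S n" "S \<longlonglongrightarrow> 0"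
    have "S n \<noteq> 0" for n using S(1)[of n] by simp
    with S have f: "filterlim S (at_right 0) sequentially"
      unfolding filterlim_at by (auto intro!: always_eventually)
    show "(\<lambda>n. CLINT \<omega>|M. iexp (u \<bullet> Y (S n) \<omega>)) \<longlonglongrightarrow> (CLINT \<omega>|M. 1)"
    proof (rule integral_dominated_convergence[where w = "\<lambda>_. 1"])
      show "AE \<omega> in M. (\<lambda>n. iexp (u \<bullet> Y (S n) \<omega>)) \<longlonglongrightarrow> 1"
        using X_tendsto_0
      proof eventually_elim
        case (elim \<omega>)
        have "(\<lambda>n. iexp (u \<bullet> X (S n) \<omega>)) \<longlonglongrightarrow> iexp (u \<bullet> 0)"
          by (intro tendsto_intros filterlim_compose[OF elim f])
        then show ?case using S(1) by (simp add: less_imp_le)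
      qed
    qed auto
  qed
  moreover have "eventually (\<lambda>t. (CLINT \<omega>|M. iexp (u \<bullet> Y t \<omega>)) = cf t u) (at_right 0)"
    unfolding eventually_at_right_field by (auto simp: cf_def intro!: exI[of _ 1])
  ultimately show ?thesis
    by (simp add: prob_space tendsto_cong)
qed

text \<open>Stochastic continuity at 0. Besides scaling, it is the only probabilistic input to the
  lower bound in (i).\<close>

lemma small_time_tight:
  obtains \<delta> where "\<delta> > 0" "\<And>t. 0 < t \<Longrightarrow> t \<le> \<delta> \<Longrightarrow> prob {\<omega> \<in> space M. norm (X t \<omega>) \<le> 1} \<ge> 1 / 2"
proof -
  have "((\<lambda>s. measure M {\<omega>\<in>space M. dist (X s \<omega>) (X 0 \<omega>) > 1}) \<longlongrightarrow> 0) (at 0 within {0..})"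
  proof -
    have "\<forall>t\<ge>0. \<forall>\<epsilon>>0. ((\<lambda>s. measure M {\<omega>\<in>space M. dist (X s \<omega>) (X t \<omega>) > \<epsilon>}) \<longlongrightarrow> 0) (at t within {0..})"
      using levy unfolding levy_process_def by blast
    then show ?thesis by simp
  qed
  then have "eventually (\<lambda>s. prob {\<omega>\<in>space M. dist (X s \<omega>) (X 0 \<omega>) > 1} < 1 / 2) (at 0 within {0..})"
    by (rule order_tendstoD) simp
  then obtain d where d: "d > 0"
    "\<And>s. s \<ge> 0 \<Longrightarrow> s \<noteq> 0 \<Longrightarrow> s < d \<Longrightarrow> prob {\<omega>\<in>space M. dist (X s \<omega>) (X 0 \<omega>) > 1} < 1 / 2"
    unfolding eventually_at by auto
  show ?thesis
  proof (rule that[of "d / 2"])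
    fix t assume t: "0 < t" "t \<le> d / 2"
    have [measurable]: "X t \<in> borel_measurable M" "X 0 \<in> borel_measurable M"
      using t by (auto intro: X_measurable)
    have "prob {\<omega>\<in>space M. dist (X t \<omega>) (X 0 \<omega>) > 1} = prob {\<omega>\<in>space M. \<not> norm (X t \<omega>) \<le> 1}"
      by (rule measure_eq_AE) (use X_0 in \<open>auto simp: dist_norm\<close>)
    then have "prob {\<omega>\<in>space M. \<not> norm (X t \<omega>) \<le> 1} < 1 / 2"
      using d(2)[of t] d(1) t by linarith
    then show "prob {\<omega> \<in> space M. norm (X t \<omega>) \<le> 1} \<ge> 1 / 2"
      by (subst (asm) prob_neg) auto
  qed (use d in simp)
qed

lemma expectation_sojourn_time:
  assumes "s \<ge> 0" and [measurable]: "ip_cball ip r \<in> sets borel"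
  shows "expectation (sojourn_time ip X r s) =
    (LBINT t:{0..s}. prob {\<omega> \<in> space M. X t \<omega> \<in> ip_cball ip r})"
proof -
  let ?B = "ip_cball ip r"
  interpret P: pair_sigma_finite "lborel :: real measure" M ..
  define f where "f = (\<lambda>(t, \<omega>). indicator {0..s} t * indicator ?B (Y t \<omega>) :: real)"
  have [measurable]: "f \<in> borel_measurable (lborel \<Otimes>\<^sub>M M)"
    unfolding f_def by measurable
  have int: "integrable (lborel \<Otimes>\<^sub>M M) f"
  proof (rule Bochner_Integration.integrable_bound)
    show "integrable (lborel \<Otimes>\<^sub>M M) (\<lambda>p. indicator ({0..s} \<times> space M) p :: real)"
      by (subst integrable_indicator_iff) (use assms(1) in \<open>auto simp: emeasure_pair_measure_Times emeasure_space_1\<close>)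
    show "AE p in lborel \<Otimes>\<^sub>M M. norm (f p) \<le> norm (indicator ({0..s} \<times> space M) p :: real)"
      by (auto intro!: AE_I2 simp: f_def indicator_def space_pair_measure)
  qed measurable
  have "expectation (sojourn_time ip X r s) = (LINT \<omega>|M. LINT t|lborel. f (t, \<omega>))"
    unfolding sojourn_time_def set_lebesgue_integral_def f_def
    by (intro Bochner_Integration.integral_cong refl) (auto simp: indicator_def)
  also have "\<dots> = (LINT t|lborel. LINT \<omega>|M. f (t, \<omega>))"
    by (rule P.Fubini_integral) (use int in \<open>simp add: f_def\<close>)
  also have "\<dots> = (LINT t|lborel. indicator {0..s} t *\<^sub>R prob {\<omega> \<in> space M. X t \<omega> \<in> ?B})"
  proof (intro Bochner_Integration.integral_cong refl)
    fix t :: real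
    have "(LINT \<omega>|M. indicator ?B (Y t \<omega>) :: real)
        = integral\<^sup>L M (indicator {\<omega> \<in> space M. Y t \<omega> \<in> ?B})"
      by (intro Bochner_Integration.integral_cong) (auto simp: indicator_def)
    then show "(LINT \<omega>|M. f (t, \<omega>)) = indicator {0..s} t *\<^sub>R prob {\<omega> \<in> space M. X t \<omega> \<in> ?B}"
      by (auto simp: f_def indicator_def Int_absorb1 Collect_conj_eq)
  qed
  finally show ?thesis by (simp add: set_lebesgue_integral_def)
qed

end

section \<open>Semistability and the lower bound 1/2 for eigenvalues\<close>

lemma one_minus_cos_le_square: "1 - cos (y::real) \<le> y\<^sup>2 / 2"
proof -
  have "norm (Re (iexp y - (\<Sum>k\<le>1. (\<i> * y) ^ k / fact k))) \<le> \<bar>y\<bar> ^ Suc 1 / fact (Suc 1)"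
    using iexp_approx1[of y 1] abs_Re_le_cmod order_trans by (metis real_norm_def)
  then have "\<bar>cos y - 1\<bar> \<le> y\<^sup>2 / 2"
    by (simp add: power2_eq_square exp_Euler cos_of_real sin_of_real  flip: abs_mult)
  then show ?thesis by linarith
qed

lemma abs_multiple_2pi_less_1:
  assumes "\<bar>of_int n * (2 * pi)\<bar> < 1" shows "n = 0"
proof (rule ccontr)
  assume "n \<noteq> 0"
  then have "\<bar>of_int n :: real\<bar> \<ge> 1" by linarith
  then show False
    using assms pi_ge_two mult_mono[of 1 "\<bar>of_int n :: real\<bar>" 1 "2 * pi"] by (simp add: abs_mult)
qed

context levy
begin

text \<open>Equality case of the bound on the mean of a unimodular variable: the phase is almost
  surely constant. As the \<open>w k\<close> are countably many, one sample point outside a common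
  null set provides the same \<open>x0\<close> for all of them.\<close>

lemma norm_cf_1_imp_lattice:
  assumes w: "\<And>k::nat. norm (cf 1 (w k)) = 1"
  obtains x0 where "AE \<omega> in M. \<forall>k. \<exists>n::int. w k \<bullet> (X 1 \<omega> - x0) = of_int n * (2 * pi)"
proof -
  have [measurable]: "X 1 \<in> borel_measurable M" by (rule X_measurable) simp
  have "AE \<omega> in M. iexp (w k \<bullet> X 1 \<omega>) = cf 1 (w k)" for k
  proof -
    define z where "z = cf 1 (w k)"
    have z: "cnj z * z = 1" using w[of k] complex_norm_square[of z] by (simp add: z_def mult.commute)
    define f where "f = (\<lambda>\<omega>. Re (cnj z * iexp (w k \<bullet> X 1 \<omega>)))"
    have int: "integrable M (\<lambda>\<omega>. iexp (w k \<bullet> X 1 \<omega>))"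
      by (rule integrable_const_bound[where B = 1]) auto
    have nf: "norm (cnj z * iexp (w k \<bullet> X 1 \<omega>)) = 1" for \<omega>
      using w[of k] by (simp add: norm_mult z_def)
    have f1: "f \<omega> \<le> 1" for \<omega> using nf[of \<omega>] complex_Re_le_cmod unfolding f_def by metis
    have intf: "integrable M f" unfolding f_def by (intro integrable_Re integrable_mult_right int)
    have "integral\<^sup>L M f = Re (cnj z * (CLINT \<omega>|M. iexp (w k \<bullet> X 1 \<omega>)))"
      unfolding f_def by (subst integral_Re) (auto intro!: integrable_mult_right int)
    also have "\<dots> = 1" using z by (simp add: z_def cf_def)
    finally have "integral\<^sup>L M (\<lambda>\<omega>. 1 - f \<omega>) = 0"
      using intf by (simp add: prob_space)
    then have "AE \<omega> in M. 1 - f \<omega> = 0"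
      using intf f1 by (subst (asm) integral_nonneg_eq_0_iff_AE) auto
    then show ?thesis
    proof eventually_elim
      case (elim \<omega>)
      let ?y = "cnj z * iexp (w k \<bullet> X 1 \<omega>)"
      have "Re ?y = 1" using elim by (simp add: f_def)
      moreover have "(Re ?y)\<^sup>2 + (Im ?y)\<^sup>2 = 1" using nf[of \<omega>] by (metis cmod_power2 one_power2)
      ultimately have "?y = 1" by (simp add: complex_eq_iff)
      then have "(cnj z * z) * iexp (w k \<bullet> X 1 \<omega>) = z" by (simp add: mult.assoc mult.left_commute)
      then show ?case unfolding z by (simp only: z_def mult_1)
    qed
  qed
  then have ae: "AE \<omega> in M. \<forall>k. iexp (w k \<bullet> X 1 \<omega>) = cf 1 (w k)" by (simp add: AE_all_countable)
  then obtain \<omega>0 where \<omega>0: "\<And>k. iexp (w k \<bullet> X 1 \<omega>0) = cf 1 (w k)"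
    using eventually_happens'[OF ae_filter_bot] by blast
  show ?thesis
  proof (rule that[of "X 1 \<omega>0"])
    show "AE \<omega> in M. \<forall>k. \<exists>n::int. w k \<bullet> (X 1 \<omega> - X 1 \<omega>0) = of_int n * (2 * pi)"
      using ae
    proof eventually_elim
      case (elim \<omega>)
      show ?case
      proof
        fix k
        have "iexp (w k \<bullet> (X 1 \<omega> - X 1 \<omega>0)) = iexp (w k \<bullet> X 1 \<omega>) / iexp (w k \<bullet> X 1 \<omega>0)"
          by (simp add: exp_diff[symmetric] inner_diff_right algebra_simps)
        also have "\<dots> = 1" using elim \<omega>0[of k] w[of k] by auto
        finally show "\<exists>n::int. w k \<bullet> (X 1 \<omega> - X 1 \<omega>0) = of_int n * (2 * pi)"
          by (auto simp: exp_eq_1)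
      qed
    qed
  qed
qed

end

section \<open>Scaling, fullness and the Levy exponent\<close>

locale semistable = levy M X
  for M :: "'w measure" and X :: "real \<Rightarrow> 'w \<Rightarrow> real^'n" +
  fixes c :: real and E :: "real^'n \<Rightarrow> real^'n"
  assumes c: "c > 1" and lin: "linear E" and semistable: "operator_semistable M X c E"
    and no_gauss: "no_gaussian_component M X"
begin

lemma continuous_flow: "continuous_on S (flow E t)"
  using linear_flow[OF lin] by (rule linear_continuous_on[OF linear_conv_bounded_linear[THEN iffD1]])

lemma flow_measurable [measurable]: "flow E t \<in> borel_measurable borel"
  by (rule borel_measurable_continuous_onI[OF continuous_flow])

lemma scaling_1:
  assumes t: "t \<ge> 0"
  shows "distr M borel (X (c * t)) = distr M borel (\<lambda>\<omega>. flow E (ln c) (X t \<omega>))"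
proof -
  have [measurable]: "X (c * t) \<in> borel_measurable M" "X t \<in> borel_measurable M"
    using t c by (auto intro: X_measurable)
  have flow_X: "(\<lambda>\<omega>. flow E (ln c) (X t \<omega>)) \<in> borel_measurable M" by measurable
  have [measurable]: "(\<lambda>\<omega>. \<lambda>s\<in>{t}. X (c * s) \<omega>) \<in> M \<rightarrow>\<^sub>M Pi\<^sub>M {t} (\<lambda>_. borel)"
    by (rule measurable_restrict) simp
  have [measurable]: "(\<lambda>\<omega>. \<lambda>s\<in>{t}. flow E (ln c) (X s \<omega>)) \<in> M \<rightarrow>\<^sub>M Pi\<^sub>M {t} (\<lambda>_. borel)"
    by (rule measurable_restrict[where X = "\<lambda>s \<omega>. flow E (ln c) (X s \<omega>)"]) (use flow_X in simp)
  have "distr M (Pi\<^sub>M {t} (\<lambda>_. borel)) (\<lambda>\<omega>. \<lambda>s\<in>{t}. X (c * s) \<omega>) =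
      distr M (Pi\<^sub>M {t} (\<lambda>_. borel)) (\<lambda>\<omega>. \<lambda>s\<in>{t}. flow E (ln c) (X s \<omega>))" (is "?L = ?R")
    using semistable t unfolding operator_semistable_def same_fdd_def op_powr_eq_flow by blast
  then have "distr ?L borel (\<lambda>f. f t) = distr ?R borel (\<lambda>f. f t)" by simp
  moreover have "distr ?L borel (\<lambda>f. f t) = distr M borel (X (c * t))"
    by (subst distr_distr) (auto simp: o_def)
  moreover have "distr ?R borel (\<lambda>f. f t) = distr M borel (\<lambda>\<omega>. flow E (ln c) (X t \<omega>))"
    by (subst distr_distr) (auto simp: o_def)
  ultimately show ?thesis by simp
qed

lemma scaling:
  assumes t: "t \<ge> 0"
  shows "distr M borel (X (c ^ k * t)) = distr M borel (\<lambda>\<omega>. flow E (real k * ln c) (X t \<omega>))"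
proof (induction k)
  case 0
  show ?case by (simp add: flow_0[OF lin])
next
  case (Suc k)
  have pos: "c ^ k * t \<ge> 0" using t c by simp
  have [measurable]: "X (c ^ k * t) \<in> borel_measurable M" "X t \<in> borel_measurable M"
    using t pos by (auto intro: X_measurable)
  have "distr M borel (X (c ^ Suc k * t)) = distr M borel (\<lambda>\<omega>. flow E (ln c) (X (c ^ k * t) \<omega>))"
    using scaling_1[OF pos] by (simp add: mult.assoc)
  also have "\<dots> = distr (distr M borel (X (c ^ k * t))) borel (flow E (ln c))"
    by (subst distr_distr) (auto simp: o_def)
  also have "\<dots> = distr (distr M borel (\<lambda>\<omega>. flow E (real k * ln c) (X t \<omega>))) borel (flow E (ln c))"
    by (simp only: Suc)
  also have "\<dots> = distr M borel (\<lambda>\<omega>. flow E (ln c) (flow E (real k * ln c) (X t \<omega>)))"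
    by (subst distr_distr) (auto simp: o_def)
  finally show ?case by (simp add: flow_add[OF lin, symmetric] distrib_right)
qed

lemma prob_scaling:
  assumes t: "t \<ge> 0" and [measurable]: "Measurable.pred borel P"
  shows "prob {\<omega> \<in> space M. P (X (c ^ k * t) \<omega>)} = prob {\<omega> \<in> space M. P (flow E (real k * ln c) (X t \<omega>))}"
proof -
  have [measurable]: "X (c ^ k * t) \<in> borel_measurable M" "X t \<in> borel_measurable M"
    using t c by (auto intro: X_measurable)
  have "measure (distr M borel (X (c ^ k * t))) {x. P x}
      = measure (distr M borel (\<lambda>\<omega>. flow E (real k * ln c) (X t \<omega>))) {x. P x}"
    by (simp only: scaling[OF t])
  then show ?thesis by (simp add: measure_distr vimage_def Int_def conj_commute)
qed

lemma cf_scaling: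
  assumes t: "t \<ge> 0" and uw: "\<And>x. u \<bullet> flow E (real k * ln c) x = w \<bullet> x"
  shows "cf (c ^ k * t) u = cf t w"
proof -
  have [measurable]: "X t \<in> borel_measurable M" using t by (rule X_measurable)
  have "cf (c ^ k * t) u = (CLINT x|distr M borel (\<lambda>\<omega>. flow E (real k * ln c) (X t \<omega>)). iexp (u \<bullet> x))"
    using t c by (subst cf_distr) (simp_all add: scaling)
  also have "\<dots> = cf t w"
    by (subst integral_distr) (auto simp: uw cf_def)
  finally show ?thesis .
qed

lemma not_constant:
  assumes "v \<noteq> 0" shows "\<not> (AE \<omega> in M. v \<bullet> X 1 \<omega> = d)"
proof
  assume ae: "AE \<omega> in M. v \<bullet> X 1 \<omega> = d"
  have [measurable]: "X 1 \<in> borel_measurable M" by (rule X_measurable) simp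
  have "AE x in distr M borel (X 1). x \<in> {x. v \<bullet> x = d}"
    using ae by (subst AE_distr_iff) auto
  moreover have "affine {x. v \<bullet> x = d}" by (rule affine_hyperplane)
  moreover have "aff_dim {x. v \<bullet> x = d} < int CARD('n)"
    using assms by (simp add: aff_dim_hyperplane)
  ultimately show False
    using semistable unfolding operator_semistable_def full_distribution_def by blast
qed

text \<open>If the modulus were 1 at all \<open>u / (k + 1)\<close>, the values of
  \<open>u \<bullet> X 1\<close> would lie on lattices of arbitrarily large spacing through a common
  point, hence be constant, against fullness. The stronger \<open>norm_cf_less_1\<close> presupposes
  a contracting backward flow and so \<open>a > 0\<close>, which is itself obtained through the
  present lemma.\<close>

lemma ex_norm_cf_less_1:
  assumes u: "u \<noteq> 0" shows "\<exists>s>0. norm (cf 1 (s *\<^sub>R u)) < 1"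
proof (rule ccontr)
  assume "\<not> ?thesis"
  then have "norm (cf 1 ((1 / real (Suc k)) *\<^sub>R u)) = 1" for k
    using norm_cf_le_1 by (meson antisym_conv2 divide_pos_pos of_nat_0_less_iff zero_less_Suc zero_less_one)
  then obtain x0 where
    ae: "AE \<omega> in M. \<forall>k. \<exists>n::int. ((1 / real (Suc k)) *\<^sub>R u) \<bullet> (X 1 \<omega> - x0) = of_int n * (2 * pi)"
    using norm_cf_1_imp_lattice[of "\<lambda>k. (1 / real (Suc k)) *\<^sub>R u"] by blast
  have "AE \<omega> in M. u \<bullet> X 1 \<omega> = u \<bullet> x0"
    using ae
  proof eventually_elim
    case (elim \<omega>)
    let ?y = "u \<bullet> (X 1 \<omega> - x0)"
    obtain k :: nat where k: "\<bar>?y\<bar> < real k" using reals_Archimedean2 by blast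
    obtain n :: int where n: "?y / real (Suc k) = of_int n * (2 * pi)" using elim[rule_format, of k] by auto
    have "\<bar>?y / real (Suc k)\<bar> < 1" using k by (simp add: abs_divide)
    then have "\<bar>of_int n * (2 * pi)\<bar> < 1" unfolding n .
    then have "n = 0" by (rule abs_multiple_2pi_less_1)
    then show ?case using n by (simp add: inner_diff_right)
  qed
  then show False using not_constant[OF u] by blast
qed

text \<open>Only the real part of the Levy-Khintchine exponent affects the modulus; without a
  Gaussian part it is the integral of cos - 1 against the Levy measure.\<close>

lemma norm_cf_ge_exp:
  obtains \<nu> where "sets \<nu> = sets borel" "integrable \<nu> (\<lambda>x::real^'n. min 1 ((norm x)\<^sup>2))"
    "\<And>v. norm (cf 1 v) \<ge> exp (- (LINT x|\<nu>. 1 - cos (v \<bullet> x)))"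
proof -
  obtain \<nu> b where T: "levy_triplet (distr M borel (X 1)) 0 \<nu> b"
    using no_gauss unfolding no_gaussian_component_def by blast
  have "norm (cf 1 v) \<ge> exp (- (LINT x|\<nu>. 1 - cos (v \<bullet> x)))" for v
  proof -
    let ?g = "\<lambda>x. iexp (v \<bullet> x) - 1 - \<i> * complex_of_real (v \<bullet> x) * indicator (cball 0 1) x"
    have "cf 1 v = exp (\<i> * complex_of_real (b \<bullet> v) - complex_of_real (v \<bullet> (0 *v v)) / 2 + (CLINT x|\<nu>. ?g x))"
      using T by (simp add: levy_triplet_def cf_distr)
    then have n: "norm (cf 1 v) = exp (Re (CLINT x|\<nu>. ?g x))" by simp
    have Re_g: "Re (?g x) = - (1 - cos (v \<bullet> x))" for x
      by (simp add: exp_Euler cos_of_real sin_of_real indicator_def)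
    have "(LINT x|\<nu>. 1 - cos (v \<bullet> x)) \<ge> - Re (CLINT x|\<nu>. ?g x)"
    proof (cases "integrable \<nu> ?g")
      case True
      then have "Re (CLINT x|\<nu>. ?g x) = (LINT x|\<nu>. Re (?g x))"
        by (rule integral_Re[symmetric])
      also have "\<dots> = - (LINT x|\<nu>. 1 - cos (v \<bullet> x))" unfolding Re_g by (rule integral_minus)
      finally show ?thesis by simp
    next
      \<comment> \<open>By convention the integral of a non-integrable function is 0, and what
        remains is nonnegativity of the integral of \<open>1 - cos\<close>.\<close>
      case False
      then show ?thesis by (simp add: not_integrable_integral_eq)
    qed
    then show ?thesis by (simp add: n)
  qed
  then show ?thesis using that T unfolding levy_triplet_def by blast
qed

text \<open>Without a Gaussian component \<open>- ln (norm (cf 1 v)) = o((norm v)\<^sup>2)\<close>, whereas along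
  the orbit of an eigenvector it grows at least like \<open>c ^ k\<close>.\<close>

lemma eigenvalue_gt_half:
  assumes u0: "u0 \<noteq> 0" and eig0: "\<And>y. u0 \<bullet> E y = a * (u0 \<bullet> y)"
  shows "a > 1 / 2"
proof (rule ccontr)
  assume "\<not> a > 1 / 2"
  then have a: "2 * a \<le> 1" by simp
  obtain s where s: "s > 0" "norm (cf 1 (s *\<^sub>R u0)) < 1" using ex_norm_cf_less_1[OF u0] by blast
  define u where "u = s *\<^sub>R u0"
  have eig: "u \<bullet> E y = a * (u \<bullet> y)" for y by (simp add: u_def eig0)
  define \<theta> where "\<theta> = norm (cf 1 u)"
  have \<theta>1: "\<theta> < 1" using s by (simp add: \<theta>_def u_def)
  obtain \<nu> where \<nu>: "sets \<nu> = sets borel" "integrable \<nu> (\<lambda>x::real^'n. min 1 ((norm x)\<^sup>2))"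
    "\<And>v. norm (cf 1 v) \<ge> exp (- (LINT x|\<nu>. 1 - cos (v \<bullet> x)))"
    using norm_cf_ge_exp by blast
  have [measurable_cong]: "sets \<nu> = sets borel" by fact
  define r where "r k = exp (a * (real k * ln c))" for k :: nat
  define G where "G k = (LINT x|\<nu>. 1 - cos ((r k *\<^sub>R u) \<bullet> x))" for k
  have cf_r: "cf (c ^ k * 1) u = cf 1 (r k *\<^sub>R u)" for k
    by (rule cf_scaling) (simp_all add: inner_flow_eigen[OF lin eig] r_def)
  have le: "exp (- G k) \<le> \<theta> ^ nat \<lfloor>c ^ k\<rfloor>" for k
  proof -
    have "exp (- G k) \<le> norm (cf (c ^ k) u)" using \<nu>(3)[of "r k *\<^sub>R u"] cf_r[of k] by (simp add: G_def)
    also have "\<dots> \<le> \<theta> ^ nat \<lfloor>c ^ k\<rfloor>" unfolding \<theta>_def using c by (intro norm_cf_le_floor) simp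
    finally show ?thesis .
  qed
  have ck: "c ^ k \<ge> 1" for k using c by simp
  have \<theta>0: "\<theta> > 0"
  proof -
    have "0 < \<theta> ^ nat \<lfloor>c ^ 0\<rfloor>" using le[of 0] exp_gt_zero less_le_trans by blast
    then show ?thesis by simp
  qed
  \<comment> \<open>The exponent grows at least like \<open>c ^ k\<close>; the factor 1/2 pays for
    the floor, since \<open>c ^ k \<ge> 1\<close>.\<close>
  have G_ge: "G k / c ^ k \<ge> (- ln \<theta>) / 2" for k
  proof -
    have "- G k \<le> ln (\<theta> ^ nat \<lfloor>c ^ k\<rfloor>)"
      using le[of k] \<theta>0 by (simp add: ln_ge_iff)
    then have "real (nat \<lfloor>c ^ k\<rfloor>) * (- ln \<theta>) \<le> G k" using \<theta>0 by (simp add: ln_realpow)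
    moreover have "c ^ k / 2 \<le> real (nat \<lfloor>c ^ k\<rfloor>)"
    proof -
      have "of_int \<lfloor>c ^ k\<rfloor> \<ge> (1::real)" using ck[of k] by simp
      then show ?thesis using ck[of k] by linarith
    qed
    moreover have "- ln \<theta> > 0" using \<theta>0 \<theta>1 by simp
    ultimately have "c ^ k / 2 * (- ln \<theta>) \<le> G k"
      by (meson less_imp_le mult_right_mono order_trans)
    then show ?thesis using ck[of k] c by (simp add: field_simps)
  qed
  have "(\<lambda>k. LINT x|\<nu>. (1 - cos ((r k *\<^sub>R u) \<bullet> x)) / c ^ k) \<longlonglongrightarrow> (LINT x|\<nu>. 0)"
  \<comment> \<open>For large \<open>x\<close> the bound \<open>1 - cos \<le> 2\<close> dominates;
    for small \<open>x\<close> the quadratic bound does, since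
    \<open>(r k)\<^sup>2 \<le> c ^ k\<close>, which is where \<open>2 * a \<le> 1\<close>
    enters.\<close>
  proof (rule integral_dominated_convergence[where w = "\<lambda>x. (2 + (norm u)\<^sup>2) * min 1 ((norm x)\<^sup>2)"])
    show "integrable \<nu> (\<lambda>x. (2 + (norm u)\<^sup>2) * min 1 ((norm x)\<^sup>2))" using \<nu>(2) by simp
    show "AE x in \<nu>. (\<lambda>k. (1 - cos ((r k *\<^sub>R u) \<bullet> x)) / c ^ k) \<longlonglongrightarrow> 0"
    proof (rule AE_I2)
      fix x
      have "(\<lambda>k. 2 * (1 / c) ^ k) \<longlonglongrightarrow> 2 * 0"
        using c by (intro tendsto_intros LIMSEQ_power_zero) simp
      then have 1: "(\<lambda>k. 2 * (1 / c) ^ k) \<longlonglongrightarrow> 0" by simp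
      have 2: "norm ((1 - cos ((r k *\<^sub>R u) \<bullet> x)) / c ^ k) \<le> 2 * (1 / c) ^ k" for k
      proof -
        have "\<bar>1 - cos ((r k *\<^sub>R u) \<bullet> x)\<bar> \<le> 2"
          using cos_ge_minus_one[of "(r k *\<^sub>R u) \<bullet> x"] cos_le_one[of "(r k *\<^sub>R u) \<bullet> x"] by linarith
        then have "\<bar>1 - cos ((r k *\<^sub>R u) \<bullet> x)\<bar> / c ^ k \<le> 2 / c ^ k"
          using c by (intro divide_right_mono) auto
        then show ?thesis using c by (simp add: power_divide abs_divide)
      qed
      show "(\<lambda>k. (1 - cos ((r k *\<^sub>R u) \<bullet> x)) / c ^ k) \<longlonglongrightarrow> 0"
        by (rule Lim_null_comparison[OF always_eventually[OF allI] 1]) (rule 2)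
    qed
    show "AE x in \<nu>. norm ((1 - cos ((r k *\<^sub>R u) \<bullet> x)) / c ^ k) \<le> (2 + (norm u)\<^sup>2) * min 1 ((norm x)\<^sup>2)" for k
    proof (rule AE_I2)
      fix x
      define y where "y = (r k *\<^sub>R u) \<bullet> x"
      have nn: "1 - cos y \<ge> 0" by simp
      have b1: "(1 - cos y) / c ^ k \<le> 2"
      proof -
        have "(1 - cos y) / c ^ k \<le> (1 - cos y) / 1" using ck[of k] nn by (intro divide_left_mono) auto
        also have "\<dots> \<le> 2" using cos_ge_minus_one[of y] by simp
        finally show ?thesis .
      qed
      have b2: "(1 - cos y) / c ^ k \<le> (norm u)\<^sup>2 * (norm x)\<^sup>2"
      proof -
        have "(r k)\<^sup>2 = exp (2 * a * (real k * ln c))"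
          by (simp add: r_def power2_eq_square exp_add[symmetric] algebra_simps)
        also have "\<dots> \<le> exp (1 * (real k * ln c))"
          using a c by (intro exp_mono mult_right_mono) auto
        also have "\<dots> = c ^ k" using c by (simp add: exp_of_nat_mult)
        finally have r2: "(r k)\<^sup>2 \<le> c ^ k" .
        have "y\<^sup>2 = (r k)\<^sup>2 * (u \<bullet> x)\<^sup>2" by (simp add: y_def power_mult_distrib)
        also have "\<dots> \<le> c ^ k * ((norm u)\<^sup>2 * (norm x)\<^sup>2)"
          using r2 Cauchy_Schwarz_ineq[of u x] c
          by (intro mult_mono) (auto simp: power2_norm_eq_inner)
        finally have "y\<^sup>2 / 2 \<le> c ^ k * ((norm u)\<^sup>2 * (norm x)\<^sup>2)"
          using zero_le_power2[of y] by linarith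
        then have "1 - cos y \<le> c ^ k * ((norm u)\<^sup>2 * (norm x)\<^sup>2)"
          using one_minus_cos_le_square[of y] by linarith
        then show ?thesis using c by (simp add: pos_divide_le_eq mult.commute)
      qed
      have "(1 - cos y) / c ^ k \<le> (2 + (norm u)\<^sup>2) * min 1 ((norm x)\<^sup>2)"
      proof (cases "(norm x)\<^sup>2 \<le> 1")
        case True
        have "(norm u)\<^sup>2 * (norm x)\<^sup>2 \<le> (2 + (norm u)\<^sup>2) * (norm x)\<^sup>2" by (intro mult_right_mono) auto
        with True b2 show ?thesis by (simp add: min_def)
      next
        case False
        have "(norm u)\<^sup>2 \<ge> 0" by simp
        then have "(1 - cos y) / c ^ k \<le> 2 + (norm u)\<^sup>2" using b1 by linarith
        with False show ?thesis by (simp add: min_def)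
      qed
      then show "norm ((1 - cos ((r k *\<^sub>R u) \<bullet> x)) / c ^ k) \<le> (2 + (norm u)\<^sup>2) * min 1 ((norm x)\<^sup>2)"
        using nn c by (simp add: y_def)
    qed
  qed measurable
  then have "(\<lambda>k. G k / c ^ k) \<longlonglongrightarrow> 0" by (simp add: G_def)
  then have "eventually (\<lambda>k. G k / c ^ k < (- ln \<theta>) / 2) sequentially"
    using \<theta>0 \<theta>1 by (intro order_tendstoD) auto
  then obtain k where "G k / c ^ k < (- ln \<theta>) / 2"
    using eventually_happens'[OF sequentially_bot] by blast
  then show False using G_ge[of k] by linarith
qed

end

section \<open>Decay of the characteristic function\<close>

text \<open>\<open>a\<close> is only a rate of contraction; the eigenvalues \<open>b\<close>,
  \<open>b1\<close>, \<open>b2\<close> in the small ball lemmas are separate parameters, so that the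
  same estimates serve both blocks.\<close>

locale contracting_semistable = semistable M X c E
  for M :: "'w measure" and X :: "real \<Rightarrow> 'w \<Rightarrow> real^'n" and c :: real
    and E :: "real^'n \<Rightarrow> real^'n" +
  fixes a C0 :: real
  assumes a0: "a > 0" and C0: "C0 > 0"
    and flow_back: "\<And>t x. t \<ge> 0 \<Longrightarrow> norm (flow E (-t) x) \<le> C0 * exp (- a * t) * norm x"
begin

text \<open>The transpose of \<open>c\<close> to the power \<open>- k E\<close>: the frequency that
  plays at time \<open>c ^ k * t\<close> the role of \<open>v\<close> at time \<open>t\<close>.
  Backward contraction makes it tend to 0 as \<open>k\<close> grows.\<close>

definition pullback :: "nat \<Rightarrow> real^'n \<Rightarrow> real^'n" where
  "pullback k v = adjoint (flow E (- (real k * ln c))) v"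

lemma inner_pullback: "pullback k v \<bullet> x = v \<bullet> flow E (- (real k * ln c)) x"
  unfolding pullback_def by (rule inner_adjoint[OF linear_flow[OF lin]])

lemma pullback_flow: "pullback k v \<bullet> flow E (real k * ln c) x = v \<bullet> x"
  by (simp add: inner_pullback flow_add[OF lin, symmetric] flow_0[OF lin])

lemma cf_pullback: "t \<ge> 0 \<Longrightarrow> cf (c ^ k * t) (pullback k v) = cf t v"
  by (rule cf_scaling) (auto simp: pullback_flow)

lemma exp_decay_power: "exp (- a * (real k * ln c)) = (c powr (-a)) ^ k"
  using c by (simp add: powr_def exp_of_nat_mult[symmetric] ac_simps)

lemma pullback_decay_tendsto: "(\<lambda>k. K * exp (- a * (real k * ln c)) * L) \<longlonglongrightarrow> 0"
proof -
  have "c powr (-a) < c powr 0" using a0 c by (intro powr_less_mono) auto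
  then have "(\<lambda>k. K * (c powr (-a)) ^ k * L) \<longlonglongrightarrow> K * 0 * L"
    using c by (intro tendsto_intros LIMSEQ_power_zero) simp
  then show ?thesis by (simp only: exp_decay_power) simp
qed

lemma norm_inner_pullback: "\<bar>pullback k v \<bullet> x\<bar> \<le> (norm v * C0) * exp (- a * (real k * ln c)) * norm x"
proof -
  have "\<bar>pullback k v \<bullet> x\<bar> \<le> norm v * norm (flow E (- (real k * ln c)) x)"
    unfolding inner_pullback by (rule Cauchy_Schwarz_ineq2)
  also have "\<dots> \<le> norm v * (C0 * exp (- a * (real k * ln c)) * norm x)"
    using c by (intro mult_left_mono flow_back) auto
  finally show ?thesis by (simp add: ac_simps)
qed

lemma norm_pullback: "norm (pullback k v) \<le> (norm v * C0) * exp (- a * (real k * ln c))"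
proof -
  have "norm (pullback k v) * norm (pullback k v) \<le> (norm v * C0) * exp (- a * (real k * ln c)) * norm (pullback k v)"
    using norm_inner_pullback[of k v "pullback k v"] by (simp add: power2_norm_eq_inner[symmetric] power2_eq_square)
  then show ?thesis using C0 by (cases "pullback k v = 0") auto
qed

text \<open>An integer-valued sequence \<open>pullback k v \<bullet> z / (2 pi)\<close> tending to \<open>0\<close> vanishes eventually; the flow
  permutes the increasing subspaces \<open>S j = {z. \<forall>k\<ge>j. pullback k v \<bullet> z = 0}\<close>, so these have equal dimension.\<close>

lemma lattice_orbit_imp_0:
  assumes z: "\<And>k. \<exists>n::int. pullback k v \<bullet> z = of_int n * (2 * pi)"
  shows "v \<bullet> z = 0"
proof -
  define S where "S j = {z. \<forall>k\<ge>j. pullback k v \<bullet> z = 0}" for j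
  have sub: "subspace (S j)" for j
    unfolding S_def subspace_def by (auto simp: inner_add_right)
  have "S j = S 0" for j
  proof (induction j)
    case (Suc j)
    have "S j \<subseteq> S (Suc j)" by (auto simp: S_def)
    moreover have "dim (S (Suc j)) \<le> dim (S j)"
    proof -
      let ?f = "flow E (- ln c)"
      have "inj ?f"
      proof (rule inj_on_inverseI)
        show "flow E (ln c) (?f x) = x" for x by (simp add: flow_add[OF lin, symmetric] flow_0[OF lin])
      qed
      then have "dim (?f ` S (Suc j)) = dim (S (Suc j))"
        by (intro dim_image_eq linear_flow[OF lin]) (auto intro: inj_on_subset)
      moreover have "?f ` S (Suc j) \<subseteq> S j"
      proof (clarsimp simp: S_def)
        fix x k assume x: "\<forall>k\<ge>Suc j. pullback k v \<bullet> x = 0" and k: "j \<le> k"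
        have "pullback k v \<bullet> ?f x = pullback (Suc k) v \<bullet> x"
          by (simp add: inner_pullback flow_add[OF lin, symmetric] algebra_simps)
        then show "pullback k v \<bullet> ?f x = 0" using x k by simp
      qed
      ultimately show ?thesis by (metis dim_subset)
    qed
    ultimately have "S j = S (Suc j)" using sub by (intro subspace_dim_equal)
    then show ?case using Suc by simp
  qed simp
  moreover obtain j where "z \<in> S j"
  proof -
    have "(\<lambda>k. (norm v * C0) * exp (- a * (real k * ln c)) * norm z) \<longlonglongrightarrow> 0" by (rule pullback_decay_tendsto)
    then have "eventually (\<lambda>k. (norm v * C0) * exp (- a * (real k * ln c)) * norm z < 1) sequentially"
      by (rule order_tendstoD) simp
    then obtain j where j: "\<And>k. k \<ge> j \<Longrightarrow> (norm v * C0) * exp (- a * (real k * ln c)) * norm z < 1"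
      unfolding eventually_sequentially by blast
    have "pullback k v \<bullet> z = 0" if "k \<ge> j" for k
    proof -
      obtain n :: int where n: "pullback k v \<bullet> z = of_int n * (2 * pi)" using z by blast
      have "\<bar>pullback k v \<bullet> z\<bar> < 1" using j[OF that] norm_inner_pullback[of k v z] by linarith
      then have "n = 0" unfolding n by (rule abs_multiple_2pi_less_1)
      then show ?thesis by (simp add: n)
    qed
    then show ?thesis using that by (auto simp: S_def)
  qed
  ultimately have "z \<in> S 0" by blast
  then have "pullback 0 v \<bullet> z = 0" by (simp add: S_def)
  then show ?thesis by (simp add: inner_pullback flow_0[OF lin])
qed

text \<open>The modulus decreases in time, so modulus 1 at time 1 holds also at the earlier times
  \<open>1 / c ^ k\<close>, that is, at time 1 for every pullback of \<open>v\<close>. These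
  frequencies tend to 0, and the resulting lattice conditions leave only a constant for
  \<open>v \<bullet> X 1\<close>.\<close>

lemma norm_cf_less_1:
  assumes v: "v \<noteq> 0" shows "norm (cf 1 v) < 1"
proof (rule ccontr)
  assume "\<not> ?thesis"
  then have v1: "norm (cf 1 v) \<ge> 1" by simp
  have "norm (cf 1 (pullback k v)) = 1" for k
  proof -
    have ck: "1 / c ^ k \<ge> 0" "1 / c ^ k \<le> 1" "c ^ k * (1 / c ^ k) = 1" using c by auto
    have "norm (cf 1 v) \<le> norm (cf (1 / c ^ k) v)" using ck by (intro norm_cf_antimono) auto
    also have "\<dots> = norm (cf 1 (pullback k v))" using cf_pullback[OF ck(1), of k v] ck(3) by simp
    finally show ?thesis using v1 norm_cf_le_1[of 1 "pullback k v"] by linarith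
  qed
  then obtain x0 where
    "AE \<omega> in M. \<forall>k. \<exists>n::int. pullback k v \<bullet> (X 1 \<omega> - x0) = of_int n * (2 * pi)"
    by (rule norm_cf_1_imp_lattice)
  then have "AE \<omega> in M. v \<bullet> X 1 \<omega> = v \<bullet> x0"
  proof eventually_elim
    case (elim \<omega>)
    then have "v \<bullet> (X 1 \<omega> - x0) = 0" by (intro lattice_orbit_imp_0) blast
    then show ?case by (simp add: inner_diff_right)
  qed
  then show False using not_constant[OF v] by blast
qed

text \<open>\<open>c ^ k\<close> eventually exceeds any multiple of \<open>k\<close>. A power
  \<open>L\<close> with \<open>\<theta> ^ L * \<mu> < 1\<close> then makes the product at most 1,
  and \<open>\<mu> ^ k0\<close> covers the initial indices.\<close>

lemma power_floor_superexponential: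
  assumes \<theta>: "0 < \<theta>" "\<theta> < 1" and \<mu>: "\<mu> > (1::real)"
  obtains K where "K > 0" "\<And>k. \<theta> ^ nat \<lfloor>c ^ k\<rfloor> * \<mu> ^ k \<le> K"
proof -
  obtain L where L: "\<theta> ^ L < 1 / \<mu>"
    using real_arch_pow_inv[of "1 / \<mu>" \<theta>] \<theta> \<mu> by auto
  have "(\<lambda>n. of_nat n * (1 / c) ^ n) \<longlonglongrightarrow> 0"
    using c by (intro powser_times_n_limit_0) simp
  then have "eventually (\<lambda>n. of_nat n * (1 / c) ^ n < 1 / (real L + 1)) sequentially"
    by (rule order_tendstoD) simp
  then obtain k0 where k0: "\<And>k. k \<ge> k0 \<Longrightarrow> real k * (1 / c) ^ k < 1 / (real L + 1)"
    unfolding eventually_sequentially by blast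
  have "\<theta> ^ nat \<lfloor>c ^ k\<rfloor> * \<mu> ^ k \<le> \<mu> ^ k0" for k
  proof (cases "k \<ge> k0")
    case True
    have "real k * (real L + 1) < c ^ k"
      using k0[OF True] c by (simp add: power_divide field_simps)
    then have "real (k * L) \<le> c ^ k" by (simp add: algebra_simps)
    then have "k * L \<le> nat \<lfloor>c ^ k\<rfloor>" by (simp add: le_nat_floor)
    then have "\<theta> ^ nat \<lfloor>c ^ k\<rfloor> \<le> \<theta> ^ (k * L)"
      using \<theta> by (intro power_decreasing) auto
    then have "\<theta> ^ nat \<lfloor>c ^ k\<rfloor> * \<mu> ^ k \<le> \<theta> ^ (k * L) * \<mu> ^ k"
      using \<mu> by (intro mult_right_mono) auto
    also have "\<dots> = (\<theta> ^ L * \<mu>) ^ k" by (simp add: power_mult_distrib power_mult[symmetric] mult.commute)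
    also have "\<dots> \<le> 1" using L \<mu> \<theta> by (intro power_le_one) (auto simp: field_simps)
    also have "\<dots> \<le> \<mu> ^ k0" using \<mu> by simp
    finally show ?thesis .
  next
    case False
    have "\<theta> ^ nat \<lfloor>c ^ k\<rfloor> * \<mu> ^ k \<le> 1 * \<mu> ^ k"
      using \<theta> \<mu> by (intro mult_right_mono power_le_one) auto
    also have "\<dots> \<le> \<mu> ^ k0" using False \<mu> by (simp add: power_increasing)
    finally show ?thesis .
  qed
  then show ?thesis using that[of "\<mu> ^ k0"] \<mu> by simp
qed

text \<open>A large frequency is pulled back until it enters a fixed shell, where compactness bounds
  the modulus by some \<open>\<theta> < 1\<close>. The number \<open>k\<close> of steps is at least
  logarithmic in \<open>norm v\<close>, and the modulus is at most \<open>\<theta>\<close> to the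
  floor of \<open>c ^ k\<close>, which beats every power of \<open>norm v\<close>. The power 4
  leaves one integrable square for each of two functionals.\<close>

lemma cf_decay:
  obtains K where "K > 0" "\<And>v. norm (cf 1 v) \<le> K / (1 + norm v) ^ 4"
proof -
  obtain \<gamma>0 where \<gamma>0: "\<gamma>0 > 0" "\<And>x. norm (flow E (ln c) x) \<le> \<gamma>0 * norm x"
    using linear_bounded_pos[OF linear_flow[OF lin]] by metis
  \<comment> \<open>Increased by 1 so that the shell between 1 and \<open>\<gamma>\<close> is not
    empty and \<open>\<gamma> ^ 4 > 1\<close>.\<close>
  define \<gamma> where "\<gamma> = \<gamma>0 + 1"
  have \<gamma>: "\<gamma> > 1" "\<And>x. norm (flow E (ln c) x) \<le> \<gamma> * norm x"
    using \<gamma>0 by (auto simp: \<gamma>_def distrib_right intro: add_increasing2)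
  have step: "norm (pullback k v) \<le> \<gamma> * norm (pullback (Suc k) v)" for k v
  proof -
    have "pullback k v \<bullet> x = pullback (Suc k) v \<bullet> flow E (ln c) x" for x
      by (simp add: inner_pullback flow_add[OF lin, symmetric] algebra_simps)
    then have "norm (pullback k v) * norm (pullback k v) = pullback (Suc k) v \<bullet> flow E (ln c) (pullback k v)"
      by (simp add: power2_norm_eq_inner flip: power2_eq_square)
    also have "\<dots> \<le> norm (pullback (Suc k) v) * (\<gamma> * norm (pullback k v))"
      by (rule order_trans[OF norm_cauchy_schwarz mult_left_mono[OF \<gamma>(2)]]) simp
    finally show ?thesis using \<gamma>(1) by (cases "pullback k v = 0") (auto simp: ac_simps)
  qed
  have cmp: "compact (cball 0 \<gamma> - ball 0 1 :: (real^'n) set)" by (intro compact_diff) auto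
  have cont: "continuous_on (cball 0 \<gamma> - ball 0 1) (\<lambda>v. norm (cf 1 v))"
    by (intro continuous_on_norm continuous_on_subset[OF cf_continuous]) auto
  obtain \<theta> where \<theta>: "0 < \<theta>" "\<theta> < 1"
    "\<And>v. 1 \<le> norm v \<Longrightarrow> norm v \<le> \<gamma> \<Longrightarrow> norm (cf 1 v) \<le> \<theta>"
  proof -
    have "axis undefined 1 \<in> (cball 0 \<gamma> - ball 0 1 :: (real^'n) set)" using \<gamma> by simp
    then obtain w where w: "w \<in> cball 0 \<gamma> - ball 0 1"
      "\<forall>v \<in> cball 0 \<gamma> - ball 0 1. norm (cf 1 v) \<le> norm (cf 1 w)"
      using continuous_attains_sup[OF cmp _ cont] by blast
    then have "norm (cf 1 w) < 1" by (intro norm_cf_less_1) auto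
    \<comment> \<open>The maximum with 1/2 keeps \<open>\<theta>\<close> positive.\<close>
    then show thesis
      using w by (intro that[of "max (1 / 2) (norm (cf 1 w))"]) (auto simp: le_max_iff_disj)
  qed
  obtain K where K: "K > 0" "\<And>k. \<theta> ^ nat \<lfloor>c ^ k\<rfloor> * (\<gamma> ^ 4) ^ k \<le> K"
    using power_floor_superexponential[of \<theta> "\<gamma> ^ 4"] \<theta> \<gamma> by (metis one_less_power zero_less_numeral)
  have main: "norm (cf 1 v) * (1 + norm v) ^ 4 \<le> 16 * \<gamma> ^ 4 * K" if v: "norm v \<ge> 1" for v
  proof -
    have "(\<lambda>k. (norm v * C0) * exp (- a * (real k * ln c)) * 1) \<longlonglongrightarrow> 0" by (rule pullback_decay_tendsto)
    then have "eventually (\<lambda>k. (norm v * C0) * exp (- a * (real k * ln c)) * 1 < 1) sequentially"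
      by (rule order_tendstoD) simp
    then obtain n where "(norm v * C0) * exp (- a * (real n * ln c)) * 1 < 1"
      using eventually_happens'[OF sequentially_bot] by blast
    then have n: "norm (pullback n v) < 1" using norm_pullback[of n v] by simp
    \<comment> \<open>One step shrinks a pullback by at most the factor \<open>\<gamma>\<close>, so
      the predecessor \<open>k\<close> of the first index with norm below 1 lies in the
      shell.\<close>
    define m where "m = (LEAST n. norm (pullback n v) < 1)"
    have m: "norm (pullback m v) < 1" unfolding m_def by (rule LeastI[of "\<lambda>n. norm (pullback n v) < 1", OF n])
    have b0: "pullback 0 v = v"
    proof -
      have "(pullback 0 v - v) \<bullet> (pullback 0 v - v) = 0"
        by (subst inner_diff_left) (simp add: inner_pullback flow_0[OF lin])
      then show ?thesis by simp
    qed
    with m v obtain k where k: "m = Suc k" by (cases m) auto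
    then have k1: "norm (pullback k v) \<ge> 1"
      using not_less_Least[of k "\<lambda>n. norm (pullback n v) < 1"] by (auto simp: m_def)
    have k2: "norm (pullback k v) \<le> \<gamma>"
    proof -
      have "\<gamma> * norm (pullback (Suc k) v) \<le> \<gamma> * 1" using m k \<gamma>(1) by (intro mult_left_mono) auto
      then show ?thesis using step[of k v] by simp
    qed
    have "norm v \<le> \<gamma> ^ j * norm (pullback j v)" for j
    proof (induction j)
      case (Suc j)
      have "\<gamma> ^ j * norm (pullback j v) \<le> \<gamma> ^ j * (\<gamma> * norm (pullback (Suc j) v))"
        using \<gamma>(1) by (intro mult_left_mono step) auto
      then show ?case using Suc by (simp add: ac_simps)
    qed (simp add: b0)
    moreover have "\<gamma> ^ k * norm (pullback k v) \<le> \<gamma> ^ k * \<gamma>"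
      using k2 \<gamma>(1) by (intro mult_left_mono) auto
    ultimately have "norm v \<le> \<gamma> ^ k * \<gamma>" by (meson order_trans)
    then have "(1 + norm v) ^ 4 \<le> (2 * (\<gamma> ^ k * \<gamma>)) ^ 4"
      using v by (intro power_mono) auto
    also have "\<dots> = 16 * \<gamma> ^ 4 * (\<gamma> ^ 4) ^ k"
      by (simp add: power_mult_distrib power_mult[symmetric] mult.commute)
    finally have p: "(1 + norm v) ^ 4 \<le> 16 * \<gamma> ^ 4 * (\<gamma> ^ 4) ^ k" .
    have "norm (cf 1 v) = norm (cf (c ^ k) (pullback k v))" using cf_pullback[of 1 k v] by simp
    also have "\<dots> \<le> norm (cf 1 (pullback k v)) ^ nat \<lfloor>c ^ k\<rfloor>" using c by (intro norm_cf_le_floor) simp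
    also have "\<dots> \<le> \<theta> ^ nat \<lfloor>c ^ k\<rfloor>" using \<theta>(3)[OF k1 k2] by (intro power_mono) auto
    finally have "norm (cf 1 v) * (1 + norm v) ^ 4 \<le> \<theta> ^ nat \<lfloor>c ^ k\<rfloor> * (16 * \<gamma> ^ 4 * (\<gamma> ^ 4) ^ k)"
      using p \<theta> by (intro mult_mono) auto
    also have "\<dots> \<le> 16 * \<gamma> ^ 4 * K" using K(2)[of k] \<gamma>(1) by (simp add: mult.left_commute)
    finally show ?thesis .
  qed
  have "norm (cf 1 v) * (1 + norm v) ^ 4 \<le> 16 * \<gamma> ^ 4 * K + 16" for v
  proof (cases "norm v \<ge> 1")
    case True then show ?thesis using main[of v] by simp
  next
    case False
    have "(1 + norm v) ^ 4 \<le> 2 ^ 4" using False by (intro power_mono) auto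
    then have "norm (cf 1 v) * (1 + norm v) ^ 4 \<le> 1 * 2 ^ 4" by (intro mult_mono norm_cf_le_1) auto
    then have "norm (cf 1 v) * (1 + norm v) ^ 4 \<le> 16" by simp
    moreover have "16 * \<gamma> ^ 4 * K \<ge> 0" using K(1) \<gamma>(1) by simp
    ultimately show ?thesis by linarith
  qed
  moreover have "(1 + norm v) ^ 4 > 0" for v :: "real^'n"
    by (rule zero_less_power) (simp add: add_pos_nonneg)
  moreover have "16 * \<gamma> ^ 4 * K + 16 > 0" using K(1) \<gamma>(1) by (intro add_nonneg_pos) auto
  ultimately show ?thesis
    by (intro that[of "16 * \<gamma> ^ 4 * K + 16"]) (simp_all only: pos_le_divide_eq)
qed

end

section \<open>Small ball estimates\<close>

interpretation gauss: real_distribution std_normal_distribution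
  by (rule real_dist_normal_dist)

text \<open>A positive kernel with an explicit Fourier representation: expectations of Gaussian
  bumps become averages of characteristic functions, and the bumps dominate multiples of small ball
  indicators.\<close>

lemma gauss_kernel:
  "complex_of_real (exp (- x\<^sup>2 / 2)) = (CLINT s|std_normal_distribution. iexp (x * s))"
  using fun_cong[OF char_std_normal_distribution, of x] by (simp add: char_def)

lemma cauchy_density_integral:
  assumes \<rho>: "\<rho> > (0::real)"
  shows "has_bochner_integral lborel (\<lambda>s. inverse (1 + (\<rho> * s)\<^sup>2)) (pi / \<rho>)"
proof -
  have "integrable lborel (\<lambda>s::real. inverse (1 + s\<^sup>2))"
    using integrable_inverse_1_plus_square by (simp add: set_integrable_def einterval_def)
  moreover have "(LINT s|lborel. inverse (1 + s\<^sup>2)) = pi"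
    using LBINT_inverse_1_plus_square
    by (simp add: interval_lebesgue_integral_def set_lebesgue_integral_def einterval_def)
  ultimately have "has_bochner_integral lborel (\<lambda>s::real. inverse (1 + s\<^sup>2)) pi"
    by (simp add: has_bochner_integral_iff)
  then have "has_bochner_integral lborel (\<lambda>s. inverse (1 + (0 + \<rho> * s)\<^sup>2)) (pi /\<^sub>R \<bar>\<rho>\<bar>)"
    using \<rho> by (subst (asm) lborel_has_bochner_integral_real_affine_iff[of \<rho> _ _ 0]) auto
  then show ?thesis using \<rho> by (simp add: divide_inverse mult.commute)
qed

text \<open>The gain \<open>1 / \<rho>\<close> becomes the width of the ball times a negative power
  of time. The constant 2 comes from bounding the normal density by 1/2 and pi by 4.\<close>

lemma gauss_cauchy_integral:
  assumes \<rho>: "\<rho> > (0::real)"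
  shows "(LINT s|std_normal_distribution. inverse (1 + (\<rho> * s)\<^sup>2)) \<le> 2 / \<rho>"
proof -
  have s2pi: "sqrt (2 * pi) \<ge> 2" using pi_ge_two by (intro real_le_rsqrt) simp
  have *: "std_normal_density s \<le> 1 / 2" for s
  proof -
    have "exp (- s\<^sup>2 / 2) \<le> 1" by simp
    then have "(1 / sqrt (2 * pi)) * exp (- s\<^sup>2 / 2) \<le> (1 / 2) * 1"
      using s2pi by (intro mult_mono) (auto simp: field_simps)
    then show ?thesis by (simp add: std_normal_density_def)
  qed
  note C = cauchy_density_integral[OF \<rho>, unfolded has_bochner_integral_iff]
  have "(LINT s|std_normal_distribution. inverse (1 + (\<rho> * s)\<^sup>2))
      = (LINT s|lborel. std_normal_density s * inverse (1 + (\<rho> * s)\<^sup>2))"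
    by (subst integral_density) auto
  also have "\<dots> \<le> (LINT s|lborel. (1 / 2) * inverse (1 + (\<rho> * s)\<^sup>2))"
  proof (rule integral_mono)
    show i: "integrable lborel (\<lambda>s. (1 / 2) * inverse (1 + (\<rho> * s)\<^sup>2))" using C by simp
    show m: "std_normal_density s * inverse (1 + (\<rho> * s)\<^sup>2) \<le> (1 / 2) * inverse (1 + (\<rho> * s)\<^sup>2)" for s
      by (intro mult_right_mono *) simp
    show "integrable lborel (\<lambda>s. std_normal_density s * inverse (1 + (\<rho> * s)\<^sup>2))"
      by (rule Bochner_Integration.integrable_bound[OF i]) (use m in \<open>auto intro!: AE_I2 simp: abs_mult\<close>)
  qed
  also have "\<dots> = (1 / 2) * (pi / \<rho>)" using C by simp
  also have "\<dots> \<le> (1 / 2) * (4 / \<rho>)"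
    using \<rho> pi_less_4 by (intro mult_left_mono divide_right_mono) auto
  finally show ?thesis by simp
qed

context levy
begin

text \<open>Fubini, shared by the one- and two-dimensional kernels. The phase
  \<open>\<theta>\<close> encodes the centre of the bump and disappears in modulus, which makes the
  later bounds uniform in the centre.\<close>

lemma norm_expectation_phase_le:
  assumes t: "t \<ge> 0" and N: "prob_space N"
    and [measurable]: "w \<in> borel_measurable N" "\<theta> \<in> borel_measurable N"
  shows "norm (CLINT \<omega>|M. CLINT s|N. iexp (w s \<bullet> X t \<omega> - \<theta> s)) \<le> (LINT s|N. norm (cf t (w s)))"
proof -
  interpret N: prob_space N by (rule N)
  interpret P: pair_prob_space M N ..
  have [measurable]: "X t \<in> borel_measurable M" using t by (rule X_measurable)
  have "integrable (M \<Otimes>\<^sub>M N) (\<lambda>(\<omega>, s). iexp (w s \<bullet> X t \<omega> - \<theta> s))"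
    by (rule P.P.integrable_const_bound[where B = 1]) (auto simp: case_prod_beta)
  then have "(CLINT \<omega>|M. CLINT s|N. iexp (w s \<bullet> X t \<omega> - \<theta> s)) = (CLINT s|N. CLINT \<omega>|M. iexp (w s \<bullet> X t \<omega> - \<theta> s))"
    by (rule P.Fubini_integral[symmetric])
  also have "\<dots> = (CLINT s|N. iexp (- \<theta> s) * cf t (w s))"
    unfolding cf_def integral_mult_right_zero[symmetric] mult_exp_exp
    by (simp add: algebra_simps)
  finally have "norm (CLINT \<omega>|M. CLINT s|N. iexp (w s \<bullet> X t \<omega> - \<theta> s))
      \<le> (LINT s|N. norm (iexp (- \<theta> s) * cf t (w s)))" by (simp only: integral_norm_bound)
  also have "\<dots> = (LINT s|N. norm (cf t (w s)))"
    by (simp only: norm_mult norm_exp_i_times mult_1)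
  finally show ?thesis .
qed

lemma gauss_expectation_le:
  assumes t: "t \<ge> 0" and \<epsilon>: "\<epsilon> > 0"
  shows "expectation (\<lambda>\<omega>. exp (- ((u \<bullet> X t \<omega> - y) / \<epsilon>)\<^sup>2 / 2))
    \<le> (LINT s|std_normal_distribution. norm (cf t ((s / \<epsilon>) *\<^sub>R u)))"
proof -
  have "complex_of_real (expectation (\<lambda>\<omega>. exp (- ((u \<bullet> X t \<omega> - y) / \<epsilon>)\<^sup>2 / 2)))
      = (CLINT \<omega>|M. CLINT s|std_normal_distribution. iexp (((s / \<epsilon>) *\<^sub>R u) \<bullet> X t \<omega> - s * y / \<epsilon>))"
    unfolding integral_complex_of_real[symmetric] gauss_kernel
    by (simp add: diff_divide_distrib right_diff_distrib ac_simps)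
  from arg_cong[OF this, of norm]
  have "\<bar>expectation (\<lambda>\<omega>. exp (- ((u \<bullet> X t \<omega> - y) / \<epsilon>)\<^sup>2 / 2))\<bar>
      = norm (CLINT \<omega>|M. CLINT s|std_normal_distribution. iexp (((s / \<epsilon>) *\<^sub>R u) \<bullet> X t \<omega> - s * y / \<epsilon>))"
    by (simp only: norm_of_real)
  also have "\<dots> \<le> (LINT s|std_normal_distribution. norm (cf t ((s / \<epsilon>) *\<^sub>R u)))"
    by (rule norm_expectation_phase_le[OF t gauss.prob_space_axioms]) measurable
  finally show ?thesis by simp
qed

lemma gauss_expectation_pair_le:
  assumes t: "t \<ge> 0" and \<epsilon>: "\<epsilon> > 0"
  shows "expectation (\<lambda>\<omega>. exp (- ((u1 \<bullet> X t \<omega>) / \<epsilon>)\<^sup>2 / 2) * exp (- ((u2 \<bullet> X t \<omega>) / \<epsilon>)\<^sup>2 / 2))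
    \<le> (LINT p|(std_normal_distribution \<Otimes>\<^sub>M std_normal_distribution).
        norm (cf t ((fst p / \<epsilon>) *\<^sub>R u1 + (snd p / \<epsilon>) *\<^sub>R u2)))"
proof -
  interpret P: pair_prob_space std_normal_distribution std_normal_distribution ..
  let ?N = "std_normal_distribution \<Otimes>\<^sub>M std_normal_distribution"
  have k: "complex_of_real (exp (- x\<^sup>2 / 2) * exp (- y\<^sup>2 / 2)) = (CLINT p|?N. iexp (x * fst p + y * snd p))" for x y
  proof -
    have "(CLINT p|?N. iexp (x * fst p + y * snd p))
        = (CLINT s|std_normal_distribution. CLINT r|std_normal_distribution. iexp (x * s + y * r))"
      by (subst P.integral_fst'[symmetric]) (auto intro!: P.P.integrable_const_bound[where B = 1])
    also have "\<dots> = (CLINT s|std_normal_distribution. CLINT r|std_normal_distribution. iexp (x * s) * iexp (y * r))"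
      by (simp only: mult_exp_exp of_real_add distrib_left)
    also have "\<dots> = complex_of_real (exp (- x\<^sup>2 / 2)) * complex_of_real (exp (- y\<^sup>2 / 2))"
      unfolding gauss_kernel by simp
    finally show ?thesis by simp
  qed
  have "complex_of_real (expectation (\<lambda>\<omega>. exp (- ((u1 \<bullet> X t \<omega>) / \<epsilon>)\<^sup>2 / 2) * exp (- ((u2 \<bullet> X t \<omega>) / \<epsilon>)\<^sup>2 / 2)))
      = (CLINT \<omega>|M. CLINT p|?N. iexp (((fst p / \<epsilon>) *\<^sub>R u1 + (snd p / \<epsilon>) *\<^sub>R u2) \<bullet> X t \<omega> - 0))"
    unfolding integral_complex_of_real[symmetric] k
    by (simp add: inner_add_left ac_simps)
  from arg_cong[OF this, of norm]
  have "\<bar>expectation (\<lambda>\<omega>. exp (- ((u1 \<bullet> X t \<omega>) / \<epsilon>)\<^sup>2 / 2) * exp (- ((u2 \<bullet> X t \<omega>) / \<epsilon>)\<^sup>2 / 2))\<bar>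
      = norm (CLINT \<omega>|M. CLINT p|?N. iexp (((fst p / \<epsilon>) *\<^sub>R u1 + (snd p / \<epsilon>) *\<^sub>R u2) \<bullet> X t \<omega> - 0))"
    by (simp only: norm_of_real)
  also have "\<dots> \<le> (LINT p|?N. norm (cf t ((fst p / \<epsilon>) *\<^sub>R u1 + (snd p / \<epsilon>) *\<^sub>R u2)))"
    by (rule norm_expectation_phase_le[OF t P.P.prob_space_axioms]) measurable
  finally show ?thesis by simp
qed

end

lemma powr_minus_cancel: "x > 0 \<Longrightarrow> x powr (-b) * s * (x powr b * z) = s * (z::real)"
  by (simp add: powr_minus field_simps)

lemma one_plus_square_le:
  assumes "\<bar>s\<bar> \<le> D * N" "D \<ge> 1" "N \<ge> (0::real)"
  shows "1 + s\<^sup>2 \<le> D\<^sup>2 * (1 + N)\<^sup>2"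
proof -
  have "1 + s\<^sup>2 \<le> (1 + \<bar>s\<bar>)\<^sup>2" by (simp add: power2_sum)
  also have "\<dots> \<le> (D * (1 + N))\<^sup>2" using assms by (intro power_mono) (auto simp: distrib_left)
  finally show ?thesis by (simp add: power_mult_distrib)
qed

lemma exp_half_indicator:
  assumes "\<bar>x\<bar> \<le> \<epsilon>" "0 < \<epsilon>" shows "exp (- (x / \<epsilon>)\<^sup>2 / 2) \<ge> exp (- 1 / 2 :: real)"
proof -
  have "(x / \<epsilon>)\<^sup>2 \<le> 1" using assms by (subst abs_square_le_1) (simp add: abs_divide)
  then show ?thesis by simp
qed

section \<open>Small balls along left eigenvectors\<close>

context contracting_semistable
begin

text \<open>Scaling moves only along powers of \<open>c\<close>, so \<open>t\<close> is brought into
  the interval from 1 to \<open>c\<close>; the factor \<open>c\<close> lost in this way goes into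
  the constants.\<close>

lemma ex_scaling_index:
  assumes t: "0 < t" "t \<le> 1"
  obtains k where "1 \<le> c ^ k * t" "c ^ k * t \<le> c"
proof -
  have ex: "\<exists>n. 1 \<le> c ^ n * t"
  proof -
    obtain n where "1 / t < c ^ n" using real_arch_pow[OF c] by blast
    then show ?thesis using t by (intro exI[of _ n]) (simp add: field_simps)
  qed
  define k where "k = (LEAST n. 1 \<le> c ^ n * t)"
  have k: "1 \<le> c ^ k * t" unfolding k_def using ex by (rule LeastI_ex)
  have "c ^ k * t \<le> c"
  proof (cases k)
    case (Suc j)
    then have "\<not> 1 \<le> c ^ j * t" using not_less_Least[of j "\<lambda>n. 1 \<le> c ^ n * t"] unfolding k_def by simp
    then have "c * (c ^ j * t) \<le> c * 1" using c by (intro mult_left_mono) auto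
    then show ?thesis by (simp add: Suc mult.assoc)
  qed (use t c in simp)
  with k that show ?thesis by blast
qed

lemma flow_eigen_power:
  assumes "\<And>y. u \<bullet> E y = b * (u \<bullet> y)"
  shows "u \<bullet> flow E (real k * ln c) x = (c ^ k) powr b * (u \<bullet> x)"
  using c by (simp add: inner_flow_eigen[OF lin assms] powr_def ln_realpow ac_simps)

lemma rescaled_square_le:
  assumes t: "0 < t" "t \<le> 1" and k: "1 \<le> c ^ k * t" "c ^ k * t \<le> c" and b: "b \<ge> 0"
  shows "((t / c) powr b * s)\<^sup>2 \<le> ((c ^ k) powr (-b) * s)\<^sup>2"
proof -
  have "(t / c) powr b \<le> (1 / c ^ k) powr b"
    using t k c b by (intro powr_mono2) (auto simp: field_simps)
  also have "\<dots> = (c ^ k) powr (-b)" using c by (simp add: powr_minus powr_divide inverse_eq_divide)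
  finally have "\<bar>(t / c) powr b * s\<bar> \<le> \<bar>(c ^ k) powr (-b) * s\<bar>"
    by (simp add: abs_mult mult_right_mono)
  then show ?thesis by (simp only: abs_le_square_iff)
qed

text \<open>Scaling multiplies each coefficient by a scalar and moves time to at least 1, where
  monotonicity replaces it by 1. The dual vectors bound each rescaled coefficient by a multiple of
  \<open>norm w\<close>, which splits the fourth power of \<open>cf_decay\<close> into two
  squares.\<close>

lemma cf_pair_decay:
  assumes e1: "\<And>y. u1 \<bullet> E y = b1 * (u1 \<bullet> y)" and e2: "\<And>y. u2 \<bullet> E y = b2 * (u2 \<bullet> y)"
    and b: "b1 \<ge> 0" "b2 \<ge> 0"
    and dual: "u1 \<bullet> x1 = 1" "u1 \<bullet> x2 = 0" "u2 \<bullet> x1 = 0" "u2 \<bullet> x2 = 1"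
  obtains K where "K > 0" "\<And>t s1 s2. 0 < t \<Longrightarrow> t \<le> 1 \<Longrightarrow> norm (cf t (s1 *\<^sub>R u1 + s2 *\<^sub>R u2))
    \<le> K * inverse (1 + ((t / c) powr b1 * s1)\<^sup>2) * inverse (1 + ((t / c) powr b2 * s2)\<^sup>2)"
proof -
  obtain K where K: "K > 0" "\<And>v. norm (cf 1 v) \<le> K / (1 + norm v) ^ 4" using cf_decay by blast
  define D where "D = 1 + norm x1 + norm x2"
  have D: "D \<ge> 1" by (simp add: D_def)
  have "norm (cf t (s1 *\<^sub>R u1 + s2 *\<^sub>R u2))
    \<le> (K * D ^ 4) * inverse (1 + ((t / c) powr b1 * s1)\<^sup>2) * inverse (1 + ((t / c) powr b2 * s2)\<^sup>2)"
    if t: "0 < t" "t \<le> 1" for t s1 s2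
  proof -
    obtain k where k: "1 \<le> c ^ k * t" "c ^ k * t \<le> c" using ex_scaling_index[OF t] .
    define \<sigma>1 where "\<sigma>1 = (c ^ k) powr (-b1) * s1"
    define \<sigma>2 where "\<sigma>2 = (c ^ k) powr (-b2) * s2"
    define w where "w = \<sigma>1 *\<^sub>R u1 + \<sigma>2 *\<^sub>R u2"
    have "cf (c ^ k * t) w = cf t (s1 *\<^sub>R u1 + s2 *\<^sub>R u2)"
      using t c by (intro cf_scaling)
        (auto simp: w_def \<sigma>1_def \<sigma>2_def inner_add_left flow_eigen_power[OF e1] flow_eigen_power[OF e2] powr_minus_cancel)
    then have "norm (cf t (s1 *\<^sub>R u1 + s2 *\<^sub>R u2)) \<le> norm (cf 1 w)"
      using norm_cf_antimono[of 1 "c ^ k * t" w] k by simp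
    also have "\<dots> \<le> K / (1 + norm w) ^ 4" by (rule K)
    also have "\<dots> \<le> K / (((1 + \<sigma>1\<^sup>2) * (1 + \<sigma>2\<^sup>2)) / D ^ 4)"
    proof (rule divide_left_mono)
      have n: "norm w \<ge> 0" by simp
      have "\<sigma>1 = w \<bullet> x1" using dual by (simp add: w_def inner_add_left)
      then have "\<bar>\<sigma>1\<bar> \<le> norm w * norm x1" by (simp add: Cauchy_Schwarz_ineq2)
      also have "\<dots> \<le> D * norm w" by (simp add: D_def distrib_left distrib_right mult.commute)
      finally have 1: "1 + \<sigma>1\<^sup>2 \<le> D\<^sup>2 * (1 + norm w)\<^sup>2" by (rule one_plus_square_le[OF _ D n])
      have "\<sigma>2 = w \<bullet> x2" using dual by (simp add: w_def inner_add_left)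
      then have "\<bar>\<sigma>2\<bar> \<le> norm w * norm x2" by (simp add: Cauchy_Schwarz_ineq2)
      also have "\<dots> \<le> D * norm w" by (simp add: D_def distrib_left distrib_right mult.commute)
      finally have 2: "1 + \<sigma>2\<^sup>2 \<le> D\<^sup>2 * (1 + norm w)\<^sup>2" by (rule one_plus_square_le[OF _ D n])
      have "(1 + \<sigma>1\<^sup>2) * (1 + \<sigma>2\<^sup>2) \<le> (D\<^sup>2 * (1 + norm w)\<^sup>2) * (D\<^sup>2 * (1 + norm w)\<^sup>2)"
        using 1 2 by (intro mult_mono) (auto intro: add_nonneg_nonneg)
      also have "\<dots> = D ^ 4 * (1 + norm w) ^ 4"
        by (simp add: power2_eq_square power4_eq_xxxx ac_simps)
      finally show "((1 + \<sigma>1\<^sup>2) * (1 + \<sigma>2\<^sup>2)) / D ^ 4 \<le> (1 + norm w) ^ 4"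
        using D by (simp add: pos_divide_le_eq mult.commute)
      show "0 < (1 + norm w) ^ 4 * (((1 + \<sigma>1\<^sup>2) * (1 + \<sigma>2\<^sup>2)) / D ^ 4)"
        using D by (intro mult_pos_pos divide_pos_pos zero_less_power) (auto intro: add_pos_nonneg)
    qed (use K in simp)
    also have "\<dots> = (K * D ^ 4) * inverse (1 + \<sigma>1\<^sup>2) * inverse (1 + \<sigma>2\<^sup>2)"
      by (simp add: divide_inverse ac_simps)
    also have "\<dots> \<le> (K * D ^ 4) * inverse (1 + ((t / c) powr b1 * s1)\<^sup>2) * inverse (1 + ((t / c) powr b2 * s2)\<^sup>2)"
      using rescaled_square_le[OF t k b(1), of s1] rescaled_square_le[OF t k b(2), of s2] K D
      unfolding \<sigma>1_def \<sigma>2_def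
      by (intro mult_mono le_imp_inverse_le) (auto intro: add_pos_nonneg)
    finally show ?thesis .
  qed
  then show ?thesis using K D by (intro that[of "K * D ^ 4"]) auto
qed

text \<open>Covers all \<open>t > 0\<close> because the occupation estimate integrates over
  unbounded time; beyond time 1 the bound is carried on by monotonicity.\<close>

lemma cf_line_decay:
  assumes e: "\<And>y. u \<bullet> E y = b * (u \<bullet> y)" and b: "b \<ge> 0" and dual: "u \<bullet> x = 1"
  obtains K where "K > 0" "\<And>t s. 0 < t \<Longrightarrow>
    norm (cf t (s *\<^sub>R u)) \<le> K * inverse (1 + ((min t 1 / c) powr b * s)\<^sup>2)"
proof -
  obtain K where K: "K > 0" "\<And>v. norm (cf 1 v) \<le> K / (1 + norm v) ^ 4" using cf_decay by blast
  define D where "D = 1 + norm x"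
  have D: "D \<ge> 1" by (simp add: D_def)
  have "norm (cf t' (s *\<^sub>R u)) \<le> (K * D\<^sup>2) * inverse (1 + ((min t' 1 / c) powr b * s)\<^sup>2)"
    if t': "0 < t'" for t' s
  proof -
    define t where "t = min t' 1"
    have t: "0 < t" "t \<le> 1" "t \<le> t'" using t' by (auto simp: t_def)
    obtain k where k: "1 \<le> c ^ k * t" "c ^ k * t \<le> c" using ex_scaling_index[OF t(1,2)] .
    define \<sigma> where "\<sigma> = (c ^ k) powr (-b) * s"
    define w where "w = \<sigma> *\<^sub>R u"
    have "cf (c ^ k * t) w = cf t (s *\<^sub>R u)"
      using t c by (intro cf_scaling) (auto simp: w_def \<sigma>_def flow_eigen_power[OF e] powr_minus_cancel)
    moreover have "norm (cf t' (s *\<^sub>R u)) \<le> norm (cf t (s *\<^sub>R u))"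
      using t by (intro norm_cf_antimono) auto
    ultimately have "norm (cf t' (s *\<^sub>R u)) \<le> norm (cf 1 w)"
      using norm_cf_antimono[of 1 "c ^ k * t" w] k by simp
    also have "\<dots> \<le> K / (1 + norm w) ^ 4" by (rule K)
    also have "\<dots> \<le> K / ((1 + \<sigma>\<^sup>2) / D\<^sup>2)"
    proof (rule divide_left_mono)
      have n: "norm w \<ge> 0" by simp
      have "\<sigma> = w \<bullet> x" using dual by (simp add: w_def)
      then have "\<bar>\<sigma>\<bar> \<le> norm w * norm x" by (simp add: Cauchy_Schwarz_ineq2)
      also have "\<dots> \<le> D * norm w" by (simp add: D_def distrib_left distrib_right mult.commute)
      finally have "1 + \<sigma>\<^sup>2 \<le> D\<^sup>2 * (1 + norm w)\<^sup>2" by (rule one_plus_square_le[OF _ D n])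
      also have "\<dots> \<le> D\<^sup>2 * (1 + norm w) ^ 4" by (intro mult_left_mono power_increasing) auto
      finally show "(1 + \<sigma>\<^sup>2) / D\<^sup>2 \<le> (1 + norm w) ^ 4"
        using D by (simp add: pos_divide_le_eq mult.commute)
      show "0 < (1 + norm w) ^ 4 * ((1 + \<sigma>\<^sup>2) / D\<^sup>2)"
        using D by (intro mult_pos_pos divide_pos_pos zero_less_power) (auto intro: add_pos_nonneg)
    qed (use K in simp)
    also have "\<dots> = (K * D\<^sup>2) * inverse (1 + \<sigma>\<^sup>2)"
      by (simp add: divide_inverse ac_simps)
    also have "\<dots> \<le> (K * D\<^sup>2) * inverse (1 + ((t / c) powr b * s)\<^sup>2)"
      using rescaled_square_le[OF t(1,2) k b, of s] K D
      unfolding \<sigma>_def by (intro mult_mono le_imp_inverse_le) (auto intro: add_pos_nonneg)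
    finally show ?thesis by (simp add: t_def)
  qed
  then show ?thesis using K D by (intro that[of "K * D\<^sup>2"]) auto
qed

text \<open>Uniformity in the centre \<open>y\<close> matters: in
  \<open>small_ball_large_norm\<close> the centre is determined by the other increment.\<close>

lemma gauss_small_ball:
  assumes e: "\<And>y. u \<bullet> E y = b * (u \<bullet> y)" and b: "b \<ge> 0" and dual: "u \<bullet> x = 1"
  obtains K where "K > 0" "\<And>t \<epsilon> y. 0 < t \<Longrightarrow> 0 < \<epsilon> \<Longrightarrow>
    expectation (\<lambda>\<omega>. exp (- ((u \<bullet> X t \<omega> - y) / \<epsilon>)\<^sup>2 / 2)) \<le> K * \<epsilon> * (min t 1) powr (-b)"
proof -
  obtain K where K: "K > 0" "\<And>t s. 0 < t \<Longrightarrow>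
    norm (cf t (s *\<^sub>R u)) \<le> K * inverse (1 + ((min t 1 / c) powr b * s)\<^sup>2)"
    using cf_line_decay[OF e b dual] by blast
  have "expectation (\<lambda>\<omega>. exp (- ((u \<bullet> X t \<omega> - y) / \<epsilon>)\<^sup>2 / 2)) \<le> (K * 2 * c powr b) * \<epsilon> * (min t 1) powr (-b)"
    if t: "0 < t" and \<epsilon>: "0 < \<epsilon>" for t \<epsilon> y
  proof -
    have [measurable]: "(\<lambda>u. cf t u) \<in> borel_measurable borel" using t by (intro cf_measurable) simp
    define \<rho> where "\<rho> = (min t 1 / c) powr b / \<epsilon>"
    have \<rho>: "\<rho> > 0" using t \<epsilon> c by (simp add: \<rho>_def)
    have "expectation (\<lambda>\<omega>. exp (- ((u \<bullet> X t \<omega> - y) / \<epsilon>)\<^sup>2 / 2))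
      \<le> (LINT s|std_normal_distribution. norm (cf t ((s / \<epsilon>) *\<^sub>R u)))"
      using t \<epsilon> by (intro gauss_expectation_le) auto
    also have "\<dots> \<le> (LINT s|std_normal_distribution. K * inverse (1 + (\<rho> * s)\<^sup>2))"
    proof (rule integral_mono)
      show "integrable std_normal_distribution (\<lambda>s. norm (cf t ((s / \<epsilon>) *\<^sub>R u)))"
        by (rule gauss.integrable_const_bound[where B = 1]) (auto simp: norm_cf_le_1)
      show "integrable std_normal_distribution (\<lambda>s. K * inverse (1 + (\<rho> * s)\<^sup>2))"
        by (intro integrable_mult_right gauss.integrable_const_bound[where B = 1])
           (auto simp: inverse_le_1_iff)
      show "norm (cf t ((s / \<epsilon>) *\<^sub>R u)) \<le> K * inverse (1 + (\<rho> * s)\<^sup>2)" for s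
        using K(2)[OF t, of "s / \<epsilon>"] by (simp add: \<rho>_def)
    qed
    also have "\<dots> = K * (LINT s|std_normal_distribution. inverse (1 + (\<rho> * s)\<^sup>2))" by simp
    also have "\<dots> \<le> K * (2 / \<rho>)"
      using K(1) by (intro mult_left_mono gauss_cauchy_integral[OF \<rho>]) auto
    also have "\<rho> = (min t 1) powr b / c powr b / \<epsilon>"
      by (simp only: \<rho>_def powr_divide)
    also have "K * (2 / \<dots>) = (K * 2 * c powr b) * \<epsilon> * (min t 1) powr (-b)"
      by (simp add: powr_minus divide_inverse ac_simps)
    finally show ?thesis .
  qed
  then show ?thesis using K c by (intro that[of "K * 2 * c powr b"]) auto
qed

lemma small_ball:
  assumes e: "\<And>y. u \<bullet> E y = b * (u \<bullet> y)" and b: "b \<ge> 0" and dual: "u \<bullet> x = 1"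
  obtains K where "K > 0" "\<And>t \<epsilon> y. 0 < t \<Longrightarrow> 0 < \<epsilon> \<Longrightarrow>
    prob {\<omega> \<in> space M. \<bar>u \<bullet> X t \<omega> - y\<bar> \<le> \<epsilon>} \<le> K * \<epsilon> * (min t 1) powr (-b)"
proof -
  obtain K where K: "K > 0" "\<And>t \<epsilon> y. 0 < t \<Longrightarrow> 0 < \<epsilon> \<Longrightarrow>
    expectation (\<lambda>\<omega>. exp (- ((u \<bullet> X t \<omega> - y) / \<epsilon>)\<^sup>2 / 2)) \<le> K * \<epsilon> * (min t 1) powr (-b)"
    using gauss_small_ball[OF e b dual] by blast
  have "prob {\<omega> \<in> space M. \<bar>u \<bullet> X t \<omega> - y\<bar> \<le> \<epsilon>} \<le> (exp (1 / 2) * K) * \<epsilon> * (min t 1) powr (-b)"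
    if t: "0 < t" and \<epsilon>: "0 < \<epsilon>" for t \<epsilon> y
  proof -
    have [measurable]: "X t \<in> borel_measurable M" using t by (intro X_measurable) simp
    let ?A = "{\<omega> \<in> space M. \<bar>u \<bullet> X t \<omega> - y\<bar> \<le> \<epsilon>}"
    have "exp (- 1 / 2) * prob ?A = expectation (\<lambda>\<omega>. exp (- 1 / 2) * indicator ?A \<omega>)" by simp
    also have "\<dots> \<le> expectation (\<lambda>\<omega>. exp (- ((u \<bullet> X t \<omega> - y) / \<epsilon>)\<^sup>2 / 2))"
    proof (rule integral_mono)
      show "integrable M (\<lambda>\<omega>. exp (- ((u \<bullet> X t \<omega> - y) / \<epsilon>)\<^sup>2 / 2))"
        by (rule integrable_const_bound[where B = 1]) auto
      show "exp (- 1 / 2) * indicator ?A \<omega> \<le> exp (- ((u \<bullet> X t \<omega> - y) / \<epsilon>)\<^sup>2 / 2)" for \<omega>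
        using exp_half_indicator[OF _ \<epsilon>, of "u \<bullet> X t \<omega> - y"] by (auto simp: indicator_def)
    qed (intro integrable_mult_right integrable_const_bound[where B = 1], auto split: split_indicator)
    also have "\<dots> \<le> K * \<epsilon> * (min t 1) powr (-b)" by (rule K(2)[OF t \<epsilon>])
    finally show ?thesis by (simp add: exp_minus field_simps)
  qed
  then show ?thesis using K by (intro that[of "exp (1 / 2) * K"]) auto
qed

text \<open>For a product of two Gaussian bumps the frequency integral factorises, and each
  functional contributes its own factor \<open>\<epsilon> * t powr (- b)\<close>.\<close>

lemma small_ball_pair:
  assumes e1: "\<And>y. u1 \<bullet> E y = b1 * (u1 \<bullet> y)" and e2: "\<And>y. u2 \<bullet> E y = b2 * (u2 \<bullet> y)"
    and b: "b1 \<ge> 0" "b2 \<ge> 0"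
    and dual: "u1 \<bullet> x1 = 1" "u1 \<bullet> x2 = 0" "u2 \<bullet> x1 = 0" "u2 \<bullet> x2 = 1"
  obtains K where "K > 0" "\<And>t \<epsilon>. 0 < t \<Longrightarrow> t \<le> 1 \<Longrightarrow> 0 < \<epsilon> \<Longrightarrow>
    prob {\<omega> \<in> space M. \<bar>u1 \<bullet> X t \<omega>\<bar> \<le> \<epsilon> \<and> \<bar>u2 \<bullet> X t \<omega>\<bar> \<le> \<epsilon>} \<le> K * \<epsilon>\<^sup>2 * t powr (- (b1 + b2))"
proof -
  interpret P: pair_prob_space std_normal_distribution std_normal_distribution ..
  let ?N = "std_normal_distribution \<Otimes>\<^sub>M std_normal_distribution"
  obtain K where K: "K > 0" "\<And>t s1 s2. 0 < t \<Longrightarrow> t \<le> 1 \<Longrightarrow> norm (cf t (s1 *\<^sub>R u1 + s2 *\<^sub>R u2))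
    \<le> K * inverse (1 + ((t / c) powr b1 * s1)\<^sup>2) * inverse (1 + ((t / c) powr b2 * s2)\<^sup>2)"
    using cf_pair_decay[OF e1 e2 b dual] by blast
  define K' where "K' = exp (1 / 2) * exp (1 / 2) * (K * 4 * c powr (b1 + b2))"
  have "prob {\<omega> \<in> space M. \<bar>u1 \<bullet> X t \<omega>\<bar> \<le> \<epsilon> \<and> \<bar>u2 \<bullet> X t \<omega>\<bar> \<le> \<epsilon>} \<le> K' * \<epsilon>\<^sup>2 * t powr (- (b1 + b2))"
    if t: "0 < t" "t \<le> 1" and \<epsilon>: "0 < \<epsilon>" for t \<epsilon>
  proof -
    have [measurable]: "X t \<in> borel_measurable M" using t by (intro X_measurable) simp
    have [measurable]: "(\<lambda>u. cf t u) \<in> borel_measurable borel" using t by (intro cf_measurable) simp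
    define \<rho>1 where "\<rho>1 = (t / c) powr b1 / \<epsilon>"
    define \<rho>2 where "\<rho>2 = (t / c) powr b2 / \<epsilon>"
    have \<rho>: "\<rho>1 > 0" "\<rho>2 > 0" using t \<epsilon> c by (simp_all add: \<rho>1_def \<rho>2_def)
    have int: "integrable ?N (\<lambda>p. inverse (1 + (\<rho>1 * fst p)\<^sup>2) * inverse (1 + (\<rho>2 * snd p)\<^sup>2))"
    proof (rule P.P.integrable_const_bound[where B = 1], rule AE_I2)
      fix p :: "real \<times> real"
      have "inverse (1 + (\<rho>1 * fst p)\<^sup>2) * inverse (1 + (\<rho>2 * snd p)\<^sup>2) \<le> 1"
        by (intro mult_le_one) (auto simp: inverse_le_1_iff)
      then show "norm (inverse (1 + (\<rho>1 * fst p)\<^sup>2) * inverse (1 + (\<rho>2 * snd p)\<^sup>2)) \<le> 1" by simp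
    qed measurable
    let ?A = "{\<omega> \<in> space M. \<bar>u1 \<bullet> X t \<omega>\<bar> \<le> \<epsilon> \<and> \<bar>u2 \<bullet> X t \<omega>\<bar> \<le> \<epsilon>}"
    let ?g = "\<lambda>\<omega>. exp (- ((u1 \<bullet> X t \<omega>) / \<epsilon>)\<^sup>2 / 2) * exp (- ((u2 \<bullet> X t \<omega>) / \<epsilon>)\<^sup>2 / 2)"
    have "exp (- 1 / 2) * exp (- 1 / 2) * prob ?A
        = expectation (\<lambda>\<omega>. exp (- 1 / 2) * exp (- 1 / 2) * indicator ?A \<omega>)" by simp
    also have "\<dots> \<le> expectation ?g"
    proof (rule integral_mono)
      show "integrable M ?g"
        by (rule integrable_const_bound[where B = 1]) (auto intro!: mult_le_one)
      show "exp (- 1 / 2) * exp (- 1 / 2) * indicator ?A \<omega> \<le> ?g \<omega>" for \<omega>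
      proof (cases "\<omega> \<in> ?A")
        case True
        then have "exp (- 1 / 2) * exp (- 1 / 2) \<le> ?g \<omega>"
          using \<epsilon> by (intro mult_mono exp_half_indicator) auto
        then show ?thesis using True by simp
      qed simp
    qed (intro integrable_mult_right integrable_const_bound[where B = 1], auto split: split_indicator)
    also have "\<dots> \<le> (LINT p|?N. norm (cf t ((fst p / \<epsilon>) *\<^sub>R u1 + (snd p / \<epsilon>) *\<^sub>R u2)))"
      using t \<epsilon> by (intro gauss_expectation_pair_le) auto
    also have "\<dots> \<le> (LINT p|?N. K * (inverse (1 + (\<rho>1 * fst p)\<^sup>2) * inverse (1 + (\<rho>2 * snd p)\<^sup>2)))"
    proof (rule integral_mono)
      show "integrable ?N (\<lambda>p. norm (cf t ((fst p / \<epsilon>) *\<^sub>R u1 + (snd p / \<epsilon>) *\<^sub>R u2)))"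
        by (rule P.P.integrable_const_bound[where B = 1]) (auto simp: norm_cf_le_1)
      show "integrable ?N (\<lambda>p. K * (inverse (1 + (\<rho>1 * fst p)\<^sup>2) * inverse (1 + (\<rho>2 * snd p)\<^sup>2)))"
        by (intro integrable_mult_right int)
      show "norm (cf t ((fst p / \<epsilon>) *\<^sub>R u1 + (snd p / \<epsilon>) *\<^sub>R u2))
          \<le> K * (inverse (1 + (\<rho>1 * fst p)\<^sup>2) * inverse (1 + (\<rho>2 * snd p)\<^sup>2))" for p
        using K(2)[OF t, of "fst p / \<epsilon>" "snd p / \<epsilon>"] by (simp add: \<rho>1_def \<rho>2_def mult.assoc)
    qed
    also have "\<dots> = K * (LINT p|?N. inverse (1 + (\<rho>1 * fst p)\<^sup>2) * inverse (1 + (\<rho>2 * snd p)\<^sup>2))" by simp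
    also have "(LINT p|?N. inverse (1 + (\<rho>1 * fst p)\<^sup>2) * inverse (1 + (\<rho>2 * snd p)\<^sup>2))
        = (LINT s|std_normal_distribution. inverse (1 + (\<rho>1 * s)\<^sup>2)) * (LINT s|std_normal_distribution. inverse (1 + (\<rho>2 * s)\<^sup>2))"
      by (subst P.integral_fst'[OF int, symmetric]) simp
    also have "K * \<dots> \<le> K * ((2 / \<rho>1) * (2 / \<rho>2))"
      using \<rho> K(1) by (intro mult_left_mono mult_mono gauss_cauchy_integral) auto
    also have "\<dots> = K * ((2 / (t powr b1 / c powr b1 / \<epsilon>)) * (2 / (t powr b2 / c powr b2 / \<epsilon>)))"
      unfolding \<rho>1_def \<rho>2_def powr_divide ..
    also have "\<dots> = (K * 4 * c powr (b1 + b2)) * \<epsilon>\<^sup>2 * t powr (- (b1 + b2))"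
      unfolding powr_add powr_minus power2_eq_square by (simp add: divide_inverse ac_simps)
    finally have "exp (- 1 / 2) * exp (- 1 / 2) * prob ?A
      \<le> (K * 4 * c powr (b1 + b2)) * \<epsilon>\<^sup>2 * t powr (- (b1 + b2))" .
    then have "(exp (1 / 2) * exp (1 / 2)) * (exp (- 1 / 2) * exp (- 1 / 2) * prob ?A)
      \<le> (exp (1 / 2) * exp (1 / 2)) * ((K * 4 * c powr (b1 + b2)) * \<epsilon>\<^sup>2 * t powr (- (b1 + b2)))"
      by (intro mult_left_mono) auto
    moreover have "(exp (1 / 2) * exp (1 / 2)) * (exp (- 1 / 2) * exp (- 1 / 2) * q) = q" for q :: real
      by (simp add: mult.assoc[symmetric] exp_add[symmetric])
    ultimately show ?thesis by (simp only: K'_def mult.assoc)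
  qed
  moreover have "K' > 0" using K c by (simp add: K'_def)
  ultimately show ?thesis using that by blast
qed

end

section \<open>Lower bounds for occupation times\<close>

lemma integrable_indicator_Icc_bounded:
  fixes f :: "real \<Rightarrow> real"
  assumes [measurable]: "f \<in> borel_measurable borel" and f: "\<And>t. 0 \<le> f t" "\<And>t. f t \<le> 1"
  shows "integrable lborel (\<lambda>t. indicator {a..b} t *\<^sub>R f t)"
proof (rule Bochner_Integration.integrable_bound)
  show "integrable lborel (indicator {a..b} :: real \<Rightarrow> real)"
    by (rule integrable_real_indicator) (auto simp: emeasure_lborel_Icc_eq)
qed (use f in \<open>auto split: split_indicator\<close>)

lemma indicator_times_eq: "(\<lambda>t. indicator S t * f t) = (\<lambda>t. if t \<in> S then f t else 0 :: real)"
  by (simp add: fun_eq_iff indicator_def)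

lemma has_bochner_integral_powr_0:
  assumes "\<beta> < 1" "\<tau> \<ge> (0::real)"
  shows "has_bochner_integral lborel (\<lambda>t. indicator {0..\<tau>} t * t powr (-\<beta>)) (\<tau> powr (1 - \<beta>) / (1 - \<beta>))"
proof (rule has_bochner_integral_nn_integral)
  have "((\<lambda>t. t powr (-\<beta>)) has_integral \<tau> powr (-\<beta> + 1) / (-\<beta> + 1)) {0..\<tau>}"
    using assms by (intro has_integral_powr_from_0) auto
  then have "((\<lambda>t. indicator {0..\<tau>} t * t powr (-\<beta>)) has_integral \<tau> powr (1 - \<beta>) / (1 - \<beta>)) UNIV"
    unfolding indicator_times_eq has_integral_restrict_UNIV by simp
  then show "(\<integral>\<^sup>+ t. ennreal (indicator {0..\<tau>} t * t powr (-\<beta>)) \<partial>lborel) = ennreal (\<tau> powr (1 - \<beta>) / (1 - \<beta>))"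
    by (intro nn_integral_has_integral_lborel) auto
qed (use assms in auto)

lemma has_bochner_integral_powr_inf:
  assumes "\<beta> > 1" "\<tau> > (0::real)"
  shows "has_bochner_integral lborel (\<lambda>t. indicator {\<tau>..} t * t powr (-\<beta>)) (\<tau> powr (1 - \<beta>) / (\<beta> - 1))"
proof (rule has_bochner_integral_nn_integral)
  have "((\<lambda>t. t powr (-\<beta>)) has_integral - (\<tau> powr (-\<beta> + 1)) / (-\<beta> + 1)) {\<tau>..}"
    using assms by (intro has_integral_powr_to_inf) auto
  also have "- (\<tau> powr (-\<beta> + 1)) / (-\<beta> + 1) = \<tau> powr (1 - \<beta>) / (\<beta> - 1)"
    using assms by (simp add: divide_simps) (simp add: algebra_simps)
  finally have "((\<lambda>t. indicator {\<tau>..} t * t powr (-\<beta>)) has_integral \<tau> powr (1 - \<beta>) / (\<beta> - 1)) UNIV"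
    unfolding indicator_times_eq has_integral_restrict_UNIV by simp
  then show "(\<integral>\<^sup>+ t. ennreal (indicator {\<tau>..} t * t powr (-\<beta>)) \<partial>lborel) = ennreal (\<tau> powr (1 - \<beta>) / (\<beta> - 1))"
    by (intro nn_integral_has_integral_lborel) auto
qed (use assms in auto)

section \<open>Exponential time and the resolvent\<close>

abbreviation exp_distribution :: "real measure" where
  "exp_distribution \<equiv> density lborel (exponential_density 1)"

interpretation expo: prob_space exp_distribution
  by (rule prob_space_exponential_density) simp

lemma AE_exp_distribution_pos: "AE t in exp_distribution. t > 0"
proof -
  have "AE t in lborel. t \<noteq> (0::real)" by (rule AE_lborel_singleton)
  then have "AE t in lborel. 0 < ennreal (exponential_density 1 t) \<longrightarrow> t > 0"
    by eventually_elim (auto simp: exponential_density_def)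
  then show ?thesis by (subst AE_density) auto
qed

lemma integral_exp_distribution:
  fixes f :: "real \<Rightarrow> 'b::{banach, second_countable_topology}"
  assumes [measurable]: "f \<in> borel_measurable borel"
  shows "integral\<^sup>L exp_distribution f = (LINT t|lborel. (indicator {0..} t * exp (- t)) *\<^sub>R f t)"
proof -
  have "exponential_density 1 t = indicator {0..} t * exp (- t)" for t
    by (auto simp: exponential_density_def indicator_def)
  then show ?thesis by (subst integral_density) (auto simp: exponential_density_def)
qed

lemma integrable_exp_distribution:
  fixes f :: "real \<Rightarrow> 'b::{banach, second_countable_topology}"
  assumes [measurable]: "f \<in> borel_measurable borel" and "integrable exp_distribution f"
  shows "integrable lborel (\<lambda>t. (indicator {0..} t * exp (- t)) *\<^sub>R f t)"
proof -
  have "exponential_density 1 t = indicator {0..} t * exp (- t)" for t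
    by (auto simp: exponential_density_def indicator_def)
  then show ?thesis using assms by (subst (asm) integrable_density) (auto simp: exponential_density_def)
qed

context levy
begin

text \<open>Laplace transform in time, at 1, of the characteristic function. If cf at time t is
  exp(-t psi), it equals 1 / (1 + psi), which explains the nonnegative real part.\<close>

definition resolvent :: "real^'n \<Rightarrow> real \<Rightarrow> complex" where
  "resolvent u s = (CLINT t|exp_distribution. cf (max 0 t) (s *\<^sub>R u))"

lemma cf_time_measurable [measurable]: "(\<lambda>t. cf (max 0 t) v) \<in> borel_measurable borel"
  using measurable_compose[OF _ cf_line_jointly_measurable, of "\<lambda>t. (t, 1)" borel v] by simp

lemma integrable_cf_time: "integrable exp_distribution (\<lambda>t. cf (max 0 t) v)"
  by (rule expo.integrable_const_bound[where B = 1]) (auto simp: norm_cf_le_1)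

text \<open>Writing \<open>J h\<close> for the part of the integral over \<open>{0..<h}\<close>, multiplicativity gives
  \<open>J h = (1 - exp (- h) * cf h v) * L\<close>; the factor has nonnegative real part and \<open>J h / h \<rightarrow> 1\<close>.\<close>

lemma Re_resolvent_nonneg: "Re (resolvent u s) \<ge> 0"
proof -
  define v where "v = s *\<^sub>R u"
  define L where "L = resolvent u s"
  define g where "g t = (indicator {0..} t * exp (- t)) *\<^sub>R cf (max 0 t) v" for t :: real
  have g_int: "integrable lborel g"
    unfolding g_def[abs_def] by (rule integrable_exp_distribution[OF _ integrable_cf_time]) measurable
  have L: "L = integral\<^sup>L lborel g"
    unfolding L_def resolvent_def g_def v_def[symmetric] by (rule integral_exp_distribution) measurable
  have rec: "L = (CLINT t|lborel. indicator {0..<h} t *\<^sub>R g t) + of_real (exp (- h)) * cf h v * L" if h: "h > 0" for h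
  proof -
    have i1: "integrable lborel (\<lambda>t. indicator {0..<h} t *\<^sub>R g t)"
      and i2: "integrable lborel (\<lambda>t. indicator {h..} t *\<^sub>R g t)"
      by (intro integrable_mult_indicator g_int; simp)+
    have "g t = indicator {0..<h} t *\<^sub>R g t + indicator {h..} t *\<^sub>R g t" for t
      using h by (auto simp: g_def indicator_def)
    then have "L = (CLINT t|lborel. indicator {0..<h} t *\<^sub>R g t + indicator {h..} t *\<^sub>R g t)"
      unfolding L by (intro Bochner_Integration.integral_cong) auto
    also have "\<dots> = (CLINT t|lborel. indicator {0..<h} t *\<^sub>R g t) + (CLINT t|lborel. indicator {h..} t *\<^sub>R g t)"
      by (rule Bochner_Integration.integral_add[OF i1 i2])
    also have "(CLINT t|lborel. indicator {h..} t *\<^sub>R g t) = (CLINT t|lborel. indicator {h..} (h + 1 * t) *\<^sub>R g (h + 1 * t))"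
      by (subst lborel_integral_real_affine[where c = 1 and t = h]) auto
    also have "\<dots> = (CLINT t|lborel. of_real (exp (- h)) * cf h v * g t)"
    proof (intro Bochner_Integration.integral_cong refl)
      fix t
      show "indicator {h..} (h + 1 * t) *\<^sub>R g (h + 1 * t) = of_real (exp (- h)) * cf h v * g t"
      proof (cases "t \<ge> 0")
        case True
        have "exp (- h - t) = exp (- h) * exp (- t)" by (simp add: exp_add[symmetric])
        then show ?thesis
          using True h by (simp add: g_def cf_add scaleR_conv_of_real max_def)
      qed (use h in \<open>auto simp: g_def\<close>)
    qed
    also have "\<dots> = of_real (exp (- h)) * cf h v * L" unfolding L by simp
    finally show ?thesis .
  qed
  have "Re L \<ge> - (\<epsilon> * norm L)" if \<epsilon>: "\<epsilon> > 0" for \<epsilon>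
  proof -
    have "((\<lambda>t. of_real (exp (- t)) * cf t v) \<longlongrightarrow> of_real (exp (- 0)) * 1) (at_right 0)"
      by (intro tendsto_intros cf_tendsto_1)
    then have "eventually (\<lambda>t. dist (of_real (exp (- t)) * cf t v) 1 < \<epsilon>) (at_right 0)"
      using \<epsilon> by (simp add: tendstoD)
    then obtain d where d: "d > 0" "\<And>t. 0 < t \<Longrightarrow> t < d \<Longrightarrow> dist (of_real (exp (- t)) * cf t v) 1 < \<epsilon>"
      unfolding eventually_at_right_field by auto
    define J where "J = (CLINT t|lborel. indicator {0..<d} t *\<^sub>R g t)"
    have i1: "integrable lborel (\<lambda>t. indicator {0..<d} t *\<^sub>R g t)"
      by (intro integrable_mult_indicator g_int) simp
    have i2: "integrable lborel (\<lambda>t. indicator {0..<d} t *\<^sub>R (1::complex))"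
      using d(1) by (intro integrable_scaleR_left integrable_real_indicator) auto
    have "(CLINT t|lborel. indicator {0..<d} t *\<^sub>R (1::complex)) = of_real d"
      using d(1) by (subst integral_scaleR_left) (auto intro!: integrable_real_indicator simp: scaleR_conv_of_real)
    then have "J - of_real d = (CLINT t|lborel. indicator {0..<d} t *\<^sub>R (g t - 1))"
      unfolding J_def scaleR_diff_right using Bochner_Integration.integral_diff[OF i1 i2] by simp
    also have "norm \<dots> \<le> (LINT t|lborel. \<epsilon> * indicator {0..<d} t)"
    proof (rule order_trans[OF integral_norm_bound integral_mono])
      show "integrable lborel (\<lambda>t. norm (indicator {0..<d} t *\<^sub>R (g t - 1)))"
        unfolding scaleR_diff_right
        by (rule integrable_norm[OF Bochner_Integration.integrable_diff[OF i1 i2]])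
      show "integrable lborel (\<lambda>t. \<epsilon> * indicator {0..<d} t)"
        using d(1) by (intro integrable_mult_right integrable_real_indicator) auto
      fix t :: real
      show "norm (indicator {0..<d} t *\<^sub>R (g t - 1)) \<le> \<epsilon> * indicator {0..<d} t"
      proof (cases "0 < t \<and> t < d")
        case True
        then show ?thesis using d(2)[of t] by (simp add: g_def dist_norm scaleR_conv_of_real)
      next
        case False
        then show ?thesis using \<epsilon> by (cases "t = 0") (auto simp: g_def cf_0 indicator_def)
      qed
    qed
    also have "\<dots> = \<epsilon> * d" using d(1) by simp
    finally have J: "norm (J - of_real d) \<le> \<epsilon> * d" .
    define w where "w = 1 - of_real (exp (- d)) * cf d v"
    have "norm (of_real (exp (- d)) * cf d v) \<le> 1"
      using norm_cf_le_1[of d v] d(1) by (simp add: norm_mult mult_le_one)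
    then have w: "Re w \<ge> 0"
      using complex_Re_le_cmod[of "of_real (exp (- d)) * cf d v"] unfolding w_def by simp
    have "J = w * L" using rec[OF d(1)] by (simp add: J_def w_def algebra_simps)
    then have "Re (J * cnj L) = Re w * (norm L)\<^sup>2"
      by (simp add: mult.assoc complex_mult_cnj cmod_power2)
    then have "0 \<le> Re (J * cnj L)" using w by simp
    also have "\<dots> = d * Re L + Re ((J - of_real d) * cnj L)" by (simp add: algebra_simps)
    also have "Re ((J - of_real d) * cnj L) \<le> norm ((J - of_real d) * cnj L)" by (rule complex_Re_le_cmod)
    also have "\<dots> \<le> \<epsilon> * d * norm L" using J by (simp add: norm_mult mult_right_mono)
    finally have "0 \<le> d * (Re L + \<epsilon> * norm L)" by (simp add: algebra_simps)
    then show ?thesis using d(1) by (simp add: zero_le_mult_iff)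
  qed
  note approx = this
  show ?thesis
  proof (rule ccontr)
    assume "\<not> ?thesis"
    then have neg: "Re L < 0" by (simp add: L_def)
    then have "norm L > 0" by auto
    then show False using approx[of "- Re L / (2 * norm L)"] neg by (simp add: field_simps)
  qed
qed

text \<open>Dominated convergence at frequency 0, where the resolvent is 1. The bound
  \<open>r \<le> 1\<close> keeps the later integration range inside [-1, 1].\<close>

lemma resolvent_near_0:
  obtains r where "0 < r" "r \<le> 1" "\<And>s. \<bar>s\<bar> \<le> r \<Longrightarrow> Re (resolvent u s) \<ge> 1 / 2"
proof -
  have "isCont (resolvent u) 0"
    unfolding continuous_at_sequentially o_def resolvent_def
  proof (intro allI impI)
    fix S :: "nat \<Rightarrow> real" assume S: "S \<longlonglongrightarrow> 0"
    show "(\<lambda>n. CLINT t|exp_distribution. cf (max 0 t) (S n *\<^sub>R u)) \<longlonglongrightarrow> (CLINT t|exp_distribution. cf (max 0 t) (0 *\<^sub>R u))"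
    proof (rule integral_dominated_convergence[where w = "\<lambda>_. 1"])
      show "AE t in exp_distribution. (\<lambda>n. cf (max 0 t) (S n *\<^sub>R u)) \<longlonglongrightarrow> cf (max 0 t) (0 *\<^sub>R u)"
      proof (rule AE_I2)
        fix t :: real
        have "isCont (cf (max 0 t)) (0 *\<^sub>R u)"
          using cf_continuous[of "max 0 t"] by (simp add: continuous_on_eq_continuous_at)
        then show "(\<lambda>n. cf (max 0 t) (S n *\<^sub>R u)) \<longlonglongrightarrow> cf (max 0 t) (0 *\<^sub>R u)"
          by (rule isCont_tendsto_compose) (intro tendsto_intros S)
      qed
    qed (auto simp: norm_cf_le_1)
  qed
  moreover have "resolvent u 0 = 1"
    using expo.prob_space by (simp add: resolvent_def cf_def prob_space)
  ultimately have "((\<lambda>s. Re (resolvent u s)) \<longlongrightarrow> 1) (at 0)"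
    using tendsto_Re[of "resolvent u" "resolvent u 0" "at 0"] by (simp add: isCont_def)
  then have "eventually (\<lambda>s. Re (resolvent u s) > 1 / 2) (at 0)" by (rule order_tendstoD) simp
  then obtain d where d: "d > 0" "\<And>s. s \<noteq> 0 \<Longrightarrow> \<bar>s\<bar> < d \<Longrightarrow> Re (resolvent u s) > 1 / 2"
    unfolding eventually_at by auto
  show ?thesis
  proof (rule that[of "min 1 (d / 2)"])
    fix s assume "\<bar>s\<bar> \<le> min 1 (d / 2)"
    then have "\<bar>s\<bar> < d" using d(1) by auto
    then show "Re (resolvent u s) \<ge> 1 / 2"
      using d(2)[of s] \<open>resolvent u 0 = 1\<close> by (cases "s = 0") auto
  qed (use d in auto)
qed

definition gauss_mean :: "real^'n \<Rightarrow> real \<Rightarrow> real \<Rightarrow> real" where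
  "gauss_mean u \<delta> t = expectation (\<lambda>\<omega>. exp (- ((u \<bullet> Y t \<omega>) / \<delta>)\<^sup>2 / 2))"

lemma gauss_mean_measurable [measurable]: "gauss_mean u \<delta> \<in> borel_measurable borel"
  unfolding gauss_mean_def[abs_def] by measurable

lemma gauss_mean_cf:
  "complex_of_real (gauss_mean u \<delta> t) = (CLINT s|std_normal_distribution. cf (max 0 t) ((s / \<delta>) *\<^sub>R u))"
proof -
  interpret P: pair_prob_space M std_normal_distribution ..
  have "integrable (M \<Otimes>\<^sub>M std_normal_distribution) (\<lambda>(\<omega>, s). iexp (((s / \<delta>) *\<^sub>R u) \<bullet> Y t \<omega>))"
    by (rule P.P.integrable_const_bound[where B = 1]) (auto simp: case_prod_beta)
  then have "(CLINT \<omega>|M. CLINT s|std_normal_distribution. iexp (((s / \<delta>) *\<^sub>R u) \<bullet> Y t \<omega>))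
      = (CLINT s|std_normal_distribution. CLINT \<omega>|M. iexp (((s / \<delta>) *\<^sub>R u) \<bullet> Y t \<omega>))"
    by (rule P.Fubini_integral[symmetric])
  then show ?thesis
    unfolding gauss_mean_def integral_complex_of_real[symmetric] gauss_kernel
    by (simp add: cf_def Y_def ac_simps)
qed

text \<open>Fubini turns the time integral of the bump into the Gaussian average of the resolvent at
  \<open>s / \<delta>\<close>. Nonnegativity of the real part discards all but
  \<open>\<bar>s\<bar> \<le> r * \<delta>\<close>, where it is at least 1/2.\<close>

lemma gauss_occupation_lower:
  obtains \<kappa> where "\<kappa> > 0" "\<And>\<delta>. 0 < \<delta> \<Longrightarrow> \<delta> \<le> 1 \<Longrightarrow> (LINT t|exp_distribution. gauss_mean u \<delta> t) \<ge> \<kappa> * \<delta>"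
proof -
  obtain r where r: "0 < r" "r \<le> 1" "\<And>s. \<bar>s\<bar> \<le> r \<Longrightarrow> Re (resolvent u s) \<ge> 1 / 2"
    using resolvent_near_0[of u] by blast
  \<comment> \<open>Smallest value of the normal density on [-1, 1], which contains the retained
    range because \<open>r * \<delta> \<le> 1\<close>.\<close>
  define n1 where "n1 = std_normal_density 1"
  have n1: "n1 > 0" by (simp add: n1_def std_normal_density_def)
  have "(LINT t|exp_distribution. gauss_mean u \<delta> t) \<ge> (n1 * r) * \<delta>" if \<delta>: "0 < \<delta>" "\<delta> \<le> 1" for \<delta>
  proof -
    interpret P: pair_prob_space exp_distribution std_normal_distribution ..
    have [measurable]: "(\<lambda>p. cf (max 0 (fst p)) ((snd p / \<delta>) *\<^sub>R u)) \<in> borel_measurable (borel \<Otimes>\<^sub>M borel)"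
      using measurable_compose[OF _ cf_line_jointly_measurable, of "\<lambda>p. (fst p, snd p / \<delta>)" "borel \<Otimes>\<^sub>M borel" u] by simp
    have [measurable]: "(\<lambda>p. cf (max 0 (snd p)) ((fst p / \<delta>) *\<^sub>R u)) \<in> borel_measurable (borel \<Otimes>\<^sub>M borel)"
      using measurable_compose[OF _ cf_line_jointly_measurable, of "\<lambda>p. (snd p, fst p / \<delta>)" "borel \<Otimes>\<^sub>M borel" u] by simp
    have "integrable (exp_distribution \<Otimes>\<^sub>M std_normal_distribution) (\<lambda>(t, s). cf (max 0 t) ((s / \<delta>) *\<^sub>R u))"
      by (rule P.P.integrable_const_bound[where B = 1]) (auto simp: case_prod_beta norm_cf_le_1)
    then have "(CLINT s|std_normal_distribution. CLINT t|exp_distribution. cf (max 0 t) ((s / \<delta>) *\<^sub>R u))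
        = (CLINT t|exp_distribution. CLINT s|std_normal_distribution. cf (max 0 t) ((s / \<delta>) *\<^sub>R u))"
      by (rule P.Fubini_integral)
    then have eq: "complex_of_real (LINT t|exp_distribution. gauss_mean u \<delta> t)
        = (CLINT s|std_normal_distribution. resolvent u (s / \<delta>))"
      by (simp add: resolvent_def gauss_mean_cf[symmetric])
    have rm: "(\<lambda>s. resolvent u (s / \<delta>)) \<in> borel_measurable borel"
      unfolding resolvent_def by measurable
    have rb: "norm (resolvent u s) \<le> 1" for s
    proof -
      have "norm (resolvent u s) \<le> (LINT t|exp_distribution. norm (cf (max 0 t) (s *\<^sub>R u)))"
        unfolding resolvent_def by (rule integral_norm_bound)
      also have "\<dots> \<le> (LINT t|exp_distribution. 1)"
        by (intro integral_mono integrable_norm integrable_cf_time) (auto simp: norm_cf_le_1)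
      finally show ?thesis using expo.prob_space by simp
    qed
    have ri: "integrable std_normal_distribution (\<lambda>s. resolvent u (s / \<delta>))"
      by (rule gauss.integrable_const_bound[where B = 1]) (use rm rb in auto)
    have "(n1 * r) * \<delta> = (LINT s|lborel. (n1 / 2) * indicator {- (r * \<delta>)..r * \<delta>} s)"
      using \<delta> r by simp
    also have "\<dots> \<le> (LINT s|lborel. std_normal_density s *\<^sub>R Re (resolvent u (s / \<delta>)))"
    proof (rule integral_mono)
      show "integrable lborel (\<lambda>s. (n1 / 2) * indicator {- (r * \<delta>)..r * \<delta>} s)"
        by (intro integrable_mult_right integrable_real_indicator) (auto simp: emeasure_lborel_Icc_eq)
      show "integrable lborel (\<lambda>s. std_normal_density s *\<^sub>R Re (resolvent u (s / \<delta>)))"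
        using integrable_Re[OF ri] rm by (subst (asm) integrable_density) auto
      fix s :: real
      show "(n1 / 2) * indicator {- (r * \<delta>)..r * \<delta>} s \<le> std_normal_density s *\<^sub>R Re (resolvent u (s / \<delta>))"
      proof (cases "\<bar>s\<bar> \<le> r * \<delta>")
        case True
        then have "Re (resolvent u (s / \<delta>)) \<ge> 1 / 2"
          using \<delta> by (intro r(3)) (simp add: field_simps)
        moreover have "n1 \<le> std_normal_density s"
        proof -
          have "r * \<delta> \<le> 1" using r \<delta> by (intro mult_le_one) auto
          then have "s\<^sup>2 \<le> 1" using True by (simp add: abs_square_le_1)
          then have "exp (- (1::real)\<^sup>2 / 2) \<le> exp (- s\<^sup>2 / 2)" by simp
          then show ?thesis
            unfolding n1_def std_normal_density_def by (intro mult_left_mono) auto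
        qed
        ultimately have "n1 * (1 / 2) \<le> std_normal_density s * Re (resolvent u (s / \<delta>))"
          using n1 by (intro mult_mono) auto
        moreover have "s \<in> {- (r * \<delta>)..r * \<delta>}" using True by auto
        ultimately show ?thesis by simp
      next
        case False
        then have "s \<notin> {- (r * \<delta>)..r * \<delta>}" by auto
        then show ?thesis using Re_resolvent_nonneg by simp
      qed
    qed
    also have "\<dots> = (LINT s|std_normal_distribution. Re (resolvent u (s / \<delta>)))"
      using rm by (subst integral_density) auto
    also have "\<dots> = Re (CLINT s|std_normal_distribution. resolvent u (s / \<delta>))"
      by (rule integral_Re[OF ri])
    also have "\<dots> = (LINT t|exp_distribution. gauss_mean u \<delta> t)"
      unfolding eq[symmetric] by simp
    finally show ?thesis .
  qed
  then show ?thesis using that n1 r by (metis mult_pos_pos)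
qed

end

text \<open>Half of the exponent yields the small factor; the other half remains as a bump of width
  \<open>sqrt 2 * \<delta>\<close>, whose mean is still of order \<open>\<delta>\<close>.\<close>

lemma exp_gauss_tail:
  assumes "\<delta> > 0" "A > 0" "\<bar>y\<bar> > A * \<delta>"
  shows "exp (- (y / \<delta>)\<^sup>2 / 2) \<le> exp (- A\<^sup>2 / 4) * exp (- (y / (sqrt 2 * \<delta>))\<^sup>2 / 2)"
proof -
  have "A \<le> \<bar>y / \<delta>\<bar>" using assms by (simp add: abs_divide field_simps)
  then have "A\<^sup>2 \<le> (y / \<delta>)\<^sup>2" using assms by (metis abs_le_square_iff abs_of_pos)
  moreover have "(y / (sqrt 2 * \<delta>))\<^sup>2 = (y / \<delta>)\<^sup>2 / 2" by (simp add: power_divide power_mult_distrib)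
  ultimately show ?thesis by (simp add: exp_add[symmetric])
qed

text \<open>Small ball weight at time \<open>t / 2\<close>, the time of each independent half. It
  also dominates the weight at time \<open>t\<close>, so one integrable majorant serves all error
  terms.\<close>

definition half_time_weight :: "real \<Rightarrow> real \<Rightarrow> real" where
  "half_time_weight b t = (min (t / 2) 1) powr (-b)"

lemma half_time_weight_measurable [measurable]: "half_time_weight b \<in> borel_measurable borel"
  unfolding half_time_weight_def[abs_def] by measurable

lemma half_time_weight_integrable:
  assumes b: "0 \<le> b" "b < 1" shows "integrable exp_distribution (half_time_weight b)"
proof -
  have "integrable lborel (\<lambda>t. indicator {0..2} t * t powr (-b))"
    using has_bochner_integral_powr_0[of b 2] b by (simp add: has_bochner_integral_iff)
  then have i1: "integrable lborel (\<lambda>t. 2 powr b * (indicator {0..2} t * t powr (-b)))"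
    by (rule integrable_mult_right)
  have i2: "integrable lborel (\<lambda>t. exponential_density 1 t *\<^sub>R (1::real))"
    using expo.integrable_const[of "1::real"]
    by (subst (asm) integrable_density) (auto simp: exponential_density_def)
  have "integrable lborel (\<lambda>t. exponential_density 1 t *\<^sub>R half_time_weight b t)"
  proof (rule Bochner_Integration.integrable_bound[OF Bochner_Integration.integrable_add[OF i1 i2]])
    show "AE t in lborel. norm (exponential_density 1 t *\<^sub>R half_time_weight b t)
      \<le> norm (2 powr b * (indicator {0..2} t * t powr (-b)) + exponential_density 1 t *\<^sub>R (1::real))"
    proof (rule AE_I2)
      fix t :: real
      show "norm (exponential_density 1 t *\<^sub>R half_time_weight b t)
        \<le> norm (2 powr b * (indicator {0..2} t * t powr (-b)) + exponential_density 1 t *\<^sub>R (1::real))"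
      proof (cases "0 \<le> t \<and> t \<le> 2")
        case True
        then have "half_time_weight b t = t powr (-b) / 2 powr (-b)"
          by (simp add: half_time_weight_def powr_divide)
        then have h: "half_time_weight b t = 2 powr b * t powr (-b)"
          by (simp add: powr_minus divide_inverse)
        have nn: "exponential_density 1 t \<ge> 0" by (simp add: exponential_density_def)
        have "exponential_density 1 t * half_time_weight b t \<le> 1 * (2 powr b * t powr (-b))"
          unfolding h using True by (intro mult_right_mono) (auto simp: exponential_density_def)
        then have "exponential_density 1 t * half_time_weight b t
            \<le> 2 powr b * t powr (-b) + exponential_density 1 t" using nn by linarith
        moreover have "half_time_weight b t \<ge> 0" by (simp add: half_time_weight_def)
        ultimately show ?thesis
          using True nn by (simp add: abs_mult)
      next
        case False
        then show ?thesis by (auto simp: exponential_density_def half_time_weight_def min_def)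
      qed
    qed
  qed measurable
  then show ?thesis by (subst integrable_density) (auto simp: exponential_density_def)
qed

lemma min_powr_le_half_time_weight:
  assumes "t > 0" "b \<ge> 0" shows "(min t 1) powr (-b) \<le> half_time_weight b t"
  unfolding half_time_weight_def using assms by (intro powr_mono2') auto

context contracting_semistable
begin

text \<open>If \<open>norm (X t) > C\<close> then one of the two independent increments over \<open>{0..t/2}\<close> and
  \<open>{t/2..t}\<close> exceeds \<open>C / 2\<close>, and the other one still provides the small ball factor.\<close>

lemma small_ball_large_norm:
  assumes t: "t > 0"
    and sb: "\<And>y. prob {\<omega> \<in> space M. \<bar>u \<bullet> X (t / 2) \<omega> - y\<bar> \<le> \<eta>} \<le> B"
  shows "prob {\<omega> \<in> space M. \<bar>u \<bullet> X t \<omega>\<bar> \<le> \<eta> \<and> norm (X t \<omega>) > C}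
    \<le> 2 * B * prob {\<omega> \<in> space M. norm (X (t / 2) \<omega>) > C / 2}"
proof -
  define s where "s = t / 2"
  have s: "s > 0" "s + s = t" using t by (auto simp: s_def)
  have [measurable]: "X s \<in> borel_measurable M" "X t \<in> borel_measurable M"
    using s t by (auto intro: X_measurable)
  define \<mu> where "\<mu> = distr M borel (X s)"
  interpret D: prob_space \<mu> unfolding \<mu>_def by (rule prob_space_distr) measurable
  interpret P: pair_prob_space \<mu> \<mu> ..
  have [measurable_cong]: "sets \<mu> = sets borel" by (simp add: \<mu>_def)
  have B0: "B \<ge> 0" using sb[of 0] measure_nonneg order_trans by blast
  have \<mu>_sb: "measure \<mu> {y. \<bar>u \<bullet> y - z\<bar> \<le> \<eta>} \<le> B" for z
    using sb[of z] unfolding \<mu>_def s_def[symmetric]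
    by (subst measure_distr) (auto simp: vimage_def Int_def conj_commute)
  define p where "p = measure \<mu> {x. norm x > C / 2}"
  have p: "p = prob {\<omega> \<in> space M. norm (X s \<omega>) > C / 2}"
    unfolding p_def \<mu>_def by (subst measure_distr) (auto simp: vimage_def Int_def conj_commute)
  define S1 where "S1 = {(x, y). \<bar>u \<bullet> (x + y)\<bar> \<le> \<eta> \<and> norm x > C / 2}"
  define S2 where "S2 = {(x, y). \<bar>u \<bullet> (x + y)\<bar> \<le> \<eta> \<and> norm y > C / 2}"
  have [measurable]: "S1 \<in> sets (borel \<Otimes>\<^sub>M borel)" "S2 \<in> sets (borel \<Otimes>\<^sub>M borel)"
  proof -
    have "S1 = {p \<in> space (borel \<Otimes>\<^sub>M borel). \<bar>u \<bullet> (fst p + snd p)\<bar> \<le> \<eta> \<and> norm (fst p) > C / 2}"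
      "S2 = {p \<in> space (borel \<Otimes>\<^sub>M borel). \<bar>u \<bullet> (fst p + snd p)\<bar> \<le> \<eta> \<and> norm (snd p) > C / 2}"
      by (auto simp: S1_def S2_def space_pair_measure)
    then show "S1 \<in> sets (borel \<Otimes>\<^sub>M borel)" "S2 \<in> sets (borel \<Otimes>\<^sub>M borel)" by simp_all
  qed
  have slice: "{y. \<bar>u \<bullet> (x + y)\<bar> \<le> \<eta>} = {y. \<bar>u \<bullet> y - (- (u \<bullet> x))\<bar> \<le> \<eta>}" for x
    by (simp add: inner_add_right add.commute)
  have e1: "emeasure (\<mu> \<Otimes>\<^sub>M \<mu>) S1 \<le> ennreal (B * p)"
  proof -
    have "emeasure (\<mu> \<Otimes>\<^sub>M \<mu>) S1 = (\<integral>\<^sup>+ x. emeasure \<mu> (Pair x -` S1) \<partial>\<mu>)"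
      by (rule D.emeasure_pair_measure_alt) measurable
    also have "\<dots> \<le> (\<integral>\<^sup>+ x. ennreal B * indicator {x. norm x > C / 2} x \<partial>\<mu>)"
    proof (rule nn_integral_mono)
      fix x
      have "Pair x -` S1 = (if norm x > C / 2 then {y. \<bar>u \<bullet> (x + y)\<bar> \<le> \<eta>} else {})"
        by (auto simp: S1_def)
      then show "emeasure \<mu> (Pair x -` S1) \<le> ennreal B * indicator {x. norm x > C / 2} x"
        using \<mu>_sb[of "- (u \<bullet> x)"] unfolding slice
        by (auto simp: D.emeasure_eq_measure intro!: ennreal_leI)
    qed
    also have "\<dots> = ennreal B * emeasure \<mu> {x. norm x > C / 2}"
      by (rule nn_integral_cmult_indicator) measurable
    finally show ?thesis using B0 by (simp add: p_def D.emeasure_eq_measure ennreal_mult)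
  qed
  have e2: "emeasure (\<mu> \<Otimes>\<^sub>M \<mu>) S2 \<le> ennreal (B * p)"
  proof -
    have "emeasure (\<mu> \<Otimes>\<^sub>M \<mu>) S2 = (\<integral>\<^sup>+ y. emeasure \<mu> ((\<lambda>x. (x, y)) -` S2) \<partial>\<mu>)"
      by (rule P.emeasure_pair_measure_alt2) measurable
    also have "\<dots> \<le> (\<integral>\<^sup>+ x. ennreal B * indicator {x. norm x > C / 2} x \<partial>\<mu>)"
    proof (rule nn_integral_mono)
      fix y
      have "(\<lambda>x. (x, y)) -` S2 = (if norm y > C / 2 then {x. \<bar>u \<bullet> (y + x)\<bar> \<le> \<eta>} else {})"
        by (auto simp: S2_def add.commute)
      then show "emeasure \<mu> ((\<lambda>x. (x, y)) -` S2) \<le> ennreal B * indicator {x. norm x > C / 2} y"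
        using \<mu>_sb[of "- (u \<bullet> y)"] unfolding slice
        by (auto simp: D.emeasure_eq_measure intro!: ennreal_leI)
    qed
    also have "\<dots> = ennreal B * emeasure \<mu> {x. norm x > C / 2}"
      by (rule nn_integral_cmult_indicator) measurable
    finally show ?thesis using B0 by (simp add: p_def D.emeasure_eq_measure ennreal_mult)
  qed
  have "prob {\<omega> \<in> space M. \<bar>u \<bullet> X t \<omega>\<bar> \<le> \<eta> \<and> norm (X t \<omega>) > C}
      \<le> prob {\<omega> \<in> space M. (X s \<omega>, X (s + s) \<omega> - X s \<omega>) \<in> S1 \<union> S2}"
  proof (rule finite_measure_mono)
    show "{\<omega> \<in> space M. \<bar>u \<bullet> X t \<omega>\<bar> \<le> \<eta> \<and> norm (X t \<omega>) > C}
        \<subseteq> {\<omega> \<in> space M. (X s \<omega>, X (s + s) \<omega> - X s \<omega>) \<in> S1 \<union> S2}"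
    proof
      fix \<omega> assume \<omega>: "\<omega> \<in> {\<omega> \<in> space M. \<bar>u \<bullet> X t \<omega>\<bar> \<le> \<eta> \<and> norm (X t \<omega>) > C}"
      have "norm (X t \<omega>) \<le> norm (X s \<omega>) + norm (X t \<omega> - X s \<omega>)"
        using norm_triangle_ineq[of "X s \<omega>" "X t \<omega> - X s \<omega>"] by simp
      then have "norm (X s \<omega>) > C / 2 \<or> norm (X t \<omega> - X s \<omega>) > C / 2" using \<omega> by auto
      then show "\<omega> \<in> {\<omega> \<in> space M. (X s \<omega>, X (s + s) \<omega> - X s \<omega>) \<in> S1 \<union> S2}"
        using \<omega> by (auto simp: S1_def S2_def s(2))
    qed
    show "{\<omega> \<in> space M. (X s \<omega>, X (s + s) \<omega> - X s \<omega>) \<in> S1 \<union> S2} \<in> events"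
      unfolding s(2) by measurable
  qed
  also have "\<dots> = measure (distr M (borel \<Otimes>\<^sub>M borel) (\<lambda>\<omega>. (X s \<omega>, X (s + s) \<omega> - X s \<omega>))) (S1 \<union> S2)"
    unfolding s(2) by (subst measure_distr) (auto simp: vimage_def Int_def conj_commute)
  also have "\<dots> = measure (\<mu> \<Otimes>\<^sub>M \<mu>) (S1 \<union> S2)"
    by (simp only: joint_distr[OF s(1) s(1)] \<mu>_def)
  also have "\<dots> \<le> measure (\<mu> \<Otimes>\<^sub>M \<mu>) S1 + measure (\<mu> \<Otimes>\<^sub>M \<mu>) S2"
    by (rule measure_Un_le) measurable
  also have "\<dots> \<le> B * p + B * p"
    using e1 e2 B0 by (intro add_mono) (auto simp: P.P.emeasure_eq_measure p_def)
  finally show ?thesis by (simp add: p s_def)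
qed

text \<open>The bump of width \<open>\<delta>\<close> has integrated mean at least
  \<open>\<kappa> * \<delta>\<close>. Three errors, each linear in \<open>\<delta>\<close>, are
  subtracted: positions beyond \<open>A * \<delta>\<close>, large norms, and late times.
  \<open>A\<close> is fixed before the truncation level \<open>n\<close>, and both independently of
  \<open>\<delta>\<close>. The weight is integrable at time 0 because \<open>b < 1\<close>.\<close>

lemma occupation_lower:
  assumes e: "\<And>y. u \<bullet> E y = b * (u \<bullet> y)" and b: "0 \<le> b" "b < 1" and dual: "u \<bullet> x = 1"
  obtains C \<kappa> where "C > 0" "\<kappa> > 0" "\<And>\<eta>. 0 < \<eta> \<Longrightarrow> \<eta> \<le> 1 \<Longrightarrow>
    (LBINT t:{0..C}. prob {\<omega> \<in> space M. \<bar>u \<bullet> Y t \<omega>\<bar> \<le> \<eta> \<and> norm (Y t \<omega>) \<le> C}) \<ge> \<kappa> * \<eta>"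
proof -
  let ?T = "exp_distribution"
  let ?W = "half_time_weight b"
  obtain \<kappa> where \<kappa>: "\<kappa> > 0"
    "\<And>\<delta>. 0 < \<delta> \<Longrightarrow> \<delta> \<le> 1 \<Longrightarrow> (LINT t|?T. gauss_mean u \<delta> t) \<ge> \<kappa> * \<delta>"
    using gauss_occupation_lower by blast
  obtain K where K: "K > 0" "\<And>t \<epsilon> y. 0 < t \<Longrightarrow> 0 < \<epsilon> \<Longrightarrow>
    expectation (\<lambda>\<omega>. exp (- ((u \<bullet> X t \<omega> - y) / \<epsilon>)\<^sup>2 / 2)) \<le> K * \<epsilon> * (min t 1) powr (-b)"
    using gauss_small_ball[OF e b(1) dual] by blast
  obtain K0 where K0: "K0 > 0" "\<And>t \<epsilon> y. 0 < t \<Longrightarrow> 0 < \<epsilon> \<Longrightarrow>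
    prob {\<omega> \<in> space M. \<bar>u \<bullet> X t \<omega> - y\<bar> \<le> \<epsilon>} \<le> K0 * \<epsilon> * (min t 1) powr (-b)"
    using small_ball[OF e b(1) dual] by blast
  have W: "integrable ?T ?W" by (rule half_time_weight_integrable[OF b])
  have Wnn: "?W t \<ge> 0" for t by (simp add: half_time_weight_def)
  define IW where "IW = integral\<^sup>L ?T ?W"
  have IW: "IW \<ge> 0" unfolding IW_def by (rule Bochner_Integration.integral_nonneg) (rule Wnn)
  \<comment> \<open>\<open>A\<close> makes the Gaussian tail cost at most a quarter of the main
    term; the choice rests on
    \<open>D \<le> A\<^sup>2 / 4 \<le> exp (A\<^sup>2 / 4)\<close>.\<close>
  obtain A where A: "A \<ge> 1" "exp (- A\<^sup>2 / 4) * (K * sqrt 2 * IW) \<le> \<kappa> / 4"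
  proof -
    define D where "D = 4 * (K * sqrt 2 * IW) / \<kappa>"
    have D: "D \<ge> 0" unfolding D_def using K \<kappa> IW by simp
    define A where "A = 1 + 4 * D"
    have A1: "A \<ge> 1" using D by (simp add: A_def)
    have "D \<le> A / 4" using D by (simp add: A_def)
    also have "\<dots> \<le> A\<^sup>2 / 4" using A1 by (simp add: power2_eq_square)
    also have "\<dots> \<le> exp (A\<^sup>2 / 4)" using exp_ge_add_one_self[of "A\<^sup>2 / 4"] by linarith
    finally have "exp (- A\<^sup>2 / 4) * D \<le> exp (- A\<^sup>2 / 4) * exp (A\<^sup>2 / 4)" by (intro mult_left_mono) auto
    also have "\<dots> = 1" by (simp add: exp_add[symmetric])
    finally have "exp (- A\<^sup>2 / 4) * (K * sqrt 2 * IW) \<le> \<kappa> / 4"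
      using \<kappa> by (simp add: D_def field_simps)
    with A1 show thesis by (rule that)
  qed
  define p where "p n t = prob {\<omega> \<in> space M. norm (Y (t / 2) \<omega>) > real n / 2}" for n :: nat and t
  \<comment> \<open>Bound for the lost mass up to the factor \<open>K0 * A * \<delta>\<close>: large
    norm before time \<open>n\<close>, with the factor 2 from the two halves, and everything after
    it. It tends to 0 pointwise and is dominated by the weight.\<close>
  define r where "r n t = ?W t * (2 * p n t + indicator {real n<..} t)" for n t
  have pm [measurable]: "p n \<in> borel_measurable borel" for n
  proof -
    have "(\<lambda>t. prob {\<omega> \<in> space M. Y (t / 2) \<omega> \<in> {x. norm x > real n / 2}}) \<in> borel_measurable borel"
      by (rule measurable_compose[OF _ prob_Y_measurable, of "\<lambda>t. t / 2"]) measurable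
    then show ?thesis by (simp add: p_def[abs_def])
  qed
  have p01: "0 \<le> p n t" "p n t \<le> 1" for n t by (simp_all add: p_def)
  have r_bound: "norm (r n t) \<le> 3 * ?W t" for n t
  proof -
    have "2 * p n t + indicator {real n<..} t \<le> 3" using p01[of n t] by (simp add: indicator_def)
    moreover have "2 * p n t + indicator {real n<..} t \<ge> 0" using p01[of n t] by simp
    moreover have "?W t * (2 * p n t + indicator {real n<..} t) \<le> ?W t * 3"
      by (rule mult_left_mono[OF _ Wnn]) fact
    ultimately show ?thesis by (simp add: r_def Wnn abs_mult mult.commute)
  qed
  have rm [measurable]: "r n \<in> borel_measurable borel" for n unfolding r_def[abs_def] by measurable
  have r_int: "integrable ?T (r n)" for n
    by (rule Bochner_Integration.integrable_bound[OF integrable_mult_right[OF W, of 3]])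
       (use r_bound Wnn in \<open>auto intro!: AE_I2\<close>)
  have "(\<lambda>n. integral\<^sup>L ?T (r n)) \<longlonglongrightarrow> integral\<^sup>L ?T (\<lambda>t. 0 :: real)"
  proof (rule integral_dominated_convergence[where w = "\<lambda>t. 3 * ?W t"])
    show "AE t in ?T. (\<lambda>n. r n t) \<longlonglongrightarrow> 0"
      using AE_exp_distribution_pos
    proof eventually_elim
      case (elim t)
      have "(\<lambda>n. prob {\<omega> \<in> space M. norm (2 *\<^sub>R X (t / 2) \<omega>) > real n}) \<longlonglongrightarrow> 0"
      proof -
        have [measurable]: "X (t / 2) \<in> borel_measurable M" using elim by (intro X_measurable) simp
        have "(\<lambda>n. prob {\<omega> \<in> space M. norm (2 *\<^sub>R X (t / 2) \<omega>) > real n})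
          \<longlonglongrightarrow> prob (\<Inter>n. {\<omega> \<in> space M. norm (2 *\<^sub>R X (t / 2) \<omega>) > real n})"
          by (rule finite_Lim_measure_decseq) (auto simp: decseq_def)
        moreover have "(\<Inter>n. {\<omega> \<in> space M. norm (2 *\<^sub>R X (t / 2) \<omega>) > real n}) = {}"
          by (auto simp del: norm_scaleR, meson less_asym reals_Archimedean2)
        ultimately show ?thesis by simp
      qed
      moreover have "p n t = prob {\<omega> \<in> space M. norm (2 *\<^sub>R X (t / 2) \<omega>) > real n}" for n
        using elim by (simp add: p_def mult.commute)
      ultimately have 1: "(\<lambda>n. p n t) \<longlonglongrightarrow> 0" by simp
      obtain N :: nat where N: "t < real N" using reals_Archimedean2 by blast
      have "eventually (\<lambda>n. indicator {real n<..} t = (0::real)) sequentially"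
        unfolding eventually_sequentially using N by (intro exI[of _ N]) (auto simp: indicator_def)
      then have 2: "(\<lambda>n. indicator {real n<..} t :: real) \<longlonglongrightarrow> 0" by (rule tendsto_eventually)
      have "(\<lambda>n. r n t) \<longlonglongrightarrow> ?W t * (2 * 0 + 0)" unfolding r_def by (intro tendsto_intros 1 2)
      then show ?case by simp
    qed
    show "AE t in ?T. norm (r n t) \<le> 3 * ?W t" for n by (intro AE_I2 r_bound)
    show "integrable ?T (\<lambda>t. 3 * ?W t)" by (intro integrable_mult_right W)
  qed (use rm in auto)
  then have "eventually (\<lambda>n. integral\<^sup>L ?T (r n) < \<kappa> / (4 * (K0 * A))) sequentially"
    using \<kappa> K0 A by (intro order_tendstoD) auto
  moreover have "eventually (\<lambda>n. n \<ge> 1) sequentially" by (rule eventually_ge_at_top)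
  ultimately have "eventually (\<lambda>n. integral\<^sup>L ?T (r n) < \<kappa> / (4 * (K0 * A)) \<and> n \<ge> 1) sequentially"
    by eventually_elim simp
  then obtain n where n: "integral\<^sup>L ?T (r n) < \<kappa> / (4 * (K0 * A))" "n \<ge> 1"
    using eventually_happens'[OF sequentially_bot] by blast
  define C where "C = real n"
  have C: "C > 0" using n(2) by (simp add: C_def)
  have main: "(LBINT t:{0..C}. prob {\<omega> \<in> space M. \<bar>u \<bullet> Y t \<omega>\<bar> \<le> A * \<delta> \<and> norm (Y t \<omega>) \<le> C}) \<ge> (\<kappa> / 2) * \<delta>"
    if \<delta>: "0 < \<delta>" "\<delta> \<le> 1" for \<delta>
  proof -
    have A\<delta>: "A * \<delta> > 0" using A \<delta> by simp
    define f where "f t = prob {\<omega> \<in> space M. \<bar>u \<bullet> Y t \<omega>\<bar> \<le> A * \<delta> \<and> norm (Y t \<omega>) \<le> C}" for t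
    have fm [measurable]: "f \<in> borel_measurable borel"
      using prob_Y_measurable[of "{x. \<bar>u \<bullet> x\<bar> \<le> A * \<delta> \<and> norm x \<le> C}"] by (simp add: f_def[abs_def])
    have f01: "0 \<le> f t" "f t \<le> 1" for t by (simp_all add: f_def)
    define c1 where "c1 = exp (- A\<^sup>2 / 4) * (K * sqrt 2)"
    define c2 where "c2 = K0 * A"
    have bound: "gauss_mean u \<delta> t \<le> indicator {0..C} t * f t + \<delta> * (c1 * ?W t + c2 * r n t)"
      if t: "t > 0" for t
    proof -
      have [measurable]: "X t \<in> borel_measurable M" using t by (intro X_measurable) simp
      let ?S = "{\<omega> \<in> space M. \<bar>u \<bullet> X t \<omega>\<bar> \<le> A * \<delta>}"
      let ?G = "\<lambda>\<omega>. exp (- ((u \<bullet> X t \<omega> - 0) / (sqrt 2 * \<delta>))\<^sup>2 / 2)"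
      have gi: "integrable M (\<lambda>\<omega>. exp (- ((u \<bullet> X t \<omega>) / \<epsilon>)\<^sup>2 / 2))" for \<epsilon>
        by (rule integrable_const_bound[where B = 1]) auto
      have si: "integrable M (indicator ?S :: _ \<Rightarrow> real)"
        by (rule integrable_const_bound[where B = 1]) (auto split: split_indicator)
      have "gauss_mean u \<delta> t \<le> expectation (\<lambda>\<omega>. indicator ?S \<omega> + exp (- A\<^sup>2 / 4) * ?G \<omega>)"
        unfolding gauss_mean_def Y_eq[OF less_imp_le[OF t]]
      proof (rule integral_mono)
        show "integrable M (\<lambda>\<omega>. indicator ?S \<omega> + exp (- A\<^sup>2 / 4) * ?G \<omega>)"
          using gi[of "sqrt 2 * \<delta>"] si by simp
        fix \<omega> assume \<omega>: "\<omega> \<in> space M"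
        show "exp (- ((u \<bullet> X t \<omega>) / \<delta>)\<^sup>2 / 2) \<le> indicator ?S \<omega> + exp (- A\<^sup>2 / 4) * ?G \<omega>"
        proof (cases "\<omega> \<in> ?S")
          case True
          have "exp (- ((u \<bullet> X t \<omega>) / \<delta>)\<^sup>2 / 2) \<le> 1" by simp
          moreover have "0 \<le> exp (- A\<^sup>2 / 4) * ?G \<omega>" by simp
          ultimately show ?thesis using True by (simp only: indicator_simps)
        next
          case False
          then have "\<bar>u \<bullet> X t \<omega>\<bar> > A * \<delta>" using \<omega> by auto
          then show ?thesis using exp_gauss_tail[of \<delta> A "u \<bullet> X t \<omega>"] \<delta> A False by simp
        qed
      qed (rule gi)
      also have "\<dots> = prob ?S + exp (- A\<^sup>2 / 4) * expectation ?G"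
        using gi[of "sqrt 2 * \<delta>"] si by (subst Bochner_Integration.integral_add) simp_all
      also have "expectation ?G \<le> K * (sqrt 2 * \<delta>) * (min t 1) powr (-b)"
        using t \<delta> by (intro K(2)) auto
      also have "\<dots> \<le> K * (sqrt 2 * \<delta>) * ?W t"
        using min_powr_le_half_time_weight[OF t b(1)] K(1) \<delta> by (intro mult_left_mono) auto
      finally have g1: "gauss_mean u \<delta> t \<le> prob ?S + \<delta> * (c1 * ?W t)"
        by (simp add: c1_def mult_left_mono ac_simps)
      have "prob ?S \<le> indicator {0..C} t * f t + \<delta> * (c2 * r n t)"
      proof (cases "t \<le> C")
        case True
        have "prob ?S \<le> f t + prob {\<omega> \<in> space M. \<bar>u \<bullet> X t \<omega>\<bar> \<le> A * \<delta> \<and> norm (X t \<omega>) > C}"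
        proof -
          let ?S1 = "{\<omega> \<in> space M. \<bar>u \<bullet> X t \<omega>\<bar> \<le> A * \<delta> \<and> norm (X t \<omega>) \<le> C}"
          let ?S2 = "{\<omega> \<in> space M. \<bar>u \<bullet> X t \<omega>\<bar> \<le> A * \<delta> \<and> norm (X t \<omega>) > C}"
          have "?S = ?S1 \<union> ?S2" by auto
          moreover have "prob (?S1 \<union> ?S2) \<le> prob ?S1 + prob ?S2"
            by (rule measure_Un_le) measurable
          moreover have "f t = prob ?S1" using t by (simp add: f_def)
          ultimately show ?thesis by (simp only:)
        qed
        also have "prob {\<omega> \<in> space M. \<bar>u \<bullet> X t \<omega>\<bar> \<le> A * \<delta> \<and> norm (X t \<omega>) > C}
            \<le> 2 * (K0 * (A * \<delta>) * ?W t) * prob {\<omega> \<in> space M. norm (X (t / 2) \<omega>) > C / 2}"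
        proof (rule small_ball_large_norm[OF t])
          show "prob {\<omega> \<in> space M. \<bar>u \<bullet> X (t / 2) \<omega> - y\<bar> \<le> A * \<delta>} \<le> K0 * (A * \<delta>) * ?W t" for y
            using K0(2)[of "t / 2" "A * \<delta>" y] t A\<delta> by (simp add: half_time_weight_def)
        qed
        also have "\<dots> = \<delta> * (c2 * (?W t * (2 * p n t)))"
          using t by (simp add: c2_def p_def C_def ac_simps)
        also have "?W t * (2 * p n t) = r n t"
          using True by (simp add: r_def C_def indicator_def)
        finally show ?thesis using True t by simp
      next
        \<comment> \<open>Past time \<open>C\<close> the whole small ball probability is counted as
          loss.\<close>
        case False
        have "prob ?S = prob {\<omega> \<in> space M. \<bar>u \<bullet> X t \<omega> - 0\<bar> \<le> A * \<delta>}" by simp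
        also have "\<dots> \<le> K0 * (A * \<delta>) * (min t 1) powr (-b)" by (rule K0(2)[OF t A\<delta>])
        also have "\<dots> \<le> K0 * (A * \<delta>) * ?W t"
          using min_powr_le_half_time_weight[OF t b(1)] K0(1) A\<delta> by (intro mult_left_mono) auto
        also have "\<dots> = \<delta> * (c2 * (?W t * 1))" by (simp add: c2_def ac_simps)
        also have "\<dots> \<le> \<delta> * (c2 * r n t)"
          unfolding r_def using False p01[of n t] \<delta> K0(1) A(1)
          by (intro mult_left_mono Wnn) (auto simp: c2_def C_def indicator_def)
        finally show ?thesis using False by simp
      qed
      with g1 show ?thesis by (simp add: distrib_left)
    qed
    have i_f: "integrable ?T (\<lambda>t. indicator {0..C} t * f t)"
      by (rule expo.integrable_const_bound[where B = 1]) (use f01 in \<open>auto split: split_indicator\<close>)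
    have i_r: "integrable ?T (\<lambda>t. \<delta> * (c1 * ?W t + c2 * r n t))" using W r_int by simp
    have "\<kappa> * \<delta> \<le> (LINT t|?T. gauss_mean u \<delta> t)" by (rule \<kappa>(2)[OF \<delta>])
    also have "\<dots> \<le> (LINT t|?T. indicator {0..C} t * f t + \<delta> * (c1 * ?W t + c2 * r n t))"
    proof (rule integral_mono_AE)
      show "integrable ?T (gauss_mean u \<delta>)"
      proof (rule expo.integrable_const_bound[where B = 1])
        have "norm (gauss_mean u \<delta> t) \<le> 1" for t
        proof -
          have "gauss_mean u \<delta> t \<le> expectation (\<lambda>_. 1)"
            unfolding gauss_mean_def
            by (intro integral_mono integrable_const_bound[where B = 1]) auto
          moreover have "gauss_mean u \<delta> t \<ge> 0"
            unfolding gauss_mean_def by (rule Bochner_Integration.integral_nonneg) simp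
          ultimately show ?thesis by (simp add: prob_space)
        qed
        then show "AE t in ?T. norm (gauss_mean u \<delta> t) \<le> 1" by simp
      qed measurable
      show "integrable ?T (\<lambda>t. indicator {0..C} t * f t + \<delta> * (c1 * ?W t + c2 * r n t))"
        by (rule Bochner_Integration.integrable_add[OF i_f i_r])
      show "AE t in ?T. gauss_mean u \<delta> t \<le> indicator {0..C} t * f t + \<delta> * (c1 * ?W t + c2 * r n t)"
        using AE_exp_distribution_pos by eventually_elim (rule bound)
    qed
    also have "\<dots> = (LINT t|?T. indicator {0..C} t * f t) + \<delta> * (c1 * IW + c2 * integral\<^sup>L ?T (r n))"
      unfolding Bochner_Integration.integral_add[OF i_f i_r] using W r_int by (simp add: IW_def)
    finally have *: "\<kappa> * \<delta> \<le> (LINT t|?T. indicator {0..C} t * f t) + \<delta> * (c1 * IW + c2 * integral\<^sup>L ?T (r n))" .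
    have "c1 * IW \<le> \<kappa> / 4" using A(2) by (simp add: c1_def mult.assoc)
    moreover have "c2 * integral\<^sup>L ?T (r n) \<le> \<kappa> / 4"
    proof -
      have "c2 > 0" using K0 A by (simp add: c2_def)
      moreover have "integral\<^sup>L ?T (r n) < \<kappa> / (4 * c2)" using n(1) by (simp only: c2_def)
      ultimately show ?thesis by (simp add: field_simps)
    qed
    ultimately have "\<delta> * (c1 * IW + c2 * integral\<^sup>L ?T (r n)) \<le> \<delta> * (\<kappa> / 2)"
      using \<delta> by (intro mult_left_mono) auto
    with * have "(\<kappa> / 2) * \<delta> \<le> (LINT t|?T. indicator {0..C} t * f t)" by (simp add: algebra_simps)
    also have "\<dots> = (LINT t|lborel. (indicator {0..} t * exp (- t)) *\<^sub>R (indicator {0..C} t * f t))"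
      by (rule integral_exp_distribution) measurable
    also have "\<dots> \<le> (LINT t|lborel. indicator {0..C} t *\<^sub>R f t)"
    proof (rule integral_mono)
      show "integrable lborel (\<lambda>t. (indicator {0..} t * exp (- t)) *\<^sub>R (indicator {0..C} t * f t))"
        by (rule integrable_exp_distribution[OF _ i_f]) measurable
      show "integrable lborel (\<lambda>t. indicator {0..C} t *\<^sub>R f t)"
        by (rule integrable_indicator_Icc_bounded[OF fm f01])
      show "(indicator {0..} t * exp (- t)) *\<^sub>R (indicator {0..C} t * f t) \<le> indicator {0..C} t *\<^sub>R f t" for t
        using f01[of t] by (auto simp: indicator_def intro: mult_left_le_one_le)
    qed
    finally show ?thesis by (simp add: set_lebesgue_integral_def f_def)
  qed
  show ?thesis
  \<comment> \<open>The main estimate is used with \<open>\<delta> = \<eta> / A\<close>, which is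
    admissible since \<open>A \<ge> 1\<close>.\<close>
  proof (rule that[of C "\<kappa> / 2 / A"])
    show "C > 0" "\<kappa> / 2 / A > 0" using C \<kappa> A by auto
    fix \<eta> :: real assume "0 < \<eta>" "\<eta> \<le> 1"
    then show "(LBINT t:{0..C}. prob {\<omega> \<in> space M. \<bar>u \<bullet> Y t \<omega>\<bar> \<le> \<eta> \<and> norm (Y t \<omega>) \<le> C}) \<ge> \<kappa> / 2 / A * \<eta>"
      using main[of "\<eta> / A"] A by simp
  qed
qed

end

section \<open>Sojourn times\<close>

text \<open>The two power bounds agree at \<open>t = \<tau>\<close>; the first is integrable at 0,
  the second at infinity, and both pieces are multiples of
  \<open>\<tau> powr (1 - \<beta>1)\<close>. Integrating the second out to infinity removes the
  dependence on \<open>s\<close>.\<close>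

lemma occupation_upper_integral:
  fixes f :: "real \<Rightarrow> real"
  assumes [measurable]: "f \<in> borel_measurable borel" and nn: "\<And>t. f t \<ge> 0"
    and \<beta>: "\<beta>1 < 1" "1 < \<beta>2" and \<tau>: "0 < \<tau>" and D: "D \<ge> 0" and s: "s \<le> 1"
    and f1: "\<And>t. 0 < t \<Longrightarrow> t \<le> 1 \<Longrightarrow> f t \<le> D * t powr (-\<beta>1)"
    and f2: "\<And>t. 0 < t \<Longrightarrow> t \<le> 1 \<Longrightarrow> f t \<le> D * \<tau> powr (\<beta>2 - \<beta>1) * t powr (-\<beta>2)"
  shows "(LBINT t:{0..s}. f t) \<le> D * \<tau> powr (1 - \<beta>1) * (1 / (1 - \<beta>1) + 1 / (\<beta>2 - 1))"
proof -
  have h1: "has_bochner_integral lborel (\<lambda>t. D * (indicator {0..\<tau>} t * t powr (-\<beta>1))) (D * (\<tau> powr (1 - \<beta>1) / (1 - \<beta>1)))"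
    using \<beta> \<tau> by (intro has_bochner_integral_mult_right has_bochner_integral_powr_0) auto
  have h2: "has_bochner_integral lborel (\<lambda>t. (D * \<tau> powr (\<beta>2 - \<beta>1)) * (indicator {\<tau>..} t * t powr (-\<beta>2)))
      ((D * \<tau> powr (\<beta>2 - \<beta>1)) * (\<tau> powr (1 - \<beta>2) / (\<beta>2 - 1)))"
    using \<beta> \<tau> by (intro has_bochner_integral_mult_right has_bochner_integral_powr_inf) auto
  let ?g = "\<lambda>t. D * (indicator {0..\<tau>} t * t powr (-\<beta>1)) + (D * \<tau> powr (\<beta>2 - \<beta>1)) * (indicator {\<tau>..} t * t powr (-\<beta>2))"
  note h = has_bochner_integral_add[OF h1 h2]
  have g: "integrable lborel ?g" using h by (simp add: has_bochner_integral_iff)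
  have le: "AE t in lborel. indicator {0..s} t *\<^sub>R f t \<le> ?g t"
    using AE_lborel_singleton[of "0::real"]
  proof eventually_elim
    case (elim t)
    show ?case
    proof (cases "t \<in> {0..s}")
      case True
      then have t: "0 < t" "t \<le> 1" using elim s by auto
      show ?thesis
      proof (cases "t \<le> \<tau>")
        case le: True
        have "0 \<le> (D * \<tau> powr (\<beta>2 - \<beta>1)) * (indicator {\<tau>..} t * t powr (-\<beta>2))" using D by simp
        then show ?thesis using f1[OF t] True le t by simp
      next
        case False
        then show ?thesis using f2[OF t] True by simp
      qed
    qed (use D in simp)
  qed
  have "(LBINT t:{0..s}. f t) \<le> integral\<^sup>L lborel ?g"
    unfolding set_lebesgue_integral_def
  proof (rule integral_mono_AE[OF _ g le])
    show "integrable lborel (\<lambda>t. indicator {0..s} t *\<^sub>R f t)"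
    proof (rule Bochner_Integration.integrable_bound[OF g])
      show "AE t in lborel. norm (indicator {0..s} t *\<^sub>R f t) \<le> norm (?g t)"
        using le by eventually_elim (use nn D in \<open>simp add: abs_mult\<close>)
    qed measurable
  qed
  also have "\<dots> = D * (\<tau> powr (1 - \<beta>1) / (1 - \<beta>1)) + (D * \<tau> powr (\<beta>2 - \<beta>1)) * (\<tau> powr (1 - \<beta>2) / (\<beta>2 - 1))"
    using h by (simp add: has_bochner_integral_iff)
  also have "\<tau> powr (\<beta>2 - \<beta>1) * \<tau> powr (1 - \<beta>2) = \<tau> powr (1 - \<beta>1)"
    by (simp add: powr_add[symmetric])
  then have "D * (\<tau> powr (1 - \<beta>1) / (1 - \<beta>1)) + (D * \<tau> powr (\<beta>2 - \<beta>1)) * (\<tau> powr (1 - \<beta>2) / (\<beta>2 - 1))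
      = D * \<tau> powr (1 - \<beta>1) * (1 / (1 - \<beta>1) + 1 / (\<beta>2 - 1))"
    by (simp add: divide_inverse distrib_left mult.assoc)
  finally show ?thesis .
qed

section \<open>Ball probabilities integrated over time\<close>

context levy
begin

definition ball_prob :: "real \<Rightarrow> real \<Rightarrow> real" where
  "ball_prob R t = prob {\<omega> \<in> space M. norm (Y t \<omega>) \<le> R}"

lemma ball_prob_measurable [measurable]: "ball_prob R \<in> borel_measurable borel"
  using prob_Y_measurable[of "{x. norm x \<le> R}"] by (simp add: ball_prob_def[abs_def])

lemma ball_prob_01: "0 \<le> ball_prob R t" "ball_prob R t \<le> 1"
  by (simp_all add: ball_prob_def)

lemma ball_prob_integrable:
  "set_integrable lborel {s..s'} (ball_prob R)"
  unfolding set_integrable_def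
  by (rule integrable_indicator_Icc_bounded[OF ball_prob_measurable ball_prob_01])

lemma ball_prob_integral_mono:
  assumes "s \<le> s'" shows "(LBINT t:{0..s}. ball_prob R t) \<le> (LBINT t:{0..s'}. ball_prob R t)"
  unfolding set_lebesgue_integral_def
  using ball_prob_integrable[unfolded set_integrable_def] ball_prob_01 assms
  by (intro integral_mono) (auto split: split_indicator)

lemma ball_prob_le:
  assumes t: "t > 0" and "\<And>x. norm x \<le> R \<Longrightarrow> P x" and [measurable]: "Measurable.pred borel P"
  shows "ball_prob R t \<le> prob {\<omega> \<in> space M. P (X t \<omega>)}"
proof -
  have [measurable]: "X t \<in> borel_measurable M" using t by (intro X_measurable) simp
  show ?thesis using assms(2) t by (auto simp: ball_prob_def intro!: finite_measure_mono)
qed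

end

context contracting_semistable
begin

lemma exp_scaling_index:
  "exp (- b * (real k * ln c)) = (c ^ k) powr (-b)"
  using c by (simp add: powr_def ln_realpow)

text \<open>Scaling by a power of \<open>c\<close> of order \<open>1 / R\<close> moves
  \<open>t\<close> below the tightness time \<open>\<delta>\<close>, and the backward flow takes the
  unit ball into one of radius \<open>C0 * R powr a\<close>, which is of order
  \<open>r\<close>.\<close>

lemma ball_prob_small_time:
  assumes L: "L > 0"
  obtains \<theta> where "0 < \<theta>" "\<theta> \<le> 1"
    "\<And>r t. 0 < r \<Longrightarrow> r \<le> 1 \<Longrightarrow> 0 < t \<Longrightarrow> t \<le> \<theta> * r powr (1 / a) \<Longrightarrow> ball_prob (L * r) t \<ge> 1 / 2"
proof -
  obtain \<delta> where \<delta>: "\<delta> > 0" "\<And>t. 0 < t \<Longrightarrow> t \<le> \<delta> \<Longrightarrow> prob {\<omega> \<in> space M. norm (X t \<omega>) \<le> 1} \<ge> 1 / 2"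
    using small_time_tight by blast
  \<comment> \<open>Absorbs the constant of the backward flow:
    \<open>C0 * \<mu> \<le> L\<close>.\<close>
  define \<mu> where "\<mu> = min 1 (L / C0)"
  have \<mu>: "0 < \<mu>" "\<mu> \<le> 1" "C0 * \<mu> \<le> L"
    using L C0 by (auto simp: \<mu>_def min_def field_simps)
  \<comment> \<open>\<open>\<delta> / c\<close> because \<open>c ^ k * R\<close> may be as large as
    \<open>c\<close>; the power of \<open>\<mu>\<close> because \<open>R\<close> is built from
    \<open>\<mu> * r\<close>.\<close>
  define \<theta> where "\<theta> = min 1 (\<delta> / c) * \<mu> powr (1 / a)"
  have \<theta>: "0 < \<theta>" "\<theta> \<le> 1"
  proof -
    show "0 < \<theta>" using \<delta> c \<mu> by (simp add: \<theta>_def)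
    have "\<mu> powr (1 / a) \<le> 1" using \<mu> a0 by (intro powr_le1) auto
    then show "\<theta> \<le> 1" unfolding \<theta>_def by (intro mult_le_one) auto
  qed
  have "ball_prob (L * r) t \<ge> 1 / 2"
    if r: "0 < r" "r \<le> 1" and t: "0 < t" "t \<le> \<theta> * r powr (1 / a)" for r t
  proof -
    have [measurable]: "X t \<in> borel_measurable M" using t by (intro X_measurable) simp
    define R where "R = (\<mu> * r) powr (1 / a)"
    have R: "0 < R" "R \<le> 1"
    proof -
      show "0 < R" using \<mu> r by (simp add: R_def)
      have "\<mu> * r \<le> 1" using \<mu> r by (intro mult_le_one) auto
      then show "R \<le> 1" unfolding R_def using \<mu> r a0 by (intro powr_le1) auto
    qed
    have Ra: "R powr a = \<mu> * r" using a0 \<mu> r by (simp add: R_def powr_powr)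
    obtain k where k: "1 \<le> c ^ k * R" "c ^ k * R \<le> c" using ex_scaling_index[OF R] .
    have ck: "c ^ k > 0" using c by simp
    have tR: "t \<le> \<delta> / c * R"
    proof -
      have "t \<le> min 1 (\<delta> / c) * R" using t \<mu> r by (simp add: \<theta>_def R_def powr_mult ac_simps)
      also have "\<dots> \<le> \<delta> / c * R" using R by (intro mult_right_mono) auto
      finally show ?thesis .
    qed
    have "c ^ k * t \<le> c ^ k * (\<delta> / c * R)" using tR ck by (intro mult_left_mono) auto
    also have "\<dots> = \<delta> / c * (c ^ k * R)" by simp
    also have "\<dots> \<le> \<delta> / c * c" using k \<delta> c by (intro mult_left_mono) auto
    finally have "c ^ k * t \<le> \<delta>" using c by simp
    then have "1 / 2 \<le> prob {\<omega> \<in> space M. norm (X (c ^ k * t) \<omega>) \<le> 1}" using t ck by (intro \<delta>) auto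
    also have "\<dots> = prob {\<omega> \<in> space M. norm (flow E (real k * ln c) (X t \<omega>)) \<le> 1}"
      using t by (intro prob_scaling) auto
    also have "\<dots> \<le> prob {\<omega> \<in> space M. norm (X t \<omega>) \<le> L * r}"
    proof (rule finite_measure_mono)
      show "{\<omega> \<in> space M. norm (flow E (real k * ln c) (X t \<omega>)) \<le> 1} \<subseteq> {\<omega> \<in> space M. norm (X t \<omega>) \<le> L * r}"
      proof clarsimp
        fix \<omega> assume w: "norm (flow E (real k * ln c) (X t \<omega>)) \<le> 1"
        have "norm (X t \<omega>) = norm (flow E (- (real k * ln c)) (flow E (real k * ln c) (X t \<omega>)))"
          by (simp add: flow_add[OF lin, symmetric] flow_0[OF lin])
        also have "\<dots> \<le> C0 * exp (- a * (real k * ln c)) * norm (flow E (real k * ln c) (X t \<omega>))"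
          using c by (intro flow_back) simp
        also have "\<dots> \<le> C0 * exp (- a * (real k * ln c)) * 1"
          using w C0 by (intro mult_left_mono) auto
        also have "\<dots> = C0 * (c ^ k) powr (-a)" by (simp only: exp_scaling_index mult_1_right)
        also have "(c ^ k) powr (-a) \<le> (1 / R) powr (-a)"
          using k R a0 by (intro powr_mono2') (auto simp: field_simps)
        also have "(1 / R) powr (-a) = \<mu> * r" using R Ra by (simp add: powr_minus powr_divide)
        finally have "norm (X t \<omega>) \<le> (C0 * \<mu>) * r" using C0 by (simp add: mult_left_mono mult.assoc)
        also have "\<dots> \<le> L * r" using \<mu> r by (intro mult_right_mono) auto
        finally show "norm (X t \<omega>) \<le> L * r" .
      qed
    qed measurable
    finally show ?thesis using t by (simp add: ball_prob_def)
  qed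
  then show ?thesis using that \<theta> by blast
qed

lemma sojourn_lower_1:
  assumes L: "L > 0"
  obtains K where "K > 0" "\<And>r s. 0 < r \<Longrightarrow> r \<le> 1 \<Longrightarrow> r powr (1 / a) \<le> s \<Longrightarrow>
    K * r powr (1 / a) \<le> (LBINT t:{0..s}. ball_prob (L * r) t)"
proof -
  obtain \<theta> where \<theta>: "0 < \<theta>" "\<theta> \<le> 1"
    "\<And>r t. 0 < r \<Longrightarrow> r \<le> 1 \<Longrightarrow> 0 < t \<Longrightarrow> t \<le> \<theta> * r powr (1 / a) \<Longrightarrow> ball_prob (L * r) t \<ge> 1 / 2"
    using ball_prob_small_time[OF L] by blast
  have "(\<theta> / 2) * r powr (1 / a) \<le> (LBINT t:{0..s}. ball_prob (L * r) t)"
    if r: "0 < r" "r \<le> 1" and s: "r powr (1 / a) \<le> s" for r s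
  proof -
    let ?\<tau> = "\<theta> * r powr (1 / a)"
    have \<tau>: "?\<tau> \<ge> 0" using \<theta> by simp
    have "(\<theta> / 2) * r powr (1 / a) = (LINT t|lborel. (1 / 2) * indicator {0..?\<tau>} t)"
      using \<tau> by simp
    also have "\<dots> \<le> (LINT t|lborel. indicator {0..?\<tau>} t *\<^sub>R ball_prob (L * r) t)"
    proof (rule integral_mono_AE)
      show "integrable lborel (\<lambda>t. (1 / 2) * indicator {0..?\<tau>} t :: real)"
        by (intro integrable_mult_right integrable_real_indicator) (auto simp: emeasure_lborel_Icc_eq)
      show "integrable lborel (\<lambda>t. indicator {0..?\<tau>} t *\<^sub>R ball_prob (L * r) t)"
        using ball_prob_integrable unfolding set_integrable_def .
      show "AE t in lborel. (1 / 2) * indicator {0..?\<tau>} t \<le> indicator {0..?\<tau>} t *\<^sub>R ball_prob (L * r) t"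
        using AE_lborel_singleton[of "0::real"]
      proof eventually_elim
        case (elim t)
        then show ?case using \<theta>(3)[OF r, of t] by (cases "t \<in> {0..?\<tau>}") auto
      qed
    qed
    also have "\<dots> \<le> (LBINT t:{0..s}. ball_prob (L * r) t)"
    proof -
      have "?\<tau> \<le> 1 * r powr (1 / a)" using \<theta> by (intro mult_right_mono) auto
      then show ?thesis using ball_prob_integral_mono[of ?\<tau> s "L * r"] s
        by (simp add: set_lebesgue_integral_def)
    qed
    finally show ?thesis .
  qed
  then show ?thesis using that[of "\<theta> / 2"] \<theta> by simp
qed

lemma ball_prob_line:
  assumes e: "\<And>y. u \<bullet> E y = b * (u \<bullet> y)" and b: "b \<ge> 0" and dual: "u \<bullet> x = 1"
  obtains K where "K > 0" "\<And>t R. 0 < t \<Longrightarrow> t \<le> 1 \<Longrightarrow> 0 < R \<Longrightarrow> ball_prob R t \<le> K * R * t powr (-b)"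
proof -
  obtain K where K: "K > 0" "\<And>t \<epsilon> y. 0 < t \<Longrightarrow> 0 < \<epsilon> \<Longrightarrow>
    prob {\<omega> \<in> space M. \<bar>u \<bullet> X t \<omega> - y\<bar> \<le> \<epsilon>} \<le> K * \<epsilon> * (min t 1) powr (-b)"
    using small_ball[OF e b dual] by blast
  have u: "norm u > 0" using dual by auto
  have "ball_prob R t \<le> (K * norm u) * R * t powr (-b)" if t: "0 < t" "t \<le> 1" and R: "0 < R" for t R
  proof -
    have "ball_prob R t \<le> prob {\<omega> \<in> space M. \<bar>u \<bullet> X t \<omega> - 0\<bar> \<le> norm u * R}"
    proof (rule ball_prob_le[OF t(1)])
      fix y assume "norm (y :: real^'n) \<le> R"
      then have "norm u * norm y \<le> norm u * R" by (intro mult_left_mono) auto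
      then show "\<bar>u \<bullet> y - 0\<bar> \<le> norm u * R" using Cauchy_Schwarz_ineq2[of u y] by simp
    qed measurable
    also have "\<dots> \<le> K * (norm u * R) * (min t 1) powr (-b)" using t u R by (intro K(2)) auto
    finally show ?thesis using t by (simp add: min_def mult.assoc split: if_splits)
  qed
  then show ?thesis using that[of "K * norm u"] K u by simp
qed

lemma ball_prob_plane:
  assumes e1: "\<And>y. u1 \<bullet> E y = b1 * (u1 \<bullet> y)" and e2: "\<And>y. u2 \<bullet> E y = b2 * (u2 \<bullet> y)"
    and b: "b1 \<ge> 0" "b2 \<ge> 0"
    and dual: "u1 \<bullet> x1 = 1" "u1 \<bullet> x2 = 0" "u2 \<bullet> x1 = 0" "u2 \<bullet> x2 = 1"
  obtains K where "K > 0" "\<And>t R. 0 < t \<Longrightarrow> t \<le> 1 \<Longrightarrow> 0 < R \<Longrightarrow> ball_prob R t \<le> K * R\<^sup>2 * t powr (- (b1 + b2))"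
proof -
  obtain K where K: "K > 0" "\<And>t \<epsilon>. 0 < t \<Longrightarrow> t \<le> 1 \<Longrightarrow> 0 < \<epsilon> \<Longrightarrow>
    prob {\<omega> \<in> space M. \<bar>u1 \<bullet> X t \<omega>\<bar> \<le> \<epsilon> \<and> \<bar>u2 \<bullet> X t \<omega>\<bar> \<le> \<epsilon>} \<le> K * \<epsilon>\<^sup>2 * t powr (- (b1 + b2))"
    using small_ball_pair[OF e1 e2 b dual] by blast
  define N where "N = max (norm u1) (norm u2)"
  have N: "N > 0" "norm u1 \<le> N" "norm u2 \<le> N" using dual by (auto simp: N_def less_max_iff_disj)
  have "ball_prob R t \<le> (K * N\<^sup>2) * R\<^sup>2 * t powr (- (b1 + b2))" if t: "0 < t" "t \<le> 1" and R: "0 < R" for t R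
  proof -
    have "ball_prob R t \<le> prob {\<omega> \<in> space M. \<bar>u1 \<bullet> X t \<omega>\<bar> \<le> N * R \<and> \<bar>u2 \<bullet> X t \<omega>\<bar> \<le> N * R}"
    proof (rule ball_prob_le[OF t(1)])
      fix y assume y: "norm (y :: real^'n) \<le> R"
      have "norm u1 * norm y \<le> N * R" "norm u2 * norm y \<le> N * R" using N y by (intro mult_mono; simp)+
      then show "\<bar>u1 \<bullet> y\<bar> \<le> N * R \<and> \<bar>u2 \<bullet> y\<bar> \<le> N * R"
        using Cauchy_Schwarz_ineq2[of u1 y] Cauchy_Schwarz_ineq2[of u2 y] by linarith
    qed measurable
    also have "\<dots> \<le> K * (N * R)\<^sup>2 * t powr (- (b1 + b2))" using t N R by (intro K(2)) auto
    finally show ?thesis by (simp add: power_mult_distrib mult.assoc)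
  qed
  then show ?thesis using that[of "K * N\<^sup>2"] K N by simp
qed

text \<open>Below \<open>n \<in> {1, 2}\<close> is the number of independent eigenfunctionals for the eigenvalue \<open>a\<close>.\<close>

lemma sojourn_upper_1:
  assumes bound: "K > 0" "\<And>t R. 0 < t \<Longrightarrow> t \<le> 1 \<Longrightarrow> 0 < R \<Longrightarrow> ball_prob R t \<le> K * R ^ n * t powr (- (real n * a))"
    and n: "real n * a > 1" and L: "L > 0"
  obtains K' where "K' > 0" "\<And>r s. 0 < r \<Longrightarrow> r \<le> 1 \<Longrightarrow> s \<le> 1 \<Longrightarrow>
    (LBINT t:{0..s}. ball_prob (L * r) t) \<le> K' * r powr (1 / a)"
proof -
  define D where "D = max 1 (K * L ^ n)"
  have D: "D \<ge> 1" "K * L ^ n \<le> D" by (auto simp: D_def)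
  have "(LBINT t:{0..s}. ball_prob (L * r) t) \<le> (D * (1 + 1 / (real n * a - 1))) * r powr (1 / a)"
    if r: "0 < r" "r \<le> 1" and s: "s \<le> 1" for r s
  proof -
    define \<tau> where "\<tau> = r powr (1 / a)"
    have \<tau>: "\<tau> > 0" using r by (simp add: \<tau>_def)
    have \<tau>n: "\<tau> powr (real n * a - 0) = r ^ n"
      using a0 r by (simp add: \<tau>_def powr_powr powr_realpow)
    \<comment> \<open>Below \<open>\<tau>\<close> the trivial bound 1 is used, as a power of
      \<open>t\<close> with exponent 0; this is why \<open>D\<close> is at least 1.\<close>
    have "(LBINT t:{0..s}. ball_prob (L * r) t) \<le> D * \<tau> powr (1 - 0) * (1 / (1 - 0) + 1 / (real n * a - 1))"
    proof (rule occupation_upper_integral[OF ball_prob_measurable ball_prob_01(1) _ n \<tau> _ s])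
      fix t :: real assume t: "0 < t" "t \<le> 1"
      show "ball_prob (L * r) t \<le> D * t powr (- 0)"
        using ball_prob_01(2)[of "L * r" t] D t by simp
      have "ball_prob (L * r) t \<le> K * (L * r) ^ n * t powr (- (real n * a))"
        using t L r by (intro bound) auto
      also have "\<dots> = (K * L ^ n) * (r ^ n * t powr (- (real n * a)))"
        by (simp add: power_mult_distrib)
      also have "\<dots> \<le> D * (r ^ n * t powr (- (real n * a)))"
        using D r by (intro mult_right_mono) auto
      finally show "ball_prob (L * r) t \<le> D * \<tau> powr (real n * a - 0) * t powr (- (real n * a))"
        unfolding \<tau>n by (simp add: mult.assoc)
    qed (use D in auto)
    then show ?thesis using \<tau> by (simp add: \<tau>_def ac_simps)
  qed
  moreover have "D * (1 + 1 / (real n * a - 1)) > 0" using D n by (intro mult_pos_pos add_pos_pos) auto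
  ultimately show ?thesis using that by blast
qed

text \<open>Before \<open>r powr (1 / b2)\<close> the \<open>u1\<close> coordinate alone gives the
  bound, with a singularity at 0 that is integrable as \<open>b1 < 1\<close>. Afterwards the second
  coordinate adds decay, and the tail is integrable as \<open>b1 + b2 > 1\<close>, which follows
  from \<open>b1 > 1 / 2\<close>.\<close>

lemma sojourn_upper_2:
  assumes e1: "\<And>y. u1 \<bullet> E y = b1 * (u1 \<bullet> y)" and e2: "\<And>y. u2 \<bullet> E y = b2 * (u2 \<bullet> y)"
    and b: "1 / 2 < b1" "b1 < 1" "b1 < b2"
    and dual: "u1 \<bullet> x1 = 1" "u1 \<bullet> x2 = 0" "u2 \<bullet> x1 = 0" "u2 \<bullet> x2 = 1" and L: "L > 0"
  obtains K where "K > 0" "\<And>r s. 0 < r \<Longrightarrow> r \<le> 1 \<Longrightarrow> s \<le> 1 \<Longrightarrow>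
    (LBINT t:{0..s}. ball_prob (L * r) t) \<le> K * r powr (1 + (1 / b2) * (1 - b1))"
proof -
  obtain K1 where K1: "K1 > 0"
    "\<And>t R. 0 < t \<Longrightarrow> t \<le> 1 \<Longrightarrow> 0 < R \<Longrightarrow> ball_prob R t \<le> K1 * R * t powr (-b1)"
    using ball_prob_line[OF e1 _ dual(1)] b by (metis less_eq_real_def less_trans half_gt_zero zero_less_one)
  obtain K2 where K2: "K2 > 0"
    "\<And>t R. 0 < t \<Longrightarrow> t \<le> 1 \<Longrightarrow> 0 < R \<Longrightarrow> ball_prob R t \<le> K2 * R\<^sup>2 * t powr (- (b1 + b2))"
  proof (rule ball_prob_plane[OF e1 e2 _ _ dual])
    show "0 \<le> b1" "0 \<le> b2" using b by auto
  qed (use that in blast)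
  define D where "D = max (K1 * L) (K2 * L\<^sup>2)"
  have D: "D > 0" "K1 * L \<le> D" "K2 * L\<^sup>2 \<le> D" using K1 L by (auto simp: D_def less_max_iff_disj)
  define G where "G = 1 / (1 - b1) + 1 / (b1 + b2 - 1)"
  have G: "G > 0" using b by (simp add: G_def add_pos_pos)
  have "(LBINT t:{0..s}. ball_prob (L * r) t) \<le> (D * G) * r powr (1 + (1 / b2) * (1 - b1))"
    if r: "0 < r" "r \<le> 1" and s: "s \<le> 1" for r s
  proof -
    define \<tau> where "\<tau> = r powr (1 / b2)"
    have \<tau>: "\<tau> > 0" using r by (simp add: \<tau>_def)
    have \<tau>2: "\<tau> powr (b1 + b2 - b1) = r" using b r by (simp add: \<tau>_def powr_powr)
    have "(LBINT t:{0..s}. ball_prob (L * r) t) \<le> (D * r) * \<tau> powr (1 - b1) * (1 / (1 - b1) + 1 / (b1 + b2 - 1))"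
    proof (rule occupation_upper_integral[OF ball_prob_measurable ball_prob_01(1) b(2) _ \<tau> _ s])
      fix t :: real assume t: "0 < t" "t \<le> 1"
      have "ball_prob (L * r) t \<le> K1 * (L * r) * t powr (-b1)" using t L r by (intro K1) auto
      also have "\<dots> = (K1 * L) * (r * t powr (-b1))" by simp
      also have "\<dots> \<le> D * (r * t powr (-b1))" using D r by (intro mult_right_mono) auto
      finally show "ball_prob (L * r) t \<le> D * r * t powr (-b1)" by (simp add: mult.assoc)
      have "ball_prob (L * r) t \<le> K2 * (L * r)\<^sup>2 * t powr (- (b1 + b2))" using t L r by (intro K2) auto
      also have "\<dots> = (K2 * L\<^sup>2) * (r * r * t powr (- (b1 + b2)))" by (simp add: power2_eq_square)
      also have "\<dots> \<le> D * (r * r * t powr (- (b1 + b2)))" using D r by (intro mult_right_mono) auto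
      finally show "ball_prob (L * r) t \<le> D * r * \<tau> powr (b1 + b2 - b1) * t powr (- (b1 + b2))"
        unfolding \<tau>2 by (simp add: mult.assoc)
    qed (use D b r in auto)
    also have "\<dots> = (D * G) * (r powr 1 * r powr ((1 / b2) * (1 - b1)))"
      using r by (simp add: \<tau>_def powr_powr G_def)
    finally show ?thesis by (simp only: powr_add)
  qed
  then show ?thesis using that[of "D * G"] D G by simp
qed

text \<open>\<open>occupation_lower\<close> is applied to the process run faster by
  \<open>q\<close>. Undoing the scaling brings points of norm at most \<open>C1\<close> back to size
  \<open>r\<close> in the fast directions, while the bound \<open>\<eta>\<close> on the
  \<open>u1\<close> coordinate controls the slow one.\<close>

lemma sojourn_lower_2:
  assumes e1: "\<And>y. u1 \<bullet> E y = b1 * (u1 \<bullet> y)" and dual: "u1 \<bullet> x1 = 1"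
    and b: "0 < b1" "b1 < 1" "b1 < b2" and C: "C > 0" and L: "L > 0"
    and dec: "\<And>t x. t \<ge> 0 \<Longrightarrow> norm (flow E (-t) x) \<le> exp (- b1 * t) * \<bar>u1 \<bullet> x\<bar> + C * exp (- b2 * t) * norm x"
  obtains K where "K > 0" "\<And>r s. 0 < r \<Longrightarrow> r \<le> 1 \<Longrightarrow> r powr (1 / b2) \<le> s \<Longrightarrow>
    K * r powr (1 + (1 / b2) * (1 - b1)) \<le> (LBINT t:{0..s}. ball_prob (L * r) t)"
proof -
  let ?\<rho> = "1 + (1 / b2) * (1 - b1)"
  obtain C1 \<kappa> where C1: "C1 > 0" "\<kappa> > 0" "\<And>\<eta>. 0 < \<eta> \<Longrightarrow> \<eta> \<le> 1 \<Longrightarrow>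
    (LBINT t:{0..C1}. prob {\<omega> \<in> space M. \<bar>u1 \<bullet> Y t \<omega>\<bar> \<le> \<eta> \<and> norm (Y t \<omega>) \<le> C1}) \<ge> \<kappa> * \<eta>"
    using occupation_lower[OF e1 less_imp_le[OF b(1)] b(2) dual] by blast
  \<comment> \<open>The three bounds ensure in turn that \<open>R \<le> 1\<close>, that the rescaled
    time window \<open>C1 / q\<close> ends before \<open>s\<close>, and that the fast components
    fill at most half of the ball.\<close>
  define \<mu> where "\<mu> = min (min 1 ((1 / C1) powr b2)) (L / (2 * C * C1))"
  have \<mu>: "0 < \<mu>" "\<mu> \<le> 1" "\<mu> powr (1 / b2) * C1 \<le> 1" "C * C1 * \<mu> \<le> L / 2"
  proof -
    show "0 < \<mu>" using C1 C L by (simp add: \<mu>_def)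
    show "\<mu> \<le> 1" by (simp add: \<mu>_def)
    have "\<mu> powr (1 / b2) \<le> ((1 / C1) powr b2) powr (1 / b2)"
      using \<open>0 < \<mu>\<close> b by (intro powr_mono2) (auto simp: \<mu>_def)
    also have "\<dots> = 1 / C1" using b C1 by (simp add: powr_powr)
    finally show "\<mu> powr (1 / b2) * C1 \<le> 1" using C1 by (simp add: field_simps)
    have "\<mu> \<le> L / (2 * C * C1)" by (simp add: \<mu>_def)
    then show "C * C1 * \<mu> \<le> L / 2" using C C1 by (simp add: field_simps)
  qed
  \<comment> \<open>One entry for each case of the minimum that defines \<open>\<eta>\<close>
    below.\<close>
  define K where "K = min (\<kappa> * (L / 2) * (\<mu> powr (1 / b2) / c) powr (1 - b1)) (\<kappa> * \<mu> powr (1 / b2) / c)"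
  have K: "K > 0" using C1 L \<mu> c by (simp add: K_def)
  have "K * r powr ?\<rho> \<le> (LBINT t:{0..s}. ball_prob (L * r) t)"
    if r: "0 < r" "r \<le> 1" and s: "r powr (1 / b2) \<le> s" for r s
  proof -
    define R where "R = (\<mu> * r) powr (1 / b2)"
    have R: "0 < R" "R \<le> 1"
    proof -
      show "0 < R" using \<mu> r by (simp add: R_def)
      have "\<mu> * r \<le> 1" using \<mu> r by (intro mult_le_one) auto
      then show "R \<le> 1" unfolding R_def using \<mu> r b by (intro powr_le1) auto
    qed
    have Req: "R = \<mu> powr (1 / b2) * r powr (1 / b2)" using \<mu> r by (simp add: R_def powr_mult)
    have Rb: "R powr b2 = \<mu> * r" using b \<mu> r by (simp add: R_def powr_powr)
    obtain k where k: "1 \<le> c ^ k * R" "c ^ k * R \<le> c" using ex_scaling_index[OF R] .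
    define q where "q = c ^ k"
    have q: "q > 0" "1 / q \<le> R" "R / c \<le> 1 / q"
    proof -
      show q0: "q > 0" using c by (simp add: q_def)
      show "1 / q \<le> R" using k(1) q0 by (simp add: q_def[symmetric] field_simps)
      show "R / c \<le> 1 / q" using k(2) q0 c by (simp add: q_def[symmetric] field_simps)
    qed
    \<comment> \<open>Capped at 1, the range in which \<open>occupation_lower\<close> applies; the
      other entry leaves the second half of the ball to the \<open>u1\<close> coordinate.\<close>
    define \<eta> where "\<eta> = min 1 (q powr b1 * (L / 2 * r))"
    have \<eta>: "0 < \<eta>" "\<eta> \<le> 1" "\<eta> \<le> q powr b1 * (L / 2 * r)" using q L r by (auto simp: \<eta>_def)
    define g where "g t = prob {\<omega> \<in> space M. \<bar>u1 \<bullet> Y t \<omega>\<bar> \<le> \<eta> \<and> norm (Y t \<omega>) \<le> C1}" for t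
    have gm [measurable]: "g \<in> borel_measurable borel"
      using prob_Y_measurable[of "{x. \<bar>u1 \<bullet> x\<bar> \<le> \<eta> \<and> norm x \<le> C1}"] by (simp add: g_def[abs_def])
    have g_le: "g v \<le> ball_prob (L * r) (v / q)" if v: "v \<ge> 0" for v
    proof -
      have t: "v / q \<ge> 0" using v q by simp
      have [measurable]: "X (v / q) \<in> borel_measurable M" using t by (rule X_measurable)
      have "g v = prob {\<omega> \<in> space M. \<bar>u1 \<bullet> X (c ^ k * (v / q)) \<omega>\<bar> \<le> \<eta> \<and> norm (X (c ^ k * (v / q)) \<omega>) \<le> C1}"
        using v q c by (simp add: g_def q_def)
      also have "\<dots> = prob {\<omega> \<in> space M. \<bar>u1 \<bullet> flow E (real k * ln c) (X (v / q) \<omega>)\<bar> \<le> \<eta> \<and>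
          norm (flow E (real k * ln c) (X (v / q) \<omega>)) \<le> C1}"
        by (rule prob_scaling[OF t, of "\<lambda>x. \<bar>u1 \<bullet> x\<bar> \<le> \<eta> \<and> norm x \<le> C1"]) measurable
      also have "\<dots> \<le> prob {\<omega> \<in> space M. norm (X (v / q) \<omega>) \<le> L * r}"
      proof (rule finite_measure_mono)
        show "{\<omega> \<in> space M. \<bar>u1 \<bullet> flow E (real k * ln c) (X (v / q) \<omega>)\<bar> \<le> \<eta> \<and>
          norm (flow E (real k * ln c) (X (v / q) \<omega>)) \<le> C1} \<subseteq> {\<omega> \<in> space M. norm (X (v / q) \<omega>) \<le> L * r}"
        proof clarsimp
          fix \<omega>
          define z where "z = flow E (real k * ln c) (X (v / q) \<omega>)"
          assume "\<bar>u1 \<bullet> flow E (real k * ln c) (X (v / q) \<omega>)\<bar> \<le> \<eta>"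
            "norm (flow E (real k * ln c) (X (v / q) \<omega>)) \<le> C1"
          then have z: "\<bar>u1 \<bullet> z\<bar> \<le> \<eta>" "norm z \<le> C1" by (simp_all add: z_def)
          have "X (v / q) \<omega> = flow E (- (real k * ln c)) z"
            by (simp add: z_def flow_add[OF lin, symmetric] flow_0[OF lin])
          then have "norm (X (v / q) \<omega>) \<le> exp (- b1 * (real k * ln c)) * \<bar>u1 \<bullet> z\<bar> + C * exp (- b2 * (real k * ln c)) * norm z"
            using dec[of "real k * ln c" z] c by simp
          also have "\<dots> = q powr (-b1) * \<bar>u1 \<bullet> z\<bar> + C * q powr (-b2) * norm z"
            by (simp only: exp_scaling_index q_def)
          also have "\<dots> \<le> q powr (-b1) * (q powr b1 * (L / 2 * r)) + C * (\<mu> * r) * C1"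
          proof (intro add_mono mult_mono)
            show "\<bar>u1 \<bullet> z\<bar> \<le> q powr b1 * (L / 2 * r)" using z \<eta> by simp
            have "q powr (-b2) = (1 / q) powr b2" using q by (simp add: powr_minus powr_divide inverse_eq_divide)
            also have "\<dots> \<le> R powr b2" using q b by (intro powr_mono2) auto
            finally show "q powr (-b2) \<le> \<mu> * r" using Rb by simp
          qed (use z C \<mu> r L in auto)
          also have "q powr (-b1) * (q powr b1 * (L / 2 * r)) = L / 2 * r"
            using q by (simp add: powr_minus field_simps)
          also have "C * (\<mu> * r) * C1 = (C * C1 * \<mu>) * r" by simp
          also have "L / 2 * r + \<dots> \<le> L / 2 * r + L / 2 * r"
            using \<mu>(4) r by (intro add_left_mono mult_right_mono) auto
          finally show "norm (X (v / q) \<omega>) \<le> L * r" by (simp add: field_simps)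
        qed
      qed measurable
      finally show ?thesis using t by (simp add: ball_prob_def)
    qed
    have "(1 / q) * (\<kappa> * \<eta>) \<le> (1 / q) * (LBINT v:{0..C1}. g v)"
      unfolding g_def using q by (intro mult_left_mono C1(3) \<eta>) auto
    also have "\<dots> \<le> (1 / q) * (LINT v|lborel. indicator {0..C1} v *\<^sub>R ball_prob (L * r) (v / q))"
    proof (rule mult_left_mono)
      have [measurable]: "(\<lambda>v. ball_prob (L * r) (v / q)) \<in> borel_measurable borel"
        by (rule measurable_compose[OF _ ball_prob_measurable]) measurable
      show "(LBINT v:{0..C1}. g v) \<le> (LINT v|lborel. indicator {0..C1} v *\<^sub>R ball_prob (L * r) (v / q))"
        unfolding set_lebesgue_integral_def
      proof (rule integral_mono)
        show "integrable lborel (\<lambda>v. indicator {0..C1} v *\<^sub>R g v)"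
          by (rule integrable_indicator_Icc_bounded[OF gm]) (simp_all add: g_def)
        show "integrable lborel (\<lambda>v. indicator {0..C1} v *\<^sub>R ball_prob (L * r) (v / q))"
          by (rule integrable_indicator_Icc_bounded) (measurable, rule ball_prob_01, rule ball_prob_01)
        show "indicator {0..C1} v *\<^sub>R g v \<le> indicator {0..C1} v *\<^sub>R ball_prob (L * r) (v / q)" for v
          using g_le[of v] by (auto split: split_indicator)
      qed
    qed (use q in simp)
    also have "\<dots> = (LINT t|lborel. indicator {0..C1 / q} t *\<^sub>R ball_prob (L * r) t)"
    proof -
      have "(LINT v|lborel. indicator {0..C1} v *\<^sub>R ball_prob (L * r) (v / q))
          = \<bar>q\<bar> *\<^sub>R (LINT t|lborel. indicator {0..C1} (0 + q * t) *\<^sub>R ball_prob (L * r) ((0 + q * t) / q))"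
        by (rule lborel_integral_real_affine) (use q in simp)
      also have "(\<lambda>t. indicator {0..C1} (0 + q * t) *\<^sub>R ball_prob (L * r) ((0 + q * t) / q))
          = (\<lambda>t. indicator {0..C1 / q} t *\<^sub>R ball_prob (L * r) t)"
        using q by (auto simp: fun_eq_iff indicator_def field_simps zero_le_mult_iff)
      finally show ?thesis using q by simp
    qed
    also have "\<dots> \<le> (LBINT t:{0..s}. ball_prob (L * r) t)"
    proof -
      have "C1 / q \<le> C1 * R" using q C1 mult_left_mono[OF q(2), of C1] by simp
      also have "\<dots> = (\<mu> powr (1 / b2) * C1) * r powr (1 / b2)" by (simp add: Req)
      also have "\<dots> \<le> 1 * r powr (1 / b2)" using \<mu> by (intro mult_right_mono) auto
      finally show ?thesis using ball_prob_integral_mono[of "C1 / q" s "L * r"] s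
        by (simp add: set_lebesgue_integral_def)
    qed
    finally have lower: "(1 / q) * (\<kappa> * \<eta>) \<le> (LBINT t:{0..s}. ball_prob (L * r) t)" .
    have "K * r powr ?\<rho> \<le> (1 / q) * (\<kappa> * \<eta>)"
    proof (cases "q powr b1 * (L / 2 * r) \<le> 1")
      case True
      have \<rho>: "r powr ?\<rho> = r * (r powr (1 / b2)) powr (1 - b1)"
        using r by (simp only: powr_add powr_powr) simp
      have "K * r powr ?\<rho> \<le> \<kappa> * (L / 2) * (\<mu> powr (1 / b2) / c) powr (1 - b1) * r powr ?\<rho>"
        unfolding K_def by (intro mult_right_mono min.cobounded1) simp
      also have "\<dots> = \<kappa> * (L / 2) * r * (R / c) powr (1 - b1)"
        unfolding \<rho> Req powr_mult powr_divide by simp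
      also have "\<dots> \<le> \<kappa> * (L / 2) * r * (1 / q) powr (1 - b1)"
        using C1 L r q R c b by (intro mult_left_mono powr_mono2) auto
      also have "(1 / q) powr (1 - b1) = (1 / q) * q powr b1"
      proof -
        have "(1 / q) powr (1 - b1) = (1 / q) powr (1 + - b1)" by simp
        also have "\<dots> = (1 / q) powr 1 * (1 / q) powr (-b1)" by (rule powr_add)
        also have "\<dots> = (1 / q) * q powr b1" using q by (simp add: powr_minus powr_divide)
        finally show ?thesis .
      qed
      also have "\<kappa> * (L / 2) * r * ((1 / q) * q powr b1) = (1 / q) * (\<kappa> * \<eta>)"
        using True by (simp add: \<eta>_def ac_simps)
      finally show ?thesis .
    next
      \<comment> \<open>Here \<open>\<eta> = 1\<close> and the time gained is of order
        \<open>r powr (1 / b2)\<close>, which is enough since \<open>1 / b2 \<le> ?\<rho>\<close>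
        and \<open>r \<le> 1\<close>.\<close>
      case False
      have "K * r powr ?\<rho> \<le> (\<kappa> * \<mu> powr (1 / b2) / c) * r powr (1 / b2)"
      proof (intro mult_mono)
        have "1 / b2 \<le> ?\<rho>" using b by (simp add: field_simps)
        then show "r powr ?\<rho> \<le> r powr (1 / b2)" using r by (intro powr_mono') auto
      qed (use C1 \<mu> c in \<open>auto simp: K_def\<close>)
      also have "\<dots> = \<kappa> * (R / c)" by (simp add: Req)
      also have "\<dots> \<le> \<kappa> * (1 / q)" using q C1 by (intro mult_left_mono) auto
      finally show ?thesis using False by (simp add: \<eta>_def)
    qed
    then show ?thesis using lower by linarith
  qed
  then show ?thesis using that K by blast
qed

end

section \<open>Comparison of inner products and assembly\<close>

lemma inner_product_norm_equiv:
  assumes ip: "is_inner_product (ip :: real^'n \<Rightarrow> real^'n \<Rightarrow> real)"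
  obtains l L where "0 < l" "0 < L" "\<And>r. {x. norm x \<le> l * r} \<subseteq> ip_cball ip r"
    "\<And>r. ip_cball ip r \<subseteq> {x. norm x \<le> L * r}" "\<And>r. ip_cball ip r \<in> sets borel"
proof -
  have bil: "bilinear ip" and pos: "\<And>x. x \<noteq> 0 \<Longrightarrow> ip x x > 0"
    using ip by (auto simp: is_inner_product_def)
  obtain B where B: "B > 0" "\<And>x y. norm (ip x y) \<le> B * norm x * norm y"
    using bilinear_bounded_pos[OF bil] by blast
  have cont: "continuous_on S (\<lambda>x. ip x x)" for S
    by (rule bounded_bilinear.continuous_on[OF bil[unfolded bilinear_conv_bounded_bilinear]
      continuous_on_id continuous_on_id])
  have meas: "ip_cball ip r \<in> sets borel" for r
  proof -
    have "closed {x. sqrt (ip x x) \<le> r}"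
      by (intro closed_Collect_le continuous_intros cont)
    then show ?thesis by (simp add: ip_cball_def)
  qed
  have hom: "ip (k *\<^sub>R x) (k *\<^sub>R x) = k\<^sup>2 * ip x x" for k and x :: "real^'n"
    using bil by (simp add: bilinear_lmul bilinear_rmul power2_eq_square)
  have "sphere 0 1 \<noteq> ({} :: (real^'n) set)"
    by simp
  \<comment> \<open>Homogeneity reduces the lower comparison to the Euclidean unit sphere, where
    compactness provides a positive minimum.\<close>
  then obtain w :: "real^'n" where w: "w \<in> sphere 0 1" "\<And>x. x \<in> sphere 0 1 \<Longrightarrow> ip w w \<le> ip x x"
    using continuous_attains_inf[OF compact_sphere _ cont] by blast
  define m where "m = ip w w"
  have "w \<noteq> 0" using w(1) by auto
  then have m: "m > 0" using pos by (simp add: m_def)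
  have low: "m * (norm x)\<^sup>2 \<le> ip x x" for x :: "real^'n"
  proof (cases "x = 0")
    case False
    then have "m \<le> ip (x /\<^sub>R norm x) (x /\<^sub>R norm x)" unfolding m_def by (intro w) simp
    then show ?thesis using False by (simp only: hom) (simp add: power_inverse field_simps)
  next
    case True
    then show ?thesis using hom[of 0 0] by simp
  qed
  have up: "ip x x \<le> B * (norm x)\<^sup>2" for x :: "real^'n"
    using B(2)[of x x] by (simp add: power2_eq_square mult.assoc)
  show ?thesis
  proof (rule that[OF _ _ _ _ meas])
    show "0 < 1 / sqrt B" "0 < 1 / sqrt m" using B m by simp_all
    fix r
    show "{x. norm x \<le> 1 / sqrt B * r} \<subseteq> ip_cball ip r"
    proof
      fix x :: "real^'n" assume "x \<in> {x. norm x \<le> 1 / sqrt B * r}"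
      then have "sqrt B * norm x \<le> r" using B by (simp add: field_simps)
      moreover have "sqrt (ip x x) \<le> sqrt (B * (norm x)\<^sup>2)" by (intro real_sqrt_le_mono up)
      ultimately show "x \<in> ip_cball ip r" by (simp add: ip_cball_def real_sqrt_mult)
    qed
    show "ip_cball ip r \<subseteq> {x. norm x \<le> 1 / sqrt m * r}"
    proof
      fix x assume "x \<in> ip_cball ip r"
      moreover have "sqrt (m * (norm x)\<^sup>2) \<le> sqrt (ip x x)" by (intro real_sqrt_le_mono low)
      ultimately have "sqrt m * norm x \<le> r" by (simp add: ip_cball_def real_sqrt_mult)
      then show "x \<in> {x. norm x \<le> 1 / sqrt m * r}" using m by (simp add: field_simps)
    qed
  qed
qed

lemma (in levy) expectation_sojourn_time_bounds:
  assumes s: "s \<ge> 0" and B: "ip_cball ip r \<in> sets borel"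
    and l: "{x. norm x \<le> l * r} \<subseteq> ip_cball ip r" and L: "ip_cball ip r \<subseteq> {x. norm x \<le> L * r}"
  shows "(LBINT t:{0..s}. ball_prob (l * r) t) \<le> expectation (sojourn_time ip X r s)"
    and "expectation (sojourn_time ip X r s) \<le> (LBINT t:{0..s}. ball_prob (L * r) t)"
proof -
  let ?f = "\<lambda>t. prob {\<omega> \<in> space M. Y t \<omega> \<in> ip_cball ip r}"
  have fm [measurable]: "?f \<in> borel_measurable borel" by (rule prob_Y_measurable[OF B])
  have "set_integrable lborel {0..s} ?f"
    unfolding set_integrable_def by (rule integrable_indicator_Icc_bounded[OF fm]) simp_all
  note int = this ball_prob_integrable[where s = 0 and s' = s]
  have eq: "expectation (sojourn_time ip X r s) = (LBINT t:{0..s}. ?f t)"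
    unfolding expectation_sojourn_time[OF s B]
    by (rule set_lebesgue_integral_cong) auto
  have [measurable]: "ip_cball ip r \<in> sets borel" by (rule B)
  show "(LBINT t:{0..s}. ball_prob (l * r) t) \<le> expectation (sojourn_time ip X r s)"
    unfolding eq
    by (rule set_integral_mono[OF int(2,1)])
       (use l in \<open>auto simp: ball_prob_def simp del: Y_eq intro!: finite_measure_mono\<close>)
  show "expectation (sojourn_time ip X r s) \<le> (LBINT t:{0..s}. ball_prob (L * r) t)"
    unfolding eq
    by (rule set_integral_mono[OF int])
       (use L in \<open>auto simp: ball_prob_def simp del: Y_eq intro!: finite_measure_mono\<close>)
qed

theorem lemma2p2:
  fixes M :: "'w measure" and X :: "real \<Rightarrow> 'w \<Rightarrow> real^'n" and c :: real
    and E :: "real^'n \<Rightarrow> real^'n"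
    and p :: nat and q :: "nat \<Rightarrow> real poly" and a \<alpha> :: "nat \<Rightarrow> real"
    and V :: "nat \<Rightarrow> (real^'n) set" and ip :: "real^'n \<Rightarrow> real^'n \<Rightarrow> real"
  assumes "c > 1" and "linear E"
    and "operator_semistable M X c E"
    and "no_gaussian_component M X"
    and "spectral_factorization E p q a"
    and V: "\<And>j. V j = {x. poly_op (q j) E x = 0}"
    and \<alpha>: "\<And>j. \<alpha> j = 1 / a j"
    and "is_inner_product ip"
    and "\<And>i j x y. i \<in> {1..p} \<Longrightarrow> j \<in> {1..p} \<Longrightarrow> i \<noteq> j \<Longrightarrow> x \<in> V i \<Longrightarrow> y \<in> V j \<Longrightarrow> ip x y = 0"
    and E1_diagonal: "\<And>x. x \<in> V 1 \<Longrightarrow> E x = inverse (\<alpha> 1) *\<^sub>R x"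
  shows "(\<alpha> 1 < real (dim (V 1)) \<longrightarrow>
           (\<exists>K4>0. \<exists>K5>0. \<forall>r s. 0 < r \<and> r \<le> 1 \<and> r powr \<alpha> 1 \<le> s \<and> s \<le> 1 \<longrightarrow>
              K4 * r powr \<alpha> 1 \<le> prob_space.expectation M (sojourn_time ip X r s) \<and>
              prob_space.expectation M (sojourn_time ip X r s) \<le> K5 * r powr \<alpha> 1)) \<and>
         (CARD('n) \<ge> 2 \<and> \<alpha> 1 > real (dim (V 1)) \<longrightarrow>
           dim (V 1) = 1 \<and>
           ((\<forall>x\<in>V 2. E x = inverse (\<alpha> 2) *\<^sub>R x) \<longrightarrow>
             (let \<rho> = 1 + \<alpha> 2 * (1 - 1 / \<alpha> 1) in
              \<exists>K6>0. \<exists>K7>0. \<exists>r0>0. \<forall>r s. 0 < r \<and> r \<le> r0 \<and> r powr \<alpha> 2 \<le> s \<and> s \<le> 1 \<longrightarrow>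
                K6 * r powr \<rho> \<le> prob_space.expectation M (sojourn_time ip X r s) \<and>
                prob_space.expectation M (sojourn_time ip X r s) \<le> K7 * r powr \<rho>)))"
proof -
  have inv: "inverse (\<alpha> j) = a j" for j by (simp add: \<alpha>)
  interpret S: spectral E p q a
    by (rule spectral.intro[OF assms(2,5)])
       (use E1_diagonal in \<open>simp add: V inv del: One_nat_def\<close>)
  have V1: "V 1 = S.V1" by (simp add: V S.V1_def)
  interpret semistable M X c E
    using assms(3)
    by (intro semistable.intro levy.intro semistable_axioms.intro assms(1-4))
       (simp add: operator_semistable_def)
  obtain u x where u: "u \<bullet> x = 1" "\<And>y. u \<bullet> E y = a 1 * (u \<bullet> y)" using S.left_eigenvector by blast
  \<comment> \<open>\<open>u\<close> is nonzero because \<open>u \<bullet> x = 1\<close>. Positivity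
    of \<open>a 1\<close> is required before the backward flow can be called contracting.\<close>
  have a_half: "a 1 > 1 / 2" using eigenvalue_gt_half[OF _ u(2)] u(1) by force
  obtain C where C: "C > 0" "\<And>t x. t \<ge> 0 \<Longrightarrow> norm (flow E (-t) x) \<le> C * exp (- a 1 * t) * norm x"
    using S.flow_decay_all by blast
  interpret contracting_semistable M X c E "a 1" C
    by unfold_locales (use a_half C in \<open>auto simp del: One_nat_def\<close>)
  obtain l L where ball: "0 < l" "0 < L" "\<And>r. {x. norm x \<le> l * r} \<subseteq> ip_cball ip r"
    "\<And>r. ip_cball ip r \<subseteq> {x. norm x \<le> L * r}" "\<And>r. ip_cball ip r \<in> sets borel"
    using inner_product_norm_equiv[OF assms(8)] by blast
  note sojourn = expectation_sojourn_time_bounds[OF _ ball(5) ball(3) ball(4)]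
  have part1: "\<exists>K4>0. \<exists>K5>0. \<forall>r s. 0 < r \<and> r \<le> 1 \<and> r powr \<alpha> 1 \<le> s \<and> s \<le> 1 \<longrightarrow>
              K4 * r powr \<alpha> 1 \<le> expectation (sojourn_time ip X r s) \<and>
              expectation (sojourn_time ip X r s) \<le> K5 * r powr \<alpha> 1"
    if d: "\<alpha> 1 < real (dim (V 1))"
  proof -
    obtain K4 where K4: "K4 > 0" "\<And>r s. 0 < r \<Longrightarrow> r \<le> 1 \<Longrightarrow> r powr (1 / a 1) \<le> s \<Longrightarrow>
        K4 * r powr (1 / a 1) \<le> (LBINT t:{0..s}. ball_prob (l * r) t)"
      using sojourn_lower_1[OF ball(1)] by blast
    \<comment> \<open>Enough functionals to bring \<open>n * a 1\<close> above 1: one if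
      \<open>a 1 > 1\<close>. Otherwise \<open>\<alpha> 1 \<ge> 1\<close>, so the hypothesis forces
      dimension at least 2, and two functionals suffice because \<open>a 1 > 1 / 2\<close>.\<close>
    have "\<exists>K n. K > 0 \<and> real n * a 1 > 1 \<and>
      (\<forall>t R. 0 < t \<longrightarrow> t \<le> 1 \<longrightarrow> 0 < R \<longrightarrow> ball_prob R t \<le> K * R ^ n * t powr (- (real n * a 1)))"
    proof (cases "a 1 > 1")
      case True
      obtain K where "K > 0" "\<And>t R. 0 < t \<Longrightarrow> t \<le> 1 \<Longrightarrow> 0 < R \<Longrightarrow> ball_prob R t \<le> K * R * t powr (- a 1)"
        using ball_prob_line[OF u(2) less_imp_le[OF a0] u(1)] by blast
      then show ?thesis using True by (intro exI[of _ K] exI[of _ "1::nat"]) (auto simp del: One_nat_def)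
    next
      case False
      then have "1 \<le> \<alpha> 1" using a0 by (simp add: \<alpha> field_simps)
      then have "dim S.V1 \<ge> 2" using d unfolding V1 by linarith
      from S.left_eigenvector_pair[OF this] obtain u1 u2 x1 x2 where uu:
        "u1 \<bullet> x1 = 1" "u1 \<bullet> x2 = 0" "u2 \<bullet> x1 = 0" "u2 \<bullet> x2 = 1"
        "\<And>y. u1 \<bullet> E y = a 1 * (u1 \<bullet> y)" "\<And>y. u2 \<bullet> E y = a 1 * (u2 \<bullet> y)" by metis
      obtain K where "K > 0"
        "\<And>t R. 0 < t \<Longrightarrow> t \<le> 1 \<Longrightarrow> 0 < R \<Longrightarrow> ball_prob R t \<le> K * R\<^sup>2 * t powr (- (a 1 + a 1))"
        using ball_prob_plane[OF uu(5,6) less_imp_le[OF a0] less_imp_le[OF a0] uu(1-4)] by blast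
      then show ?thesis using a_half
        by (intro exI[of _ K] exI[of _ "2::nat"]) (auto simp del: One_nat_def)
    qed
    then obtain K n where "K > 0" "real n * a 1 > 1"
      "\<And>t R. 0 < t \<Longrightarrow> t \<le> 1 \<Longrightarrow> 0 < R \<Longrightarrow> ball_prob R t \<le> K * R ^ n * t powr (- (real n * a 1))" by blast
    then obtain K5 where K5: "K5 > 0" "\<And>r s. 0 < r \<Longrightarrow> r \<le> 1 \<Longrightarrow> s \<le> 1 \<Longrightarrow>
        (LBINT t:{0..s}. ball_prob (L * r) t) \<le> K5 * r powr (1 / a 1)"
      using sojourn_upper_1[OF _ _ _ ball(2)] by metis
    have "K4 * r powr \<alpha> 1 \<le> expectation (sojourn_time ip X r s) \<and>
        expectation (sojourn_time ip X r s) \<le> K5 * r powr \<alpha> 1"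
      if r: "0 < r" "r \<le> 1" "r powr \<alpha> 1 \<le> s" "s \<le> 1" for r s
    proof
      have s0: "s \<ge> 0" using r(3) powr_ge_zero[of r "\<alpha> 1"] by linarith
      show "K4 * r powr \<alpha> 1 \<le> expectation (sojourn_time ip X r s)"
        using order_trans[OF K4(2) sojourn(1)] r s0 by (simp only: \<alpha>)
      show "expectation (sojourn_time ip X r s) \<le> K5 * r powr \<alpha> 1"
        using order_trans[OF sojourn(2) K5(2)] r s0 by (simp only: \<alpha>)
    qed
    with K4(1) K5(1) show ?thesis by blast
  qed
  \<comment> \<open>\<open>\<alpha> 1 < 2\<close> leaves only dimension 1, as \<open>V 1\<close> is
    not trivial.\<close>
  have d1: "dim (V 1) = 1" if d: "\<alpha> 1 > real (dim (V 1))"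
  proof -
    have "\<alpha> 1 < 2" using a_half by (simp add: \<alpha> field_simps del: One_nat_def)
    with d have "dim (V 1) < 2" by linarith
    then show ?thesis using S.dim_V1_pos unfolding V1 by linarith
  qed
  have part2: "\<exists>K6>0. \<exists>K7>0. \<exists>r0>0. \<forall>r s. 0 < r \<and> r \<le> r0 \<and> r powr \<alpha> 2 \<le> s \<and> s \<le> 1 \<longrightarrow>
                K6 * r powr (1 + \<alpha> 2 * (1 - 1 / \<alpha> 1)) \<le> expectation (sojourn_time ip X r s) \<and>
                expectation (sojourn_time ip X r s) \<le> K7 * r powr (1 + \<alpha> 2 * (1 - 1 / \<alpha> 1))"
    if n: "CARD('n) \<ge> 2" and d: "\<alpha> 1 > real (dim (V 1))"
      and diag2: "\<forall>x\<in>V 2. E x = inverse (\<alpha> 2) *\<^sub>R x"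
  proof -
    have dim1: "dim S.V1 = 1" using d1[OF d] unfolding V1 .
    have "\<alpha> 1 > 1" using d d1[OF d] by simp
    then have a1: "a 1 < 1" using a0 by (simp add: \<alpha> field_simps del: One_nat_def)
    have E2: "E x = a 2 *\<^sub>R x" if "poly_op (q 2) E x = 0" for x using diag2 that by (simp add: V inv)
    obtain u1 u2 x1 x2 C2 where uu:
      "u1 \<bullet> x1 = 1" "u1 \<bullet> x2 = 0" "u2 \<bullet> x1 = 0" "u2 \<bullet> x2 = 1"
      "\<And>y. u1 \<bullet> E y = a 1 * (u1 \<bullet> y)" "\<And>y. u2 \<bullet> E y = a 2 * (u2 \<bullet> y)" "C2 > 0"
      "\<And>t x. t \<ge> 0 \<Longrightarrow> norm (flow E (-t) x) \<le> exp (- a 1 * t) * \<bar>u1 \<bullet> x\<bar> + C2 * exp (- a 2 * t) * norm x"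
      "a 1 < a 2" by (rule S.two_blocks[OF dim1 n E2], assumption) (rule that, assumption+)
    obtain K6 where K6: "K6 > 0" "\<And>r s. 0 < r \<Longrightarrow> r \<le> 1 \<Longrightarrow> r powr (1 / a 2) \<le> s \<Longrightarrow>
        K6 * r powr (1 + (1 / a 2) * (1 - a 1)) \<le> (LBINT t:{0..s}. ball_prob (l * r) t)"
      using sojourn_lower_2[OF uu(5) uu(1) a0 a1 uu(9) uu(7) ball(1) uu(8)] by blast
    obtain K7 where K7: "K7 > 0" "\<And>r s. 0 < r \<Longrightarrow> r \<le> 1 \<Longrightarrow> s \<le> 1 \<Longrightarrow>
        (LBINT t:{0..s}. ball_prob (L * r) t) \<le> K7 * r powr (1 + (1 / a 2) * (1 - a 1))"
      using sojourn_upper_2[OF uu(5,6) a_half a1 uu(9) uu(1-4) ball(2)] by blast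
    have \<rho>: "1 + \<alpha> 2 * (1 - 1 / \<alpha> 1) = 1 + (1 / a 2) * (1 - a 1)" by (simp add: \<alpha>)
    have "K6 * r powr (1 + \<alpha> 2 * (1 - 1 / \<alpha> 1)) \<le> expectation (sojourn_time ip X r s) \<and>
        expectation (sojourn_time ip X r s) \<le> K7 * r powr (1 + \<alpha> 2 * (1 - 1 / \<alpha> 1))"
      if r: "0 < r" "r \<le> 1" "r powr \<alpha> 2 \<le> s" "s \<le> 1" for r s
      unfolding \<rho>
    proof
      have s0: "s \<ge> 0" using r(3) powr_ge_zero[of r "\<alpha> 2"] by linarith
      have s': "r powr (1 / a 2) \<le> s" using r(3) by (simp only: \<alpha>)
      show "K6 * r powr (1 + (1 / a 2) * (1 - a 1)) \<le> expectation (sojourn_time ip X r s)"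
        using K6(2)[OF r(1,2) s'] sojourn(1)[OF s0, of r] by (rule order_trans)
      show "expectation (sojourn_time ip X r s) \<le> K7 * r powr (1 + (1 / a 2) * (1 - a 1))"
        using sojourn(2)[OF s0, of r] K7(2)[OF r(1,2,4)] by (rule order_trans)
    qed
    \<comment> \<open>The witness for \<open>r0\<close> is 1.\<close>
    with K6(1) K7(1) show ?thesis by (meson zero_less_one)
  qed
  show ?thesis
    unfolding Let_def using part1 d1 part2 by blast
qed

end
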